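(* Let $\delta\mathcal{T}^\xi=\frac1m\sum_{\ell=1}^m\delta\mathcal{T}^\xi_\ell$ be the random operator on $L^2(\Omega;\sigma_T)$ defined in the context. Then $$\mathbb{E}\big(\|\delta \mathcal{T}^{\xi}\|^2\big)\le 8\,\mathbb{E}\left[\left(\log\frac{m^{-1}\sum_{\ell=1}^m \operatorname{tr}\left((\delta \mathcal{T}_{\ell}^{\xi})^*\,\delta \mathcal{T}_{\ell}^{\xi}\right)}{m^{-1}\sum_{\ell=1}^m \|\delta \mathcal{T}_{\ell}^{\xi}\|^2}+2.7\right)\frac{1}{m^2}\sum_{\ell=1}^m \|\delta \mathcal{T}_{\ell}^{\xi}\|^2\right],$$ where the quantity inside the outer expectation on the right is read as $0$ when $\sum_\ell\|\delta\mathcal{T}_\ell^\xi\|^2=0$.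
   Context: **Data.** $\Omega=[x_L,x_R]$ is a bounded interval. The cross sections $\sigma_S,\sigma_T$ are strictly positive bounded functions on $\Omega$ (bounded above, and below by positive constants), $\sigma_S\le\sigma_T$. Set $\lambda=\|\sigma_S/\sigma_T\|_\infty\in(0,1)$ and $\sigma_r=\sigma_S/\lambda\le\sigma_T$. The space $L^2(\Omega;\sigma_T)$ has inner product $\langle f,g\rangle=\int_{x_L}^{x_R} f g\,\sigma_T\,dx$; operator norms, adjoints and traces are taken on this space. **Transport operator.** For $\mu\ne0$, $\mathcal{A}_\mu:L^2(\Omega;\sigma_T)\to L^2(\Omega;\sigma_T)$ maps $\varphi$ to the solution $\psi$ of $\mu\,\partial_x\psi+\sigma_T\psi=\sigma_r\varphi$ with $\psi(x_L)=0$ if $\mu>0$ and $\psi(x_R)=0$ if $\mu<0$. **Random ordinates.** Fix $\delta\in(0,1)$ and let $S=[-1,-\delta)\cup(\delta,1]$, $|S|=2(1-\delta)$. Let $n=2m$ be even. $S$ is partitioned into $n$ subintervals $S_1,\dots,S_n$, symmetrically about $0$: $S_1,\dots,S_m$ partition $[-1,-\delta)$ and $S_{n+1-\ell}=-S_\ell$ for $1\le\ell\le m$. Set $\omega_\ell=|S_\ell|/|S|$ and $\alpha_\ell=n\,\omega_\ell$. The random ordinates $\mu^\xi_\ell$, $1\le\ell\le m$, are independent, $\mu_\ell^\xi$ is uniformly distributed in $S_\ell$, and $\mu^\xi_{n+1-\ell}=-\mu^\xi_\ell$. $\mathbb{E}$ is expectation over the random ordinates. **Operators.** $\mathcal{T}^\xi_\ell=\alpha_\ell\mathcal{A}_{\mu_\ell^\xi}$,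 $\mathcal{T}_\ell=\frac{n}{|S|}\int_{S_\ell}\mathcal{A}_\mu\,d\mu$ for $1\le\ell\le n$; $\mathcal{T}^\xi=\frac1n\sum_{\ell=1}^n\mathcal{T}_\ell^\xi$, $\mathcal{T}=\frac1{|S|}\int_S\mathcal{A}_\mu\,d\mu$. For $1\le\ell\le m$, $$\delta\mathcal{T}^\xi_\ell=\tfrac12\left(\mathcal{T}_\ell^\xi-\mathcal{T}_\ell+\mathcal{T}_{n+1-\ell}^\xi-\mathcal{T}_{n+1-\ell}\right),\qquad \delta\mathcal{T}^\xi=\mathcal{T}^\xi-\mathcal{T}=\frac1m\sum_{\ell=1}^m\delta\mathcal{T}_\ell^\xi .$$ *)

theory Defs
  imports "HOL-Probability.Probability"
begin

section \<open>Operators on the real Hilbert space of square-integrable functions\<close>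

text \<open>
  Elements of the \<open>L\<^sup>2\<close> space of a measure \<open>M\<close> are represented by functions; two functions that
  agree almost everywhere represent the same element, and the value of a function outside
  \<open>space M\<close> is irrelevant.  Operators are maps on representatives.
\<close>

definition L2 :: "'a measure \<Rightarrow> ('a \<Rightarrow> real) set" where
  "L2 M = {f \<in> borel_measurable M. integrable M (\<lambda>x. (f x)\<^sup>2)}"

definition L2_inner :: "'a measure \<Rightarrow> ('a \<Rightarrow> real) \<Rightarrow> ('a \<Rightarrow> real) \<Rightarrow> real" where
  "L2_inner M f g = (\<integral>x. f x * g x \<partial>M)"

definition L2_norm :: "'a measure \<Rightarrow> ('a \<Rightarrow> real) \<Rightarrow> real" where
  "L2_norm M f = sqrt (L2_inner M f f)"

text \<open>The next two definitions follow \<^const>\<open>onorm\<close> and \<^const>\<open>adjoint\<close>; the supremum is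
  meaningful for bounded operators, and the adjoint is determined up to a.e. equality.\<close>

definition L2_onorm :: "'a measure \<Rightarrow> (('a \<Rightarrow> real) \<Rightarrow> 'a \<Rightarrow> real) \<Rightarrow> real" where
  "L2_onorm M T = (SUP f\<in>L2 M. L2_norm M (T f) / L2_norm M f)"

definition L2_adjoint ::
  "'a measure \<Rightarrow> (('a \<Rightarrow> real) \<Rightarrow> 'a \<Rightarrow> real) \<Rightarrow> ('a \<Rightarrow> real) \<Rightarrow> 'a \<Rightarrow> real" where
  "L2_adjoint M T = (SOME T'. (\<forall>g\<in>L2 M. T' g \<in> L2 M) \<and>
     (\<forall>f\<in>L2 M. \<forall>g\<in>L2 M. L2_inner M (T f) g = L2_inner M f (T' g)))"

text \<open>An orthonormal basis is a maximal orthonormal set.  Distinct elements of \<open>E\<close> are never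
  a.e. equal, because their inner product vanishes.\<close>

definition L2_onb :: "'a measure \<Rightarrow> ('a \<Rightarrow> real) set \<Rightarrow> bool" where
  "L2_onb M E \<longleftrightarrow> E \<subseteq> L2 M \<and>
     (\<forall>e\<in>E. \<forall>e'\<in>E. L2_inner M e e' = (if e = e' then 1 else 0)) \<and>
     (\<forall>f\<in>L2 M. (\<forall>e\<in>E. L2_inner M f e = 0) \<longrightarrow> (AE x in M. f x = 0))"

text \<open>For trace-class operators the value does not depend on the orthonormal basis chosen.\<close>

definition L2_trace :: "'a measure \<Rightarrow> (('a \<Rightarrow> real) \<Rightarrow> 'a \<Rightarrow> real) \<Rightarrow> real" where
  "L2_trace M B = (let E = (SOME E. L2_onb M E) in \<Sum>\<^sub>\<infinity>e\<in>E. L2_inner M (B e) e)"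

section \<open>The transport operator\<close>

text \<open>The measure \<open>\<sigma>\<^sub>T dx\<close> on \<open>\<Omega> = [x\<^sub>L, x\<^sub>R]\<close>; its space is \<open>\<Omega>\<close>, and \<open>L2\<close> of it is
  \<open>L\<^sup>2(\<Omega>; \<sigma>\<^sub>T)\<close>.\<close>

definition transport_measure :: "real \<Rightarrow> real \<Rightarrow> (real \<Rightarrow> real) \<Rightarrow> real measure" where
  "transport_measure xL xR \<sigma>T = density (lebesgue_on {xL..xR}) (\<lambda>x. ennreal (\<sigma>T x))"

text \<open>\<open>\<lambda> = \<parallel>\<sigma>\<^sub>S / \<sigma>\<^sub>T\<parallel>\<^sub>\<infinity>\<close>.\<close>

definition scattering_ratio ::
  "real \<Rightarrow> real \<Rightarrow> (real \<Rightarrow> real) \<Rightarrow> (real \<Rightarrow> real) \<Rightarrow> real" where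
  "scattering_ratio xL xR \<sigma>S \<sigma>T =
     real_of_ereal (esssup (lebesgue_on {xL..xR}) (\<lambda>x. ereal \<bar>\<sigma>S x / \<sigma>T x\<bar>))"

definition reduced_cross_section ::
  "real \<Rightarrow> real \<Rightarrow> (real \<Rightarrow> real) \<Rightarrow> (real \<Rightarrow> real) \<Rightarrow> real \<Rightarrow> real" where
  "reduced_cross_section xL xR \<sigma>S \<sigma>T x = \<sigma>S x / scattering_ratio xL xR \<sigma>S \<sigma>T"

text \<open>\<open>\<psi>\<close> is absolutely continuous on \<open>[a, b]\<close> with derivative \<open>\<psi>'\<close>, equivalently it is the
  continuous representative of a \<open>W\<^sup>1\<^sup>,\<^sup>1\<close> function with weak derivative \<open>\<psi>'\<close>.  The cross
  sections are merely bounded, so classical derivatives need not exist.\<close>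

definition has_L1_deriv_on ::
  "(real \<Rightarrow> real) \<Rightarrow> (real \<Rightarrow> real) \<Rightarrow> real \<Rightarrow> real \<Rightarrow> bool" where
  "has_L1_deriv_on \<psi> \<psi>' a b \<longleftrightarrow> \<psi>' absolutely_integrable_on {a..b} \<and>
     (\<forall>x\<in>{a..b}. \<psi> x = \<psi> a + integral {a..x} \<psi>')"

definition transport_solution ::
  "real \<Rightarrow> real \<Rightarrow> (real \<Rightarrow> real) \<Rightarrow> (real \<Rightarrow> real) \<Rightarrow> real \<Rightarrow> (real \<Rightarrow> real) \<Rightarrow>
   (real \<Rightarrow> real) \<Rightarrow> bool" where
  "transport_solution xL xR \<sigma>T \<sigma>r \<mu> \<phi> \<psi> \<longleftrightarrow>
     (\<exists>\<psi>'. has_L1_deriv_on \<psi> \<psi>' xL xR \<and>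
        (AE x in lebesgue_on {xL..xR}. \<mu> * \<psi>' x + \<sigma>T x * \<psi> x = \<sigma>r x * \<phi> x)) \<and>
     (\<mu> > 0 \<longrightarrow> \<psi> xL = 0) \<and> (\<mu> < 0 \<longrightarrow> \<psi> xR = 0)"

text \<open>\<open>\<A>\<^sub>\<mu>\<close>, for \<open>\<mu> \<noteq> 0\<close>.  The solution is unique on \<open>\<Omega>\<close>; it is extended by \<open>0\<close>
  so that the description picks out a single function.\<close>

definition transport_op ::
  "real \<Rightarrow> real \<Rightarrow> (real \<Rightarrow> real) \<Rightarrow> (real \<Rightarrow> real) \<Rightarrow> real \<Rightarrow> (real \<Rightarrow> real) \<Rightarrow> real \<Rightarrow> real" where
  "transport_op xL xR \<sigma>S \<sigma>T \<mu> \<phi> =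
     (THE \<psi>. transport_solution xL xR \<sigma>T (reduced_cross_section xL xR \<sigma>S \<sigma>T) \<mu> \<phi> \<psi> \<and>
             (\<forall>x. x \<notin> {xL..xR} \<longrightarrow> \<psi> x = 0))"

section \<open>Random ordinates\<close>

definition ordinate_domain :: "real \<Rightarrow> real set" where
  "ordinate_domain \<delta> = {-1..<-\<delta>} \<union> {\<delta><..1}"

text \<open>In the following, \<open>A\<close> is the family of transport operators, \<open>S\<close> the family of
  subintervals, indexed by \<open>{1..2 * m}\<close>, and \<open>\<mu>\<close> a realization of the \<open>n = 2 * m\<close> ordinates.\<close>

definition ordinate_weight :: "real \<Rightarrow> (nat \<Rightarrow> real set) \<Rightarrow> nat \<Rightarrow> real" where
  "ordinate_weight \<delta> S l = measure lborel (S l) / measure lborel (ordinate_domain \<delta>)"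

definition sampled_op ::
  "(real \<Rightarrow> (real \<Rightarrow> real) \<Rightarrow> real \<Rightarrow> real) \<Rightarrow> real \<Rightarrow> nat \<Rightarrow> (nat \<Rightarrow> real set) \<Rightarrow>
   (nat \<Rightarrow> real) \<Rightarrow> nat \<Rightarrow> (real \<Rightarrow> real) \<Rightarrow> real \<Rightarrow> real" where
  "sampled_op A \<delta> m S \<mu> l = (\<lambda>\<phi> x. real (2 * m) * ordinate_weight \<delta> S l * A (\<mu> l) \<phi> x)"

text \<open>The operator-valued integral is evaluated pointwise on the continuous representatives
  \<open>\<A>\<^sub>\<nu> \<phi>\<close>.\<close>

definition averaged_op ::
  "(real \<Rightarrow> (real \<Rightarrow> real) \<Rightarrow> real \<Rightarrow> real) \<Rightarrow> real \<Rightarrow> nat \<Rightarrow> (nat \<Rightarrow> real set) \<Rightarrow>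
   nat \<Rightarrow> (real \<Rightarrow> real) \<Rightarrow> real \<Rightarrow> real" where
  "averaged_op A \<delta> m S l = (\<lambda>\<phi> x.
     real (2 * m) / measure lborel (ordinate_domain \<delta>) * (LBINT \<nu>:S l. A \<nu> \<phi> x))"

definition delta_op_at ::
  "(real \<Rightarrow> (real \<Rightarrow> real) \<Rightarrow> real \<Rightarrow> real) \<Rightarrow> real \<Rightarrow> nat \<Rightarrow> (nat \<Rightarrow> real set) \<Rightarrow>
   (nat \<Rightarrow> real) \<Rightarrow> nat \<Rightarrow> (real \<Rightarrow> real) \<Rightarrow> real \<Rightarrow> real" where
  "delta_op_at A \<delta> m S \<mu> l = (\<lambda>\<phi> x. 1 / 2 *
     (sampled_op A \<delta> m S \<mu> l \<phi> x - averaged_op A \<delta> m S l \<phi> x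
      + sampled_op A \<delta> m S \<mu> (2 * m + 1 - l) \<phi> x - averaged_op A \<delta> m S (2 * m + 1 - l) \<phi> x))"

definition delta_op ::
  "(real \<Rightarrow> (real \<Rightarrow> real) \<Rightarrow> real \<Rightarrow> real) \<Rightarrow> real \<Rightarrow> nat \<Rightarrow> (nat \<Rightarrow> real set) \<Rightarrow>
   (nat \<Rightarrow> real) \<Rightarrow> (real \<Rightarrow> real) \<Rightarrow> real \<Rightarrow> real" where
  "delta_op A \<delta> m S \<mu> = (\<lambda>\<phi> x. 1 / real m * (\<Sum>l = 1..m. delta_op_at A \<delta> m S \<mu> l \<phi> x))"

end

theory Submission
  imports Defs
begin

text \<open>
  Write \<open>X\<^sub>l\<close> for the fluctuation of the \<open>l\<close>-th pair of ordinates, \<open>a\<^sub>l\<close> for its operator norm,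
  \<open>s\<^sub>l = tr (X\<^sub>l* X\<^sub>l)\<close>, \<open>V = \<Sum> a\<^sub>l\<^sup>2\<close> and \<open>r = (\<Sum> s\<^sub>l) / V\<close>.  The \<open>X\<^sub>l\<close> are independent and
  centred, so the sum can be symmetrized, and conditionally on the ordinates one is left with
  a Rademacher sum of fixed Hilbert-Schmidt operators.

  Symmetrization.  The squared operator norm is the supremum of \<open>\<langle>X f, g\<rangle>\<^sup>2\<close> over pairs of
  functions of norm at most one.  If \<open>x\<close> is centred, then \<open>z = \<bbbE> (z - 2 x)\<close> and
  \<open>(z + x)\<^sup>2 \<le> 1/2 (z + 2 x)\<^sup>2 + 1/2 z\<^sup>2\<close>, so that replacing \<open>x\<close> by \<open>2 \<epsilon> x\<close> with a random sign
  \<open>\<epsilon>\<close> does not decrease the expected supremum of the squares.  Doing this for one summand after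
  the other (\<open>symmetrization_product\<close>) gives \<open>\<bbbE> \<parallel>\<Sum> X\<^sub>l\<parallel>\<^sup>2 \<le> 4 \<bbbE> \<parallel>\<Sum> \<epsilon>\<^sub>l X\<^sub>l\<parallel>\<^sup>2\<close>.

  Rademacher sums.  Let \<open>Y = \<Sum> \<epsilon>\<^sub>l X\<^sub>l\<close> with symmetric matrices \<open>X\<^sub>l\<close>.  In the expansion of
  \<open>\<bbbE> tr (Y ^ (2 p))\<close> only the words survive in which each index occurs an even number of times.
  The first letter \<open>j\<close> of such a word occurs once more, and estimating these two letters by their
  Hilbert-Schmidt norm and all others by their operator norm bounds the trace of the word by
  \<open>s\<^sub>j / a\<^sub>j\<^sup>2\<close> times the product of the numbers \<open>a\<^sub>l\<close> over its letters.  The noncommutative moment is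
  thereby at most \<open>\<Sum>\<^sub>j s\<^sub>j / a\<^sub>j \<cdot> \<bbbE> (\<epsilon>\<^sub>j (\<Sum> \<epsilon>\<^sub>l a\<^sub>l) ^ (2 p - 1))\<close>, a scalar quantity, which is at
  most \<open>r V ^ p (2 p)! / (2 ^ p p!)\<close> by comparison with a Gaussian.  The case distinction by words
  is carried out on the mixed moments \<open>\<bbbE> (\<Prod> \<epsilon>\<^sub>l ^ n\<^sub>l \<cdot> Y ^ k)\<close>, which satisfy the same recursion in \<open>k\<close>
  as their scalar analogues (\<open>bilinear_bound_monomial_mean\<close>, \<open>hs_norm_monomial_mean\<close>).  Summation
  against the series of \<open>cosh\<close> gives \<open>\<bbbE> \<parallel>Y\<parallel>\<^sup>2 \<le> 2 V ln (2 r)\<close>, and \<open>2 V ln (4 r)\<close> for matrices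
  that are not symmetric.  As \<open>ln 4 < 2.7\<close>, the two steps together produce the constant \<open>8\<close>.

  From matrices to operators.  Parseval's identity for a maximal orthonormal set, that is,
  completeness of \<open>L\<^sup>2\<close>, allows the finitely many test functions in question to be replaced by
  their projections to the span of a finite part of the basis; the matrix estimate for these
  compressions has constants that involve the operators only through \<open>a\<^sub>l\<close> and \<open>s\<^sub>l\<close>
  (\<open>rademacher_onorm_second_moment\<close>).

  Transport.  With the optical depth as coordinate, an integrating factor solves the transport
  equation explicitly, and \<open>\<A>\<^sub>\<mu>\<close> becomes an integral operator (\<open>transport_op_kernel\<close>) whose kernel is
  bounded, and Lipschitz in \<open>\<mu>\<close>, for \<open>\<bar>\<mu>\<bar> \<ge> \<delta>\<close>.  Bounded kernels give adjoints and finite traces;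
  the Lipschitz dependence makes norms, traces and suprema measurable in the ordinates.
\<close>

section \<open>Averages over independent signs\<close>

text \<open>
  Sign vectors are taken to be undefined outside \<open>L\<close>, which makes them a finite set of
  \<open>2 ^ card L\<close> elements.
\<close>

definition rademacher_mean :: "'l set \<Rightarrow> (('l \<Rightarrow> real) \<Rightarrow> real) \<Rightarrow> real" where
  "rademacher_mean L f = (\<Sum>\<epsilon>\<in>PiE L (\<lambda>_. {-1, 1}). f \<epsilon>) / 2 ^ card L"

lemma rademacher_mean_add:
  "rademacher_mean L (\<lambda>\<epsilon>. f \<epsilon> + g \<epsilon>) = rademacher_mean L f + rademacher_mean L g"
  by (simp add: rademacher_mean_def sum.distrib add_divide_distrib)

lemma rademacher_mean_cmult:
  "rademacher_mean L (\<lambda>\<epsilon>. c * f \<epsilon>) = c * rademacher_mean L f"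
  by (simp add: rademacher_mean_def sum_distrib_left)

lemma rademacher_mean_sum:
  "rademacher_mean L (\<lambda>\<epsilon>. \<Sum>j\<in>J. f j \<epsilon>) = (\<Sum>j\<in>J. rademacher_mean L (f j))"
  unfolding rademacher_mean_def sum_divide_distrib[symmetric] by (subst sum.swap) simp

lemma rademacher_mean_cong:
  assumes "\<And>\<epsilon>. \<epsilon> \<in> PiE L (\<lambda>_. {-1, 1}) \<Longrightarrow> f \<epsilon> = g \<epsilon>"
  shows "rademacher_mean L f = rademacher_mean L g"
  using assms by (simp add: rademacher_mean_def)

lemma rademacher_mean_mono:
  assumes "\<And>\<epsilon>. \<epsilon> \<in> PiE L (\<lambda>_. {-1, 1}) \<Longrightarrow> f \<epsilon> \<le> g \<epsilon>"
  shows "rademacher_mean L f \<le> rademacher_mean L g"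
  using assms by (auto simp: rademacher_mean_def intro!: divide_right_mono sum_mono)

lemma card_sign_vectors: "finite L \<Longrightarrow> card (PiE L (\<lambda>_. {-1, 1::real})) = 2 ^ card L"
  by (simp add: card_PiE numeral_2_eq_2)

lemma rademacher_mean_const: "finite L \<Longrightarrow> rademacher_mean L (\<lambda>_. c) = c"
  by (simp add: rademacher_mean_def card_sign_vectors)

text \<open>
  Conditioning on one sign; averages over more signs are reduced to this step.
\<close>

lemma rademacher_mean_insert:
  assumes "finite L" "k \<notin> L"
  shows "rademacher_mean (insert k L) f =
    1/2 * rademacher_mean L (\<lambda>\<epsilon>. f (\<epsilon>(k := 1))) + 1/2 * rademacher_mean L (\<lambda>\<epsilon>. f (\<epsilon>(k := -1)))"
proof -
  have "inj_on (\<lambda>(y, g). g(k := y)) ({-1, 1} \<times> PiE L (\<lambda>_. {-1, 1::real}))"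
    using inj_combinator[OF assms(2), of "\<lambda>_. {-1, 1::real}"] by simp
  then have "(\<Sum>\<epsilon>\<in>PiE (insert k L) (\<lambda>_. {-1, 1}). f \<epsilon>)
     = (\<Sum>(y, g)\<in>{-1, 1} \<times> PiE L (\<lambda>_. {-1, 1}). f (g(k := y)))"
    unfolding PiE_insert_eq by (subst sum.reindex) (auto intro!: sum.cong)
  also have "\<dots> = (\<Sum>y\<in>{-1, 1}. \<Sum>g\<in>PiE L (\<lambda>_. {-1, 1}). f (g(k := y)))"
    by (rule sum.cartesian_product[symmetric])
  finally show ?thesis
    using assms by (simp add: rademacher_mean_def field_simps)
qed

lemma rademacher_mean_flip:
  assumes "finite L" "j \<in> L"
  shows "rademacher_mean L (\<lambda>\<epsilon>. f (\<epsilon>(j := - \<epsilon> j))) = rademacher_mean L f"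
proof -
  obtain K where K: "L = insert j K" "j \<notin> K" using assms(2) by (meson mk_disjoint_insert)
  then show ?thesis using assms(1) by (simp add: rademacher_mean_insert)
qed

text \<open>
  The signs are independent and centred, and an even power of a sign is \<open>1\<close>.
\<close>

lemma rademacher_mean_monomial:
  assumes "finite L"
  shows "rademacher_mean L (\<lambda>\<epsilon>. \<Prod>l\<in>L. \<epsilon> l ^ n l) = (if \<forall>l\<in>L. even (n l) then 1 else 0)"
  using assms
proof (induction L)
  case empty then show ?case by (simp add: rademacher_mean_const)
next
  case (insert k L)
  have *: "(\<Prod>l\<in>insert k L. (\<epsilon>(k := s)) l ^ n l) = s ^ n k * (\<Prod>l\<in>L. \<epsilon> l ^ n l)" for \<epsilon> and s :: real
    using insert.hyps by (simp cong: prod.cong_simp) (rule disjI2, rule prod.cong, auto)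
  show ?case
    unfolding rademacher_mean_insert[OF insert.hyps] * rademacher_mean_cmult insert.IH by simp
qed

lemma rademacher_mean_power_mean:
  assumes "finite L" "p \<ge> 1" "\<And>\<epsilon>. f \<epsilon> \<ge> 0"
  shows "rademacher_mean L f ^ p \<le> rademacher_mean L (\<lambda>\<epsilon>. f \<epsilon> ^ p)"
proof -
  let ?S = "PiE L (\<lambda>_. {-1, 1::real})"
  have fin: "finite ?S" using assms(1) by (simp add: finite_PiE)
  have ne: "?S \<noteq> {}" by (simp add: PiE_eq_empty_iff)
  have cv: "convex_on {0::real..} (\<lambda>x. x ^ p)"
    by (cases "even p") (auto intro: convex_on_subset[OF convex_power_even] convex_power_odd)
  have "(\<Sum>\<epsilon>\<in>?S. (1 / 2 ^ card L) *\<^sub>R f \<epsilon>) ^ p \<le> (\<Sum>\<epsilon>\<in>?S. (1 / 2 ^ card L) * f \<epsilon> ^ p)"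
    by (rule convex_on_sum[OF fin ne cv]) (use assms in \<open>auto simp: card_sign_vectors\<close>)
  then show ?thesis by (simp add: rademacher_mean_def sum_divide_distrib)
qed

section \<open>Scalar moments\<close>

text \<open>
  The Hermite-Hadamard inequality for the convex function \<open>n t ^ (n - 1)\<close>.  In the factorization of
  \<open>x ^ n - y ^ n\<close> the terms \<open>x ^ q y ^ r\<close> and \<open>x ^ r y ^ q\<close> are paired: as \<open>q + r\<close> is even,
  \<open>x ^ q - y ^ q\<close> and \<open>x ^ r - y ^ r\<close> never have opposite signs.
\<close>

lemma odd_power_diff_le:
  fixes x y :: real
  assumes "odd n" "y \<le> x"
  shows "x ^ n - y ^ n \<le> real n * (x - y) * ((x ^ (n - 1) + y ^ (n - 1)) / 2)"
proof -
  obtain k where n: "n = Suc k" "even k" using assms(1) by (cases n) auto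
  have pair: "x ^ q * y ^ r + x ^ r * y ^ q \<le> x ^ (q + r) + y ^ (q + r)" if "even (q + r)" for q r
  proof -
    have "0 \<le> (x ^ q - y ^ q) * (x ^ r - y ^ r)"
    proof (cases "even q")
      case True
      then have "even r" using that by simp
      show ?thesis
      proof (cases "\<bar>y\<bar> \<le> \<bar>x\<bar>")
        case True
        then have "y ^ q \<le> x ^ q" "y ^ r \<le> x ^ r"
          using \<open>even q\<close> \<open>even r\<close> by (metis power_even_abs power_mono abs_ge_zero)+
        then show ?thesis by simp
      next
        case False
        then have "x ^ q \<le> y ^ q" "x ^ r \<le> y ^ r"
          using \<open>even q\<close> \<open>even r\<close> by (metis power_even_abs power_mono abs_ge_zero nle_le)+
        then show ?thesis by (simp add: mult_nonpos_nonpos)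
      qed
    next
      case False
      then have "odd r" using that by simp
      then have "y ^ q \<le> x ^ q" "y ^ r \<le> x ^ r"
        using \<open>odd q\<close> \<open>y \<le> x\<close> by (auto intro: power_mono_odd)
      then show ?thesis by simp
    qed
    then show ?thesis by (simp add: algebra_simps power_add)
  qed
  have "2 * (\<Sum>p<Suc k. x ^ p * y ^ (k - p)) = 
      (\<Sum>p<Suc k. x ^ p * y ^ (k - p)) + (\<Sum>p<Suc k. x ^ (k - p) * y ^ p)"
    by (subst (3) sum.nat_diff_reindex[symmetric]) (auto intro!: sum.cong)
  also have "\<dots> = (\<Sum>p<Suc k. x ^ p * y ^ (k - p) + x ^ (k - p) * y ^ p)"
    by (simp add: sum.distrib)
  also have "\<dots> \<le> (\<Sum>p<Suc k. x ^ k + y ^ k)"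
  proof (rule sum_mono)
    fix p assume "p \<in> {..<Suc k}"
    then show "x ^ p * y ^ (k - p) + x ^ (k - p) * y ^ p \<le> x ^ k + y ^ k"
      using pair[of p "k - p"] n by simp
  qed
  also have "\<dots> = real n * (x ^ k + y ^ k)" using n by simp
  finally have "(x - y) * (2 * (\<Sum>p<Suc k. x ^ p * y ^ (k - p))) \<le> (x - y) * (real n * (x ^ k + y ^ k))"
    using assms(2) by (intro mult_left_mono) auto
  moreover have "x ^ n - y ^ n = (x - y) * (\<Sum>p<Suc k. x ^ p * y ^ (k - p))"
    unfolding n(1) by (rule diff_power_eq_sum)
  ultimately show ?thesis using n by (simp add: field_simps)
qed

text \<open>
  The discrete form of \<open>\<bbbE> (g F(Z)) = a \<bbbE> (F'(Z))\<close> for a Gaussian \<open>g\<close>.  Averaging over the flip of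
  \<open>\<epsilon> j\<close>, which moves the sum by \<open>2 a j\<close>, leaves a difference of \<open>n\<close>-th powers.
\<close>

lemma rademacher_integration_by_parts:
  assumes "finite L" "j \<in> L" "a j \<ge> 0" "odd n"
  shows "rademacher_mean L (\<lambda>\<epsilon>. \<epsilon> j * (\<Sum>l\<in>L. \<epsilon> l * a l) ^ n)
     \<le> real n * a j * rademacher_mean L (\<lambda>\<epsilon>. (\<Sum>l\<in>L. \<epsilon> l * a l) ^ (n - 1))"
proof -
  let ?Z = "\<lambda>\<epsilon>. \<Sum>l\<in>L. \<epsilon> l * a l"
  let ?f = "\<lambda>\<epsilon>::'a \<Rightarrow> real. \<epsilon>(j := - \<epsilon> j)"
  have Zf: "?Z (?f \<epsilon>) = ?Z \<epsilon> - 2 * \<epsilon> j * a j" for \<epsilon>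
    using assms(1,2) by (simp add: sum.remove[of L j] cong: sum.cong_simp)
  have "rademacher_mean L (\<lambda>\<epsilon>. \<epsilon> j * ?Z \<epsilon> ^ n) =
    1/2 * rademacher_mean L (\<lambda>\<epsilon>. \<epsilon> j * ?Z \<epsilon> ^ n) + 1/2 * rademacher_mean L (\<lambda>\<epsilon>. ?f \<epsilon> j * ?Z (?f \<epsilon>) ^ n)"
    by (subst rademacher_mean_flip[OF assms(1,2), of "\<lambda>\<epsilon>. \<epsilon> j * ?Z \<epsilon> ^ n"]) simp
  also have "\<dots> = rademacher_mean L (\<lambda>\<epsilon>. 1/2 * (\<epsilon> j * ?Z \<epsilon> ^ n) + 1/2 * (?f \<epsilon> j * ?Z (?f \<epsilon>) ^ n))"
    by (simp only: rademacher_mean_add rademacher_mean_cmult)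
  also have "\<dots> \<le> rademacher_mean L (\<lambda>\<epsilon>. real n * a j * (1/2 * ?Z \<epsilon> ^ (n - 1) + 1/2 * ?Z (?f \<epsilon>) ^ (n - 1)))"
  proof (rule rademacher_mean_mono)
    fix \<epsilon> :: "'a \<Rightarrow> real" assume "\<epsilon> \<in> PiE L (\<lambda>_. {-1, 1})"
    then have "\<epsilon> j = 1 \<or> \<epsilon> j = -1" using assms(2) by (auto simp: PiE_def Pi_def)
    then consider "\<epsilon> j = 1" | "\<epsilon> j = -1" by blast
    then show "1/2 * (\<epsilon> j * ?Z \<epsilon> ^ n) + 1/2 * (?f \<epsilon> j * ?Z (?f \<epsilon>) ^ n)
      \<le> real n * a j * (1/2 * ?Z \<epsilon> ^ (n - 1) + 1/2 * ?Z (?f \<epsilon>) ^ (n - 1))"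
    proof cases
      case 1
      define z z' where "z = ?Z \<epsilon>" and "z' = ?Z (?f \<epsilon>)"
      have "z' = z - 2 * a j" using Zf[of \<epsilon>] 1 by (simp add: z_def z'_def)
      then have "z ^ n - z' ^ n \<le> real n * (2 * a j) * ((z ^ (n - 1) + z' ^ (n - 1)) / 2)"
        using odd_power_diff_le[OF assms(4), of z' z] assms(3) by simp
      then have "1/2 * (1 * z ^ n) + 1/2 * (- 1 * z' ^ n) \<le> real n * a j * (1/2 * z ^ (n - 1) + 1/2 * z' ^ (n - 1))"
        by (simp add: algebra_simps)
      moreover have "?f \<epsilon> j = -1" using 1 by simp
      ultimately show ?thesis unfolding z_def z'_def 1 by (simp only:)
    next
      case 2
      define z z' where "z = ?Z \<epsilon>" and "z' = ?Z (?f \<epsilon>)"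
      have "z' = z + 2 * a j" using Zf[of \<epsilon>] 2 by (simp add: z_def z'_def)
      then have "z' ^ n - z ^ n \<le> real n * (2 * a j) * ((z' ^ (n - 1) + z ^ (n - 1)) / 2)"
        using odd_power_diff_le[OF assms(4), of z z'] assms(3) by simp
      then have "1/2 * (- 1 * z ^ n) + 1/2 * (1 * z' ^ n) \<le> real n * a j * (1/2 * z ^ (n - 1) + 1/2 * z' ^ (n - 1))"
        by (simp add: algebra_simps)
      moreover have "?f \<epsilon> j = 1" using 2 by simp
      ultimately show ?thesis unfolding z_def z'_def 2 by (simp only:)
    qed
  qed
  also have "\<dots> = real n * a j * (1/2 * rademacher_mean L (\<lambda>\<epsilon>. ?Z \<epsilon> ^ (n - 1)) + 1/2 * rademacher_mean L (\<lambda>\<epsilon>. ?Z (?f \<epsilon>) ^ (n - 1)))"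
    by (simp only: rademacher_mean_add rademacher_mean_cmult)
  also have "\<dots> = real n * a j * rademacher_mean L (\<lambda>\<epsilon>. ?Z \<epsilon> ^ (n - 1))"
    by (subst rademacher_mean_flip[OF assms(1,2), of "\<lambda>\<epsilon>. ?Z \<epsilon> ^ (n - 1)"]) simp
  finally show ?thesis .
qed

lemma double_factorial_step:
  "fact (2 * Suc p) / ((2::real) ^ Suc p * fact (Suc p)) = real (2 * p + 1) * (fact (2 * p) / (2 ^ p * fact p))"
proof -
  have "fact (2 * Suc p) = real (2 * p + 2) * (real (2 * p + 1) * (fact (2 * p) :: real))"
    by (simp add: fact_Suc algebra_simps)
  moreover have "(2::real) ^ Suc p * fact (Suc p) = real (2 * p + 2) * (2 ^ p * fact p)"
    by (simp add: fact_Suc algebra_simps)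
  moreover have *: "x / y = s * (f / g)" if "x = r * (s * f)" "y = r * g" "r \<noteq> 0" for x y r s f g :: real
    using that by simp
  ultimately show ?thesis by (intro *) auto
qed

text \<open>
  The factor \<open>(2 p)! / (2 ^ p p!) = (2 p - 1)!!\<close> is the moment of order \<open>2 p\<close> of a standard Gaussian;
  integration by parts gives its recursion.
\<close>

lemma rademacher_moment_le:
  assumes "finite L" "\<And>l. l \<in> L \<Longrightarrow> a l \<ge> 0"
  shows "rademacher_mean L (\<lambda>\<epsilon>. (\<Sum>l\<in>L. \<epsilon> l * a l) ^ (2 * p))
    \<le> (\<Sum>l\<in>L. (a l)\<^sup>2) ^ p * (fact (2 * p) / (2 ^ p * fact p))"
proof (induction p)
  case 0
  then show ?case using assms(1) by (simp add: rademacher_mean_const)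
next
  case (Suc p)
  let ?Z = "\<lambda>\<epsilon>. \<Sum>l\<in>L. \<epsilon> l * a l"
  let ?V = "\<Sum>l\<in>L. (a l)\<^sup>2"
  have "rademacher_mean L (\<lambda>\<epsilon>. ?Z \<epsilon> ^ (2 * Suc p)) =
     rademacher_mean L (\<lambda>\<epsilon>. \<Sum>j\<in>L. a j * (\<epsilon> j * ?Z \<epsilon> ^ (2 * p + 1)))"
    by (rule rademacher_mean_cong) (simp add: sum_distrib_left sum_distrib_right algebra_simps)
  also have "\<dots> = (\<Sum>j\<in>L. a j * rademacher_mean L (\<lambda>\<epsilon>. \<epsilon> j * ?Z \<epsilon> ^ (2 * p + 1)))"
    by (simp only: rademacher_mean_sum rademacher_mean_cmult)
  also have "\<dots> \<le> (\<Sum>j\<in>L. a j * (real (2 * p + 1) * a j * rademacher_mean L (\<lambda>\<epsilon>. ?Z \<epsilon> ^ (2 * p + 1 - 1))))"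
    by (intro sum_mono mult_left_mono rademacher_integration_by_parts assms) auto
  also have "\<dots> = real (2 * p + 1) * ?V * rademacher_mean L (\<lambda>\<epsilon>. ?Z \<epsilon> ^ (2 * p))"
    by (simp add: sum_distrib_left sum_distrib_right power2_eq_square algebra_simps)
  also have "\<dots> \<le> real (2 * p + 1) * ?V * (?V ^ p * (fact (2 * p) / (2 ^ p * fact p)))"
    by (intro mult_left_mono Suc.IH mult_nonneg_nonneg sum_nonneg) auto
  also have "\<dots> = ?V ^ Suc p * (fact (2 * Suc p) / (2 ^ Suc p * fact (Suc p)))"
    by (subst double_factorial_step) (simp only: power_Suc mult_ac)
  finally show ?case .
qed

section \<open>Finite matrices\<close>

text \<open>
  Matrices are functions together with an explicit finite index set, because the index sets below
  are finite subsets of an orthonormal basis that are chosen in the course of a proof.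
\<close>

definition matmul :: "'i set \<Rightarrow> ('i \<Rightarrow> 'i \<Rightarrow> real) \<Rightarrow> ('i \<Rightarrow> 'i \<Rightarrow> real) \<Rightarrow> 'i \<Rightarrow> 'i \<Rightarrow> real" where
  "matmul I A B = (\<lambda>i j. \<Sum>k\<in>I. A i k * B k j)"

definition hs_norm :: "'i set \<Rightarrow> ('i \<Rightarrow> 'i \<Rightarrow> real) \<Rightarrow> real" where
  "hs_norm I A = L2_set (\<lambda>(i, j). A i j) (I \<times> I)"

text \<open>
  An upper bound for the operator norm, stated for the bilinear form and hence invariant under
  transposition.
\<close>

definition bilinear_bound :: "'i set \<Rightarrow> ('i \<Rightarrow> 'i \<Rightarrow> real) \<Rightarrow> real \<Rightarrow> bool" where
  "bilinear_bound I A c \<longleftrightarrow> 0 \<le> c \<and>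
     (\<forall>u v. \<bar>\<Sum>i\<in>I. \<Sum>j\<in>I. A i j * u i * v j\<bar> \<le> c * L2_set u I * L2_set v I)"

primrec matpow :: "'i set \<Rightarrow> ('i \<Rightarrow> 'i \<Rightarrow> real) \<Rightarrow> nat \<Rightarrow> 'i \<Rightarrow> 'i \<Rightarrow> real" where
  "matpow I A 0 = (\<lambda>i j. if i = j then 1 else 0)"
| "matpow I A (Suc k) = matmul I A (matpow I A k)"

lemma L2_set_power2: "(L2_set f A)\<^sup>2 = (\<Sum>i\<in>A. (f i)\<^sup>2)"
  by (simp add: L2_set_def sum_nonneg)

lemma sum_mult_le_L2_set: "\<bar>\<Sum>i\<in>A. f i * g i\<bar> \<le> L2_set f A * L2_set g A"
proof -
  have "\<bar>\<Sum>i\<in>A. f i * g i\<bar> \<le> (\<Sum>i\<in>A. \<bar>f i\<bar> * \<bar>g i\<bar>)"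
    by (rule order_trans[OF sum_abs]) (simp add: abs_mult)
  then show ?thesis using L2_set_mult_ineq[of f g A] by linarith
qed

lemma L2_set_sum: "finite J \<Longrightarrow> L2_set (\<lambda>i. \<Sum>l\<in>J. f l i) A \<le> (\<Sum>l\<in>J. L2_set (f l) A)"
proof (induction J rule: finite_induct)
  case empty then show ?case by (simp add: L2_set_0')
next
  case (insert l J)
  then show ?case using L2_set_triangle_ineq[of "f l" "\<lambda>i. \<Sum>l\<in>J. f l i" A] by simp
qed

lemma hs_norm_power2: "(hs_norm I A)\<^sup>2 = (\<Sum>i\<in>I. \<Sum>j\<in>I. (A i j)\<^sup>2)"
  by (simp add: hs_norm_def L2_set_power2 sum.cartesian_product case_prod_unfold)

lemma hs_norm_nonneg [simp]: "0 \<le> hs_norm I A"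
  by (simp add: hs_norm_def)

lemma hs_norm_transpose: "hs_norm I (\<lambda>i j. A j i) = hs_norm I A"
proof -
  have "(hs_norm I (\<lambda>i j. A j i))\<^sup>2 = (hs_norm I A)\<^sup>2"
    unfolding hs_norm_power2 by (rule sum.swap)
  then show ?thesis by (simp add: power2_eq_iff_nonneg)
qed

lemma hs_norm_inner_le: "\<bar>\<Sum>i\<in>I. \<Sum>j\<in>I. A i j * B i j\<bar> \<le> hs_norm I A * hs_norm I B"
  using sum_mult_le_L2_set[of "\<lambda>(i, j). A i j" "\<lambda>(i, j). B i j" "I \<times> I"]
  by (simp add: hs_norm_def sum.cartesian_product case_prod_unfold)

lemma hs_norm_sum: "finite J \<Longrightarrow> hs_norm I (\<lambda>i j. \<Sum>l\<in>J. A l i j) \<le> (\<Sum>l\<in>J. hs_norm I (A l))"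
  using L2_set_sum[of J "\<lambda>l (i, j). A l i j" "I \<times> I"] by (simp add: hs_norm_def case_prod_unfold)

lemma bilinear_bound_transpose:
  assumes "bilinear_bound I A c"
  shows "bilinear_bound I (\<lambda>i j. A j i) c"
  unfolding bilinear_bound_def
proof (intro conjI allI)
  show "0 \<le> c" using assms by (simp add: bilinear_bound_def)
  fix u v
  have "(\<Sum>i\<in>I. \<Sum>j\<in>I. A j i * u i * v j) = (\<Sum>j\<in>I. \<Sum>i\<in>I. A j i * v j * u i)"
    by (subst sum.swap) (simp add: mult_ac)
  then show "\<bar>\<Sum>i\<in>I. \<Sum>j\<in>I. A j i * u i * v j\<bar> \<le> c * L2_set u I * L2_set v I"
    using assms[unfolded bilinear_bound_def, THEN conjunct2, THEN spec[of _ v], THEN spec[of _ u]]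
    by (simp only: mult.assoc mult.commute[of "L2_set v I"])
qed

lemma bilinear_bound_vec:
  assumes "bilinear_bound I A c"
  shows "L2_set (\<lambda>i. \<Sum>j\<in>I. A i j * v j) I \<le> c * L2_set v I"
proof -
  let ?w = "\<lambda>i. \<Sum>j\<in>I. A i j * v j"
  have "(L2_set ?w I)\<^sup>2 = (\<Sum>i\<in>I. \<Sum>j\<in>I. A i j * ?w i * v j)"
    unfolding L2_set_power2 by (simp add: power2_eq_square sum_distrib_left mult_ac)
  also have "\<dots> \<le> c * L2_set ?w I * L2_set v I"
    using assms unfolding bilinear_bound_def by (meson abs_le_D1)
  finally have "L2_set ?w I * L2_set ?w I \<le> L2_set ?w I * (c * L2_set v I)"
    by (simp add: power2_eq_square mult_ac)
  moreover have "0 \<le> c * L2_set v I" using assms by (simp add: bilinear_bound_def)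
  moreover have "0 \<le> L2_set ?w I" by simp
  ultimately show ?thesis
    using mult_le_cancel_left_pos[of "L2_set ?w I" "L2_set ?w I" "c * L2_set v I"]
    by linarith
qed

text \<open>
  The operator bound of the left factor is applied to each column of the right one.
\<close>

lemma hs_norm_matmul_left:
  assumes "bilinear_bound I A c"
  shows "hs_norm I (matmul I A B) \<le> c * hs_norm I B"
proof (rule power2_le_imp_le)
  have "(hs_norm I (matmul I A B))\<^sup>2 = (\<Sum>j\<in>I. (L2_set (\<lambda>i. \<Sum>k\<in>I. A i k * B k j) I)\<^sup>2)"
    unfolding hs_norm_power2 L2_set_power2 matmul_def by (rule sum.swap)
  also have "\<dots> \<le> (\<Sum>j\<in>I. (c * L2_set (\<lambda>k. B k j) I)\<^sup>2)"
    by (intro sum_mono power_mono bilinear_bound_vec assms) auto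
  also have "\<dots> = c\<^sup>2 * (\<Sum>j\<in>I. \<Sum>k\<in>I. (B k j)\<^sup>2)"
    by (simp add: power_mult_distrib L2_set_power2 sum_distrib_left)
  also have "\<dots> = (c * hs_norm I B)\<^sup>2"
    unfolding power_mult_distrib hs_norm_power2 by (subst sum.swap) simp
  finally show "(hs_norm I (matmul I A B))\<^sup>2 \<le> (c * hs_norm I B)\<^sup>2" .
qed (use assms in \<open>auto simp: bilinear_bound_def\<close>)

lemma hs_norm_matmul_right:
  assumes "bilinear_bound I B c"
  shows "hs_norm I (matmul I A B) \<le> hs_norm I A * c"
proof -
  have "(\<lambda>i j. matmul I A B j i) = matmul I (\<lambda>i j. B j i) (\<lambda>i j. A j i)"
    by (auto simp: matmul_def fun_eq_iff mult_ac)
  then have "hs_norm I (matmul I A B) = hs_norm I (matmul I (\<lambda>i j. B j i) (\<lambda>i j. A j i))"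
    using hs_norm_transpose[of I "matmul I A B"] by simp
  also have "\<dots> \<le> c * hs_norm I (\<lambda>i j. A j i)"
    by (rule hs_norm_matmul_left[OF bilinear_bound_transpose[OF assms]])
  also have "\<dots> = hs_norm I A * c"
    using hs_norm_transpose[of I A] by simp
  finally show ?thesis .
qed

lemma bilinear_bound_matmul:
  assumes "bilinear_bound I A c" "bilinear_bound I B d"
  shows "bilinear_bound I (matmul I A B) (c * d)"
  unfolding bilinear_bound_def
proof (intro conjI allI)
  show "0 \<le> c * d" using assms by (auto simp: bilinear_bound_def)
  fix u v
  let ?w = "\<lambda>i. \<Sum>j\<in>I. B i j * v j"
  have "(\<Sum>i\<in>I. \<Sum>j\<in>I. matmul I A B i j * u i * v j) = (\<Sum>i\<in>I. \<Sum>j\<in>I. \<Sum>k\<in>I. A i k * u i * (B k j * v j))"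
    by (simp add: matmul_def sum_distrib_right sum_distrib_left mult_ac)
  also have "\<dots> = (\<Sum>i\<in>I. \<Sum>k\<in>I. A i k * u i * ?w k)"
    by (rule sum.cong[OF refl], subst sum.swap) (simp add: sum_distrib_left)
  finally have eq: "(\<Sum>i\<in>I. \<Sum>j\<in>I. matmul I A B i j * u i * v j) = (\<Sum>i\<in>I. \<Sum>k\<in>I. A i k * u i * ?w k)" .
  have "\<bar>\<Sum>i\<in>I. \<Sum>k\<in>I. A i k * u i * ?w k\<bar> \<le> c * L2_set u I * L2_set ?w I"
    using assms(1) by (simp add: bilinear_bound_def)
  also have "\<dots> \<le> c * L2_set u I * (d * L2_set v I)"
    using assms(1) by (intro mult_left_mono bilinear_bound_vec assms(2)) (auto simp: bilinear_bound_def)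
  finally show "\<bar>\<Sum>i\<in>I. \<Sum>j\<in>I. matmul I A B i j * u i * v j\<bar> \<le> c * d * L2_set u I * L2_set v I"
    unfolding eq by (simp add: mult_ac)
qed

lemma bilinear_bound_sum:
  assumes "finite J" "\<And>l. l \<in> J \<Longrightarrow> bilinear_bound I (A l) (c l)"
  shows "bilinear_bound I (\<lambda>i j. \<Sum>l\<in>J. A l i j) (\<Sum>l\<in>J. c l)"
  unfolding bilinear_bound_def
proof (intro conjI allI)
  show "0 \<le> (\<Sum>l\<in>J. c l)" using assms by (auto simp: bilinear_bound_def intro: sum_nonneg)
  fix u v
  have "(\<Sum>i\<in>I. \<Sum>j\<in>I. (\<Sum>l\<in>J. A l i j) * u i * v j) = (\<Sum>i\<in>I. \<Sum>l\<in>J. \<Sum>j\<in>I. A l i j * u i * v j)"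
    by (rule sum.cong[OF refl], subst sum.swap) (simp add: sum_distrib_right)
  also have "\<dots> = (\<Sum>l\<in>J. \<Sum>i\<in>I. \<Sum>j\<in>I. A l i j * u i * v j)" by (rule sum.swap)
  also have "\<bar>\<dots>\<bar> \<le> (\<Sum>l\<in>J. c l * L2_set u I * L2_set v I)"
    by (rule order_trans[OF sum_abs], rule sum_mono) (use assms(2) in \<open>auto simp: bilinear_bound_def\<close>)
  finally show "\<bar>\<Sum>i\<in>I. \<Sum>j\<in>I. (\<Sum>l\<in>J. A l i j) * u i * v j\<bar> \<le> (\<Sum>l\<in>J. c l) * L2_set u I * L2_set v I"
    by (simp add: sum_distrib_right)
qed

section \<open>Moments of Rademacher sums of matrices\<close>

definition sign_sum :: "'l set \<Rightarrow> ('l \<Rightarrow> 'i \<Rightarrow> 'i \<Rightarrow> real) \<Rightarrow> ('l \<Rightarrow> real) \<Rightarrow> 'i \<Rightarrow> 'i \<Rightarrow> real" where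
  "sign_sum L X \<epsilon> = (\<lambda>i j. \<Sum>l\<in>L. \<epsilon> l * X l i j)"

text \<open>
  For exponents with values in \<open>{0, 1}\<close> these are the Fourier-Walsh coefficients of \<open>f\<close>.  General
  exponents spare the reduction modulo two.
\<close>

definition monomial_mean :: "'l set \<Rightarrow> ('l \<Rightarrow> nat) \<Rightarrow> (('l \<Rightarrow> real) \<Rightarrow> real) \<Rightarrow> real" where
  "monomial_mean L n f = rademacher_mean L (\<lambda>\<epsilon>. (\<Prod>l\<in>L. \<epsilon> l ^ n l) * f \<epsilon>)"

lemma prod_monomial_Suc:
  assumes "finite L" "k \<in> L"
  shows "(\<Prod>l\<in>L. (\<epsilon> l :: real) ^ (n(k := Suc (n k))) l) = \<epsilon> k * (\<Prod>l\<in>L. \<epsilon> l ^ n l)"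
proof -
  have "(\<Prod>l\<in>L - {k}. \<epsilon> l ^ (n(k := Suc (n k))) l) = (\<Prod>l\<in>L - {k}. \<epsilon> l ^ n l)"
    by (rule prod.cong) auto
  then show ?thesis by (simp add: prod.remove[OF assms] mult_ac)
qed

text \<open>
  Splitting off the leftmost factor of the power moves one sign into the monomial.
\<close>

lemma monomial_mean_matpow_Suc:
  assumes "finite L"
  shows "monomial_mean L n (\<lambda>\<epsilon>. matpow I (sign_sum L X \<epsilon>) (Suc k) i j)
    = (\<Sum>l\<in>L. matmul I (X l) (\<lambda>i j. monomial_mean L (n(l := Suc (n l))) (\<lambda>\<epsilon>. matpow I (sign_sum L X \<epsilon>) k i j)) i j)"
proof -
  let ?P = "\<lambda>\<epsilon>. matpow I (sign_sum L X \<epsilon>) k"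
  have "monomial_mean L n (\<lambda>\<epsilon>. matpow I (sign_sum L X \<epsilon>) (Suc k) i j)
     = rademacher_mean L (\<lambda>\<epsilon>. \<Sum>l\<in>L. \<Sum>q\<in>I. X l i q * ((\<Prod>l'\<in>L. \<epsilon> l' ^ (n(l := Suc (n l))) l') * ?P \<epsilon> q j))"
    unfolding monomial_mean_def
  proof (rule rademacher_mean_cong)
    fix \<epsilon>
    have "(\<Prod>l\<in>L. \<epsilon> l ^ n l) * matpow I (sign_sum L X \<epsilon>) (Suc k) i j =
      (\<Sum>q\<in>I. \<Sum>l\<in>L. X l i q * ((\<epsilon> l * (\<Prod>l\<in>L. \<epsilon> l ^ n l)) * ?P \<epsilon> q j))"
      by (simp add: matmul_def sign_sum_def sum_distrib_left sum_distrib_right mult_ac)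
    also have "\<dots> = (\<Sum>l\<in>L. \<Sum>q\<in>I. X l i q * ((\<epsilon> l * (\<Prod>l\<in>L. \<epsilon> l ^ n l)) * ?P \<epsilon> q j))"
      by (rule sum.swap)
    also have "\<dots> = (\<Sum>l\<in>L. \<Sum>q\<in>I. X l i q * ((\<Prod>l'\<in>L. \<epsilon> l' ^ (n(l := Suc (n l))) l') * ?P \<epsilon> q j))"
      by (intro sum.cong refl) (simp only: prod_monomial_Suc[OF assms])
    finally show "(\<Prod>l\<in>L. \<epsilon> l ^ n l) * matpow I (sign_sum L X \<epsilon>) (Suc k) i j = \<dots>" .
  qed
  then show ?thesis
    by (simp only: rademacher_mean_sum rademacher_mean_cmult monomial_mean_def matmul_def)
qed

lemma monomial_mean_power_Suc:
  assumes "finite L"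
  shows "monomial_mean L n (\<lambda>\<epsilon>. (\<Sum>l\<in>L. \<epsilon> l * a l) ^ Suc k)
    = (\<Sum>l\<in>L. a l * monomial_mean L (n(l := Suc (n l))) (\<lambda>\<epsilon>. (\<Sum>l\<in>L. \<epsilon> l * a l) ^ k))"
proof -
  have "monomial_mean L n (\<lambda>\<epsilon>. (\<Sum>l\<in>L. \<epsilon> l * a l) ^ Suc k) = 
    rademacher_mean L (\<lambda>\<epsilon>. \<Sum>l\<in>L. a l * ((\<Prod>l'\<in>L. \<epsilon> l' ^ (n(l := Suc (n l))) l') * (\<Sum>l\<in>L. \<epsilon> l * a l) ^ k))"
    unfolding monomial_mean_def
  proof (rule rademacher_mean_cong)
    fix \<epsilon>
    have "(\<Prod>l\<in>L. \<epsilon> l ^ n l) * (\<Sum>l\<in>L. \<epsilon> l * a l) ^ Suc k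
      = (\<Sum>l\<in>L. a l * ((\<epsilon> l * (\<Prod>l\<in>L. \<epsilon> l ^ n l)) * (\<Sum>l\<in>L. \<epsilon> l * a l) ^ k))"
      by (simp add: sum_distrib_left sum_distrib_right mult_ac)
    also have "\<dots> = (\<Sum>l\<in>L. a l * ((\<Prod>l'\<in>L. \<epsilon> l' ^ (n(l := Suc (n l))) l') * (\<Sum>l\<in>L. \<epsilon> l * a l) ^ k))"
      by (intro sum.cong refl) (simp only: prod_monomial_Suc[OF assms])
    finally show "(\<Prod>l\<in>L. \<epsilon> l ^ n l) * (\<Sum>l\<in>L. \<epsilon> l * a l) ^ Suc k = \<dots>" .
  qed
  then show ?thesis
    by (simp only: rademacher_mean_sum rademacher_mean_cmult monomial_mean_def)
qed

lemma monomial_mean_1: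
  assumes "finite L"
  shows "monomial_mean L n (\<lambda>_. c) = (if \<forall>l\<in>L. even (n l) then c else 0)"
  using rademacher_mean_cmult[of L c "\<lambda>\<epsilon>. \<Prod>l\<in>L. \<epsilon> l ^ n l"] rademacher_mean_monomial[OF assms, of n]
  by (simp add: monomial_mean_def mult.commute)

text \<open>
  The matrix recursion is dominated term by term by the scalar one; both start from the mean of a
  monomial, which is \<open>0\<close> or \<open>1\<close>.
\<close>

lemma bilinear_bound_monomial_mean:
  assumes "finite L" "finite I" "\<And>l. l \<in> L \<Longrightarrow> bilinear_bound I (X l) (a l)"
  shows "bilinear_bound I (\<lambda>i j. monomial_mean L n (\<lambda>\<epsilon>. matpow I (sign_sum L X \<epsilon>) k i j))
     (monomial_mean L n (\<lambda>\<epsilon>. (\<Sum>l\<in>L. \<epsilon> l * a l) ^ k))"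
proof (induction k arbitrary: n)
  case 0
  have "bilinear_bound I (\<lambda>i j. if i = j then c else 0) c" if "c \<in> {0, 1}" for c
    using that sum_mult_le_L2_set[of _ _ I] assms(2)
    by (auto simp: bilinear_bound_def if_distrib[of "\<lambda>x. x * _"] cong: if_cong)
  moreover have "monomial_mean L n (\<lambda>_. 1) \<in> {0, 1}"
    by (simp add: monomial_mean_1[OF assms(1)])
  ultimately have "bilinear_bound I (\<lambda>i j. if i = j then monomial_mean L n (\<lambda>_. 1) else 0) (monomial_mean L n (\<lambda>_. 1))"
    by blast
  moreover have "monomial_mean L n (\<lambda>\<epsilon>. matpow I (sign_sum L X \<epsilon>) 0 i j)
     = (if i = j then monomial_mean L n (\<lambda>_. 1) else 0)" for i j
    by (simp add: monomial_mean_1[OF assms(1)])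
  ultimately show ?case by simp
next
  case (Suc k)
  show ?case
    unfolding monomial_mean_matpow_Suc[OF assms(1)] monomial_mean_power_Suc[OF assms(1)]
    by (intro bilinear_bound_sum bilinear_bound_matmul assms Suc.IH)
qed

text \<open>
  If \<open>\<epsilon> j\<close> occurs to an odd power, then each word that contributes contains the letter \<open>X j\<close>.
  At its leftmost occurrence its Hilbert-Schmidt norm is used, which costs the factor \<open>c\<close>, and
  operator norms everywhere else.
\<close>

lemma hs_norm_monomial_mean:
  assumes "finite L" "finite I" "\<And>l. l \<in> L \<Longrightarrow> bilinear_bound I (X l) (a l)"
    and "j \<in> L" "odd (n j)" "hs_norm I (X j) \<le> c * a j" "0 \<le> c"
  shows "hs_norm I (\<lambda>p q. monomial_mean L n (\<lambda>\<epsilon>. matpow I (sign_sum L X \<epsilon>) k p q))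
     \<le> c * monomial_mean L n (\<lambda>\<epsilon>. (\<Sum>l\<in>L. \<epsilon> l * a l) ^ k)"
  using assms(5)
proof (induction k arbitrary: n)
  case 0
  then have "\<not> (\<forall>l\<in>L. even (n l))" using assms(4) by auto
  then have "monomial_mean L n (\<lambda>_. c) = 0" for c
    by (simp only: monomial_mean_1[OF assms(1)] if_False)
  then show ?case by (simp add: hs_norm_def L2_set_0' case_prod_unfold)
next
  case (Suc k)
  let ?M = "\<lambda>l p q. monomial_mean L (n(l := Suc (n l))) (\<lambda>\<epsilon>. matpow I (sign_sum L X \<epsilon>) k p q)"
  let ?z = "\<lambda>l. monomial_mean L (n(l := Suc (n l))) (\<lambda>\<epsilon>. (\<Sum>l\<in>L. \<epsilon> l * a l) ^ k)"
  have "hs_norm I (\<lambda>p q. \<Sum>l\<in>L. matmul I (X l) (?M l) p q) \<le> (\<Sum>l\<in>L. hs_norm I (matmul I (X l) (?M l)))"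
    by (rule hs_norm_sum[OF assms(1)])
  also have "\<dots> \<le> (\<Sum>l\<in>L. c * (a l * ?z l))"
  proof (rule sum_mono)
    fix l assume l: "l \<in> L"
    have bb: "bilinear_bound I (?M l) (?z l)"
      by (rule bilinear_bound_monomial_mean[OF assms(1-3)])
    show "hs_norm I (matmul I (X l) (?M l)) \<le> c * (a l * ?z l)"
    proof (cases "l = j")
      case True
      have "hs_norm I (matmul I (X l) (?M l)) \<le> hs_norm I (X l) * ?z l"
        by (rule hs_norm_matmul_right[OF bb])
      also have "\<dots> \<le> (c * a l) * ?z l"
        using bb assms(6) True by (intro mult_right_mono) (auto simp: bilinear_bound_def)
      finally show ?thesis by (simp add: mult_ac)
    next
      case False
      have "hs_norm I (matmul I (X l) (?M l)) \<le> a l * hs_norm I (?M l)"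
        by (rule hs_norm_matmul_left[OF assms(3)[OF l]])
      also have "\<dots> \<le> a l * (c * ?z l)"
        using assms(3)[OF l] False Suc.prems
        by (intro mult_left_mono Suc.IH) (auto simp: bilinear_bound_def)
      finally show ?thesis by (simp add: mult_ac)
    qed
  qed
  finally show ?case
    unfolding monomial_mean_matpow_Suc[OF assms(1)] monomial_mean_power_Suc[OF assms(1)]
    by (simp add: sum_distrib_left)
qed

section \<open>Powers of a symmetric matrix\<close>

lemma inner_matmul_symmetric:
  assumes "\<And>i j. i \<in> I \<Longrightarrow> j \<in> I \<Longrightarrow> Y i j = Y j i"
  shows "(\<Sum>i\<in>I. \<Sum>j\<in>I. A i j * matmul I Y B i j) = (\<Sum>i\<in>I. \<Sum>j\<in>I. matmul I Y A i j * B i j)"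
proof -
  have "(\<Sum>i\<in>I. \<Sum>j\<in>I. A i j * matmul I Y B i j) = (\<Sum>j\<in>I. \<Sum>i\<in>I. \<Sum>k\<in>I. A i j * Y i k * B k j)"
    by (subst sum.swap) (simp add: matmul_def sum_distrib_left mult_ac)
  also have "\<dots> = (\<Sum>j\<in>I. \<Sum>k\<in>I. \<Sum>i\<in>I. A i j * Y i k * B k j)"
    by (rule sum.cong[OF refl], rule sum.swap)
  also have "\<dots> = (\<Sum>j\<in>I. \<Sum>k\<in>I. \<Sum>i\<in>I. Y k i * A i j * B k j)"
    by (intro sum.cong refl) (use assms in \<open>simp add: mult_ac\<close>)
  also have "\<dots> = (\<Sum>k\<in>I. \<Sum>j\<in>I. matmul I Y A k j * B k j)"
    by (subst sum.swap) (simp add: matmul_def sum_distrib_right)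
  finally show ?thesis .
qed

lemma matpow_1:
  assumes "finite I" "j \<in> I"
  shows "matpow I Y (Suc 0) i j = Y i j"
proof -
  have "matpow I Y (Suc 0) i j = (\<Sum>k\<in>I. if k = j then Y i k else 0)"
    by (auto simp: matmul_def intro!: sum.cong)
  then show ?thesis using assms by simp
qed

text \<open>
  Symmetry moves the factors of one power to the other:
  \<open>tr (Y ^ (q + 1) Y ^ (q + 1)) = tr (Y \<cdot> Y ^ (2 q + 1))\<close>.  A single factor \<open>Y\<close> is thereby isolated,
  which is linear in the signs.
\<close>

lemma hs_norm_matpow:
  assumes "finite I" "\<And>i j. i \<in> I \<Longrightarrow> j \<in> I \<Longrightarrow> Y i j = Y j i"
  shows "(hs_norm I (matpow I Y (Suc q)))\<^sup>2 = (\<Sum>i\<in>I. \<Sum>j\<in>I. Y i j * matpow I Y (Suc (2 * q)) i j)"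
proof -
  have "(\<Sum>i\<in>I. \<Sum>j\<in>I. matpow I Y (Suc 0) i j * matpow I Y (d + b) i j)
      = (\<Sum>i\<in>I. \<Sum>j\<in>I. matpow I Y (Suc d) i j * matpow I Y b i j)" for d b
  proof (induction d arbitrary: b)
    case (Suc d)
    have "(\<Sum>i\<in>I. \<Sum>j\<in>I. matpow I Y (Suc 0) i j * matpow I Y (Suc d + b) i j)
      = (\<Sum>i\<in>I. \<Sum>j\<in>I. matpow I Y (Suc d) i j * matpow I Y (Suc b) i j)"
      using Suc.IH[of "Suc b"] by simp
    also have "\<dots> = (\<Sum>i\<in>I. \<Sum>j\<in>I. matpow I Y (Suc (Suc d)) i j * matpow I Y b i j)"
      unfolding matpow.simps(2)[of I Y b] matpow.simps(2)[of I Y "Suc d"]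
      by (rule inner_matmul_symmetric[OF assms(2)])
    finally show ?case .
  qed simp
  from this[of q "Suc q"]
  have "(hs_norm I (matpow I Y (Suc q)))\<^sup>2 = (\<Sum>i\<in>I. \<Sum>j\<in>I. matpow I Y (Suc 0) i j * matpow I Y (Suc (2 * q)) i j)"
    unfolding hs_norm_power2 by (simp only: power2_eq_square mult_2 add_Suc_right)
  also have "\<dots> = (\<Sum>i\<in>I. \<Sum>j\<in>I. Y i j * matpow I Y (Suc (2 * q)) i j)"
    by (intro sum.cong refl) (simp only: matpow_1[OF assms(1)])
  finally show ?thesis .
qed

text \<open>
  The ratios \<open>q (k + 1) / q k\<close> of a log-convex sequence increase.  Applied to \<open>\<parallel>Y ^ k v\<parallel>\<close>, this replaces
  Jensen's inequality for the spectral measure of \<open>Y\<close>.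
\<close>

lemma log_convex_power_le:
  fixes q :: "nat \<Rightarrow> real"
  assumes nonneg: "\<And>k. q k \<ge> 0" and "q 0 \<le> 1" and lc: "\<And>k. (q (Suc k))\<^sup>2 \<le> q k * q (Suc (Suc k))"
  shows "q 1 ^ Suc p \<le> q (Suc p)"
proof -
  have step: "q 1 * q k \<le> q (Suc k)" for k
  proof (induction k)
    case 0
    then show ?case using mult_left_mono[OF assms(2) nonneg[of 1]] by simp
  next
    case (Suc k)
    show ?case
    proof (cases "q (Suc k) = 0")
      case False
      then have pos: "q (Suc k) > 0" using nonneg[of "Suc k"] by linarith
      then have "0 < q k * q (Suc (Suc k))" using lc[of k] by (smt (verit) zero_less_power)
      then have "q k > 0" using nonneg[of k] by (metis less_le mult_zero_left)
      have "q k * (q 1 * q (Suc k)) = (q 1 * q k) * q (Suc k)" by simp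
      also have "\<dots> \<le> q (Suc k) * q (Suc k)" using Suc.IH nonneg by (intro mult_right_mono) auto
      also have "\<dots> \<le> q k * q (Suc (Suc k))" using lc[of k] by (simp add: power2_eq_square)
      finally show ?thesis using \<open>q k > 0\<close> by simp
    qed (simp add: nonneg)
  qed
  show ?thesis
  proof (induction p)
    case (Suc p)
    have "q 1 ^ Suc (Suc p) \<le> q 1 * q (Suc p)"
      using Suc nonneg[of 1] by (simp add: mult_left_mono)
    also have "\<dots> \<le> q (Suc (Suc p))" by (rule step)
    finally show ?case .
  qed simp
qed

text \<open>
  A form of \<open>\<parallel>Y\<parallel> ^ (2 p) \<le> tr (Y ^ (2 p))\<close>: the norms \<open>\<parallel>Y ^ k v\<parallel>\<close> are log-convex in \<open>k\<close> because
  \<open>\<parallel>Y w\<parallel>\<^sup>2 = \<langle>w, Y (Y w)\<rangle>\<close>, and \<open>\<parallel>Y ^ p v\<parallel>\<close> is at most the Hilbert-Schmidt norm of \<open>Y ^ p\<close>.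
\<close>

lemma bilinear_power_le_hs_norm:
  assumes "finite I" and sym: "\<And>i j. i \<in> I \<Longrightarrow> j \<in> I \<Longrightarrow> Y i j = Y j i"
    and u: "L2_set u I \<le> 1" and v: "L2_set v I \<le> 1"
  shows "(\<Sum>i\<in>I. \<Sum>j\<in>I. Y i j * u i * v j) ^ (2 * Suc p) \<le> (hs_norm I (matpow I Y (Suc p)))\<^sup>2"
proof -
  define w where "w k = (\<lambda>i. \<Sum>j\<in>I. matpow I Y k i j * v j)" for k
  define q where "q k = L2_set (w k) I" for k
  have w0: "w 0 i = v i" if "i \<in> I" for i
  proof -
    have "w 0 i = (\<Sum>j\<in>I. if j = i then v j else 0)"
      unfolding w_def by (intro sum.cong refl) auto
    then show ?thesis using that assms(1) by simp
  qed
  have wSuc: "w (Suc k) i = (\<Sum>j\<in>I. Y i j * w k j)" for k i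
  proof -
    have "w (Suc k) i = (\<Sum>j\<in>I. \<Sum>l\<in>I. Y i l * (matpow I Y k l j * v j))"
      by (simp only: w_def matmul_def matpow.simps sum_distrib_right mult.assoc)
    also have "\<dots> = (\<Sum>l\<in>I. \<Sum>j\<in>I. Y i l * (matpow I Y k l j * v j))" by (rule sum.swap)
    finally show ?thesis by (simp add: w_def sum_distrib_left)
  qed
  have "(q (Suc k))\<^sup>2 \<le> q k * q (Suc (Suc k))" for k
  proof -
    have "(q (Suc k))\<^sup>2 = (\<Sum>i\<in>I. \<Sum>j\<in>I. Y i j * w k j * w (Suc k) i)"
      unfolding q_def L2_set_power2 by (simp add: wSuc[of k] power2_eq_square sum_distrib_right)
    also have "\<dots> = (\<Sum>j\<in>I. \<Sum>i\<in>I. w k j * (Y j i * w (Suc k) i))"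
      by (subst sum.swap, intro sum.cong refl) (simp add: sym mult_ac)
    also have "\<dots> = (\<Sum>j\<in>I. w k j * w (Suc (Suc k)) j)"
      by (simp add: wSuc[of "Suc k"] sum_distrib_left)
    also have "\<dots> \<le> q k * q (Suc (Suc k))"
      using sum_mult_le_L2_set[of "w k" "w (Suc (Suc k))" I] by (simp add: q_def)
    finally show ?thesis .
  qed
  moreover have q0: "q 0 \<le> 1" using v by (simp add: q_def w0 cong: L2_set_cong_simp)
  ultimately have "q 1 ^ Suc p \<le> q (Suc p)"
    by (intro log_convex_power_le) (auto simp: q_def)
  also have "q (Suc p) \<le> hs_norm I (matpow I Y (Suc p))"
  proof (rule power2_le_imp_le)
    have "(q (Suc p))\<^sup>2 = (\<Sum>i\<in>I. (\<Sum>j\<in>I. matpow I Y (Suc p) i j * v j)\<^sup>2)"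
      by (simp only: q_def w_def L2_set_power2)
    also have "\<dots> \<le> (\<Sum>i\<in>I. (L2_set (matpow I Y (Suc p) i) I)\<^sup>2)"
    proof (rule sum_mono)
      fix i
      have "\<bar>\<Sum>j\<in>I. matpow I Y (Suc p) i j * v j\<bar> \<le> L2_set (matpow I Y (Suc p) i) I * L2_set v I"
        by (rule sum_mult_le_L2_set)
      also have "\<dots> \<le> L2_set (matpow I Y (Suc p) i) I * 1"
        using v by (intro mult_left_mono) auto
      finally have "\<bar>\<Sum>j\<in>I. matpow I Y (Suc p) i j * v j\<bar> \<le> \<bar>L2_set (matpow I Y (Suc p) i) I\<bar>" by simp
      then show "(\<Sum>j\<in>I. matpow I Y (Suc p) i j * v j)\<^sup>2 \<le> (L2_set (matpow I Y (Suc p) i) I)\<^sup>2"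
        by (simp only: abs_le_square_iff)
    qed
    also have "\<dots> = (hs_norm I (matpow I Y (Suc p)))\<^sup>2"
      by (simp only: hs_norm_power2 L2_set_power2)
    finally show "(q (Suc p))\<^sup>2 \<le> (hs_norm I (matpow I Y (Suc p)))\<^sup>2" .
  qed simp
  finally have "q 1 ^ Suc p \<le> hs_norm I (matpow I Y (Suc p))" .
  moreover have "\<bar>\<Sum>i\<in>I. \<Sum>j\<in>I. Y i j * u i * v j\<bar> \<le> q 1"
  proof -
    have "(\<Sum>i\<in>I. \<Sum>j\<in>I. Y i j * u i * v j) = (\<Sum>i\<in>I. u i * w (Suc 0) i)"
      by (simp add: wSuc w0 sum_distrib_left mult_ac)
    also have "\<bar>\<dots>\<bar> \<le> L2_set u I * q 1" unfolding q_def One_nat_def by (rule sum_mult_le_L2_set)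
    also have "\<dots> \<le> 1 * q 1" using u by (intro mult_right_mono) (auto simp: q_def)
    finally show ?thesis by simp
  qed
  ultimately have "\<bar>\<Sum>i\<in>I. \<Sum>j\<in>I. Y i j * u i * v j\<bar> ^ Suc p \<le> hs_norm I (matpow I Y (Suc p))"
    by (meson abs_ge_zero order_trans power_mono)
  then have "(\<bar>\<Sum>i\<in>I. \<Sum>j\<in>I. Y i j * u i * v j\<bar> ^ Suc p)\<^sup>2 \<le> (hs_norm I (matpow I Y (Suc p)))\<^sup>2"
    by (intro power_mono) auto
  moreover have "(\<bar>x\<bar> ^ n)\<^sup>2 = x ^ (2 * n)" for x :: real and n
    by (metis power2_abs power_mult mult.commute)
  ultimately show ?thesis by (simp only:)
qed

text \<open>
  The noncommutative Khintchine estimate.  Taking the mean of \<open>\<langle>Y, Y ^ (2 p + 1)\<rangle>\<close> in the leading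
  factor \<open>Y = \<Sum> \<epsilon> l X l\<close> leaves the mixed moments of \<open>\<epsilon> l\<close> and \<open>Y ^ (2 p + 1)\<close>, in which the exponent of
  \<open>\<epsilon> l\<close> is odd.  The vectors may depend on the signs, so that they can be chosen to nearly attain
  the norm of \<open>Y\<close>.
\<close>

lemma rademacher_bilinear_moment_symmetric:
  assumes "finite L" "finite I" and bb: "\<And>l. l \<in> L \<Longrightarrow> bilinear_bound I (X l) (a l)"
    and sym: "\<And>l i j. l \<in> L \<Longrightarrow> i \<in> I \<Longrightarrow> j \<in> I \<Longrightarrow> X l i j = X l j i"
    and u: "\<And>\<epsilon>. L2_set (u \<epsilon>) I \<le> 1" and v: "\<And>\<epsilon>. L2_set (v \<epsilon>) I \<le> 1"
  shows "rademacher_mean L (\<lambda>\<epsilon>. (\<Sum>i\<in>I. \<Sum>j\<in>I. sign_sum L X \<epsilon> i j * u \<epsilon> i * v \<epsilon> j) ^ (2 * Suc p))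
    \<le> (\<Sum>l\<in>L. (hs_norm I (X l))\<^sup>2) * (real (2 * p + 1) * ((\<Sum>l\<in>L. (a l)\<^sup>2) ^ p * (fact (2 * p) / (2 ^ p * fact p))))"
proof -
  let ?Y = "\<lambda>\<epsilon>. sign_sum L X \<epsilon>"
  let ?V = "\<Sum>l\<in>L. (a l)\<^sup>2"
  let ?Z = "\<lambda>\<epsilon>. \<Sum>l\<in>L. \<epsilon> l * a l"
  let ?K = "real (2 * p + 1) * (?V ^ p * (fact (2 * p) / (2 ^ p * fact p)))"
  let ?n = "\<lambda>l l'. if l' = l then 1 else 0 :: nat"
  let ?M = "\<lambda>l i j. monomial_mean L (?n l) (\<lambda>\<epsilon>. matpow I (?Y \<epsilon>) (Suc (2 * p)) i j)"
  have a0: "a l \<ge> 0" if "l \<in> L" for l using bb[OF that] by (simp add: bilinear_bound_def)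
  have mono: "(\<Prod>l'\<in>L. \<epsilon> l' ^ ?n l l') = \<epsilon> l" if "l \<in> L" for l and \<epsilon> :: "'a \<Rightarrow> real"
  proof -
    have "(\<Prod>l'\<in>L. \<epsilon> l' ^ ?n l l') = (\<Prod>l'\<in>L. if l' = l then \<epsilon> l' else 1)"
      by (intro prod.cong refl) auto
    then show ?thesis using that assms(1) by simp
  qed
  have "rademacher_mean L (\<lambda>\<epsilon>. (\<Sum>i\<in>I. \<Sum>j\<in>I. ?Y \<epsilon> i j * u \<epsilon> i * v \<epsilon> j) ^ (2 * Suc p))
    \<le> rademacher_mean L (\<lambda>\<epsilon>. (hs_norm I (matpow I (?Y \<epsilon>) (Suc p)))\<^sup>2)"
    using sym u v by (intro rademacher_mean_mono bilinear_power_le_hs_norm assms(2)) (auto simp: sign_sum_def intro!: sum.cong)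
  also have "\<dots> = rademacher_mean L (\<lambda>\<epsilon>. \<Sum>i\<in>I. \<Sum>j\<in>I. ?Y \<epsilon> i j * matpow I (?Y \<epsilon>) (Suc (2 * p)) i j)"
    by (intro rademacher_mean_cong hs_norm_matpow assms(2)) (use sym in \<open>auto simp: sign_sum_def intro!: sum.cong\<close>)
  also have "\<dots> = rademacher_mean L (\<lambda>\<epsilon>. \<Sum>i\<in>I. \<Sum>j\<in>I. \<Sum>l\<in>L. X l i j * ((\<Prod>l'\<in>L. \<epsilon> l' ^ ?n l l') * matpow I (?Y \<epsilon>) (Suc (2 * p)) i j))"
  proof (intro rademacher_mean_cong sum.cong refl)
    fix \<epsilon> i j
    have "?Y \<epsilon> i j * matpow I (?Y \<epsilon>) (Suc (2 * p)) i j = (\<Sum>l\<in>L. X l i j * (\<epsilon> l * matpow I (?Y \<epsilon>) (Suc (2 * p)) i j))"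
      unfolding sign_sum_def[of L X \<epsilon>] sum_distrib_right by (intro sum.cong refl) (simp only: mult_ac)
    also have "\<dots> = (\<Sum>l\<in>L. X l i j * ((\<Prod>l'\<in>L. \<epsilon> l' ^ ?n l l') * matpow I (?Y \<epsilon>) (Suc (2 * p)) i j))"
      by (intro sum.cong refl) (simp only: mono)
    finally show "?Y \<epsilon> i j * matpow I (?Y \<epsilon>) (Suc (2 * p)) i j = \<dots>" .
  qed
  also have "\<dots> = (\<Sum>i\<in>I. \<Sum>j\<in>I. \<Sum>l\<in>L. X l i j * ?M l i j)"
    by (simp only: rademacher_mean_sum rademacher_mean_cmult monomial_mean_def)
  also have "\<dots> = (\<Sum>i\<in>I. \<Sum>l\<in>L. \<Sum>j\<in>I. X l i j * ?M l i j)"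
    by (rule sum.cong[OF refl], rule sum.swap)
  also have "\<dots> = (\<Sum>l\<in>L. \<Sum>i\<in>I. \<Sum>j\<in>I. X l i j * ?M l i j)"
    by (rule sum.swap)
  also have "\<dots> \<le> (\<Sum>l\<in>L. (hs_norm I (X l))\<^sup>2 * ?K)"
  proof (rule sum_mono)
    fix l assume l: "l \<in> L"
    let ?h = "hs_norm I (X l)"
    have K0: "0 \<le> ?K" by (simp add: sum_nonneg)
    \<comment> \<open>If \<open>a l = 0\<close> then \<open>X l\<close> vanishes, and the quotient \<open>?h / a l\<close> is \<open>0\<close>.\<close>
    have hsa: "?h \<le> ?h / a l * a l"
    proof (cases "a l = 0")
      case True
      have "?h = hs_norm I (matpow I (X l) (Suc 0))"
        unfolding hs_norm_def by (rule L2_set_cong) (auto simp: matpow_1[OF assms(2)] simp del: matpow.simps)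
      also have "\<dots> \<le> a l * hs_norm I (matpow I (X l) 0)"
        using hs_norm_matmul_left[OF bb[OF l]] by simp
      finally show ?thesis using True by simp
    qed simp
    have "(\<Sum>i\<in>I. \<Sum>j\<in>I. X l i j * ?M l i j) \<le> ?h * hs_norm I (?M l)"
      by (rule abs_le_D1[OF hs_norm_inner_le])
    also have "\<dots> \<le> ?h * (?h / a l * monomial_mean L (?n l) (\<lambda>\<epsilon>. ?Z \<epsilon> ^ Suc (2 * p)))"
      by (intro mult_left_mono hs_norm_monomial_mean[of L I X a l]) (use assms(1,2) bb l hsa a0[OF l] in auto)
    also have "\<dots> = ?h * (?h / a l) * rademacher_mean L (\<lambda>\<epsilon>. \<epsilon> l * ?Z \<epsilon> ^ Suc (2 * p))"
      by (simp only: monomial_mean_def mono[OF l] mult.assoc)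
    also have "\<dots> \<le> ?h * (?h / a l) * (a l * ?K)"
    proof (rule mult_left_mono)
      have "rademacher_mean L (\<lambda>\<epsilon>. \<epsilon> l * ?Z \<epsilon> ^ Suc (2 * p))
          \<le> real (Suc (2 * p)) * a l * rademacher_mean L (\<lambda>\<epsilon>. ?Z \<epsilon> ^ (Suc (2 * p) - 1))"
        using a0[OF l] by (intro rademacher_integration_by_parts assms(1) l) auto
      also have "\<dots> \<le> real (Suc (2 * p)) * a l * (?V ^ p * (fact (2 * p) / (2 ^ p * fact p)))"
        unfolding diff_Suc_1
        by (intro mult_left_mono rademacher_moment_le assms(1)) (use a0 a0[OF l] in auto)
      finally show "rademacher_mean L (\<lambda>\<epsilon>. \<epsilon> l * ?Z \<epsilon> ^ Suc (2 * p)) \<le> a l * ?K"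
        by (simp add: mult_ac)
    qed (use a0[OF l] in auto)
    also have "\<dots> \<le> ?h\<^sup>2 * ?K"
    proof -
      have "h * (h / b) * (b * K) \<le> h\<^sup>2 * K" if "0 \<le> K" for h b K :: real
        using that by (cases "b = 0") (auto simp: power2_eq_square)
      then show ?thesis using K0 by blast
    qed
    finally show "(\<Sum>i\<in>I. \<Sum>j\<in>I. X l i j * ?M l i j) \<le> ?h\<^sup>2 * ?K" .
  qed
  finally show ?thesis by (simp only: sum_distrib_right)
qed

section \<open>From moments to a logarithm\<close>

lemma sums_cosh_even: "(\<lambda>p. x ^ (2 * p) / fact (2 * p)) sums cosh (x :: real)"
proof -
  have "(\<lambda>p. if even (2 * p) then x ^ (2 * p) /\<^sub>R fact (2 * p) else 0) sums cosh x"
    by (subst sums_mono_reindex[where g = "\<lambda>p. 2 * p"]) (auto simp: strict_mono_def cosh_converges elim: evenE)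
  then show ?thesis by (simp add: scaleR_conv_of_real divide_inverse mult.commute)
qed

text \<open>
  Write \<open>y\<^sup>2 = w / V\<close>.  Since \<open>r \<ge> 1\<close> also covers the constant term, the assumption says that the
  series of \<open>cosh (\<theta> y)\<close> is dominated by that of \<open>r exp (\<theta>\<^sup>2 / 2)\<close>, hence
  \<open>\<theta> y \<le> ln (2 r) + \<theta>\<^sup>2 / 2\<close>.  The best choice is \<open>\<theta>\<^sup>2 = 2 ln (2 r)\<close>.
\<close>

lemma subgaussian_moments_imp_log_bound:
  fixes w V r :: real
  assumes "w \<ge> 0" "V > 0" "r \<ge> 1"
    and mom: "\<And>p. p \<ge> 1 \<Longrightarrow> w ^ p \<le> r * V ^ p * (fact (2 * p) / (2 ^ p * fact p))"
  shows "w \<le> 2 * V * ln (2 * r)"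
proof -
  define y where "y = sqrt (w / V)"
  define \<theta> where "\<theta> = sqrt (2 * ln (2 * r))"
  have y: "y ^ (2 * p) = (w / V) ^ p" "y \<ge> 0" for p
    using assms by (simp_all add: y_def power_mult)
  have ln0: "ln (2 * r) > 0" using assms by simp
  then have \<theta>: "\<theta>\<^sup>2 = 2 * ln (2 * r)" "\<theta> > 0" by (simp_all add: \<theta>_def)
  have "cosh (\<theta> * y) \<le> r * exp (\<theta>\<^sup>2 / 2)"
  proof (rule sums_le)
    show "(\<lambda>p. (\<theta> * y) ^ (2 * p) / fact (2 * p)) sums cosh (\<theta> * y)" by (rule sums_cosh_even)
    have "(\<lambda>p. x ^ p / fact p) sums exp x" for x :: real
      using exp_converges[of x] by (simp add: divide_inverse mult.commute)
    from sums_mult[OF this]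
    show "(\<lambda>p. r * ((\<theta>\<^sup>2 / 2) ^ p / fact p)) sums (r * exp (\<theta>\<^sup>2 / 2))" .
    fix p
    show "(\<theta> * y) ^ (2 * p) / fact (2 * p) \<le> r * ((\<theta>\<^sup>2 / 2) ^ p / fact p)"
    proof (cases "p = 0")
      case False
      have "(w / V) ^ p \<le> r * (fact (2 * p) / (2 ^ p * fact p))"
        using mom[of p] False \<open>V > 0\<close> by (simp add: power_divide field_simps)
      then have "\<theta> ^ (2 * p) * (w / V) ^ p / fact (2 * p) \<le> \<theta> ^ (2 * p) * (r * (fact (2 * p) / (2 ^ p * fact p))) / fact (2 * p)"
        by (intro divide_right_mono mult_left_mono) auto
      also have "\<dots> = r * ((\<theta>\<^sup>2 / 2) ^ p / fact p)"
        by (simp only: power_mult[of \<theta> 2 p] power_divide) simp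
      finally show ?thesis by (simp add: power_mult_distrib y)
    qed (use assms in simp)
  qed
  moreover have "exp (\<theta> * y) \<le> 2 * cosh (\<theta> * y)" by (simp add: cosh_field_def)
  ultimately have "exp (\<theta> * y) \<le> (2 * r) * exp (\<theta>\<^sup>2 / 2)" by linarith
  also have "\<dots> = exp (ln (2 * r) + \<theta>\<^sup>2 / 2)" using assms by (simp add: exp_add)
  finally have "\<theta> * y \<le> \<theta> * \<theta>" using \<theta>(1) by (simp add: power2_eq_square)
  then have "y \<le> \<theta>" using \<theta>(2) by simp
  then have "y\<^sup>2 \<le> \<theta>\<^sup>2" using y(2) by (intro power_mono) auto
  then have "w / V \<le> 2 * ln (2 * r)" using \<theta>(1) y(1)[of 1] by simp
  then show ?thesis using \<open>V > 0\<close> by (simp add: pos_divide_le_eq mult_ac)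
qed

section \<open>Second moment of the norm of a Rademacher sum\<close>

text \<open>
  By the power mean inequality, the moment bounds of all orders \<open>2 p\<close> are bounds for powers of the
  second moment.
\<close>

lemma rademacher_bilinear_second_moment_symmetric:
  assumes "finite L" "finite I" and bb: "\<And>l. l \<in> L \<Longrightarrow> bilinear_bound I (X l) (a l)"
    and sym: "\<And>l i j. l \<in> L \<Longrightarrow> i \<in> I \<Longrightarrow> j \<in> I \<Longrightarrow> X l i j = X l j i"
    and hs: "\<And>l. l \<in> L \<Longrightarrow> (hs_norm I (X l))\<^sup>2 \<le> s l"
    and as: "\<And>l. l \<in> L \<Longrightarrow> (a l)\<^sup>2 \<le> s l"
    and V: "(\<Sum>l\<in>L. (a l)\<^sup>2) > 0"
    and u: "\<And>\<epsilon>. L2_set (u \<epsilon>) I \<le> 1" and v: "\<And>\<epsilon>. L2_set (v \<epsilon>) I \<le> 1"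
  shows "rademacher_mean L (\<lambda>\<epsilon>. (\<Sum>i\<in>I. \<Sum>j\<in>I. sign_sum L X \<epsilon> i j * u \<epsilon> i * v \<epsilon> j)\<^sup>2)
    \<le> 2 * (\<Sum>l\<in>L. (a l)\<^sup>2) * ln (2 * ((\<Sum>l\<in>L. s l) / (\<Sum>l\<in>L. (a l)\<^sup>2)))"
proof -
  let ?V = "\<Sum>l\<in>L. (a l)\<^sup>2"
  let ?b = "\<lambda>\<epsilon>. \<Sum>i\<in>I. \<Sum>j\<in>I. sign_sum L X \<epsilon> i j * u \<epsilon> i * v \<epsilon> j"
  define r where "r = (\<Sum>l\<in>L. s l) / ?V"
  have rV: "(\<Sum>l\<in>L. s l) = r * ?V" using V by (simp add: r_def)
  have "rademacher_mean L (\<lambda>\<epsilon>. (?b \<epsilon>)\<^sup>2) \<le> 2 * ?V * ln (2 * r)"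
  proof (rule subgaussian_moments_imp_log_bound)
    show "0 \<le> rademacher_mean L (\<lambda>\<epsilon>. (?b \<epsilon>)\<^sup>2)"
      using rademacher_mean_mono[of L "\<lambda>_. 0" "\<lambda>\<epsilon>. (?b \<epsilon>)\<^sup>2"] by (simp add: rademacher_mean_const assms(1))
    show "1 \<le> r" using V as by (simp add: r_def sum_mono)
    fix p :: nat assume "p \<ge> 1"
    then obtain q where q: "p = Suc q" by (cases p) auto
    have "rademacher_mean L (\<lambda>\<epsilon>. (?b \<epsilon>)\<^sup>2) ^ p \<le> rademacher_mean L (\<lambda>\<epsilon>. ((?b \<epsilon>)\<^sup>2) ^ p)"
      using \<open>p \<ge> 1\<close> by (intro rademacher_mean_power_mean assms(1)) auto
    also have "\<dots> = rademacher_mean L (\<lambda>\<epsilon>. ?b \<epsilon> ^ (2 * Suc q))"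
      by (simp only: q power_mult)
    also have "\<dots> \<le> (\<Sum>l\<in>L. (hs_norm I (X l))\<^sup>2) * (real (2 * q + 1) * (?V ^ q * (fact (2 * q) / (2 ^ q * fact q))))"
      by (rule rademacher_bilinear_moment_symmetric[OF assms(1,2) bb sym u v])
    also have "\<dots> \<le> (\<Sum>l\<in>L. s l) * (real (2 * q + 1) * (?V ^ q * (fact (2 * q) / (2 ^ q * fact q))))"
      using V by (intro mult_right_mono sum_mono hs mult_nonneg_nonneg) auto
    also have "\<dots> = r * ?V ^ p * (fact (2 * p) / (2 ^ p * fact p))"
      unfolding rV q double_factorial_step by simp
    finally show "rademacher_mean L (\<lambda>\<epsilon>. (?b \<epsilon>)\<^sup>2) ^ p \<le> r * ?V ^ p * (fact (2 * p) / (2 ^ p * fact p))" .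
  qed (rule V)
  then show ?thesis unfolding r_def .
qed

lemma sum_times_bool:
  fixes f :: "'i \<times> bool \<Rightarrow> 'b :: comm_monoid_add"
  shows "(\<Sum>p\<in>I \<times> UNIV. f p) = (\<Sum>i\<in>I. f (i, True)) + (\<Sum>i\<in>I. f (i, False))"
proof -
  have "(\<Sum>p\<in>I \<times> UNIV. f p) = (\<Sum>i\<in>I. \<Sum>b\<in>UNIV. f (i, b))" by (simp add: sum.cartesian_product)
  then show ?thesis by (simp add: UNIV_bool sum.distrib add.commute)
qed

text \<open>
  The symmetric block matrix with zero diagonal blocks and off-diagonal blocks \<open>X\<close> and its
  transpose.
\<close>

definition dilation :: "('i \<Rightarrow> 'i \<Rightarrow> real) \<Rightarrow> 'i \<times> bool \<Rightarrow> 'i \<times> bool \<Rightarrow> real" where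
  "dilation X = (\<lambda>(i, b) (j, c). if b = c then 0 else if b then X i j else X j i)"

lemma bilinear_boundD:
  "bilinear_bound I A c \<Longrightarrow> \<bar>\<Sum>i\<in>I. \<Sum>j\<in>I. A i j * u i * v j\<bar> \<le> c * L2_set u I * L2_set v I"
  unfolding bilinear_bound_def by simp

lemma bilinear_bound_dilation:
  assumes "bilinear_bound I X a"
  shows "bilinear_bound (I \<times> UNIV) (dilation X) a"
  unfolding bilinear_bound_def
proof (intro conjI allI)
  show a0: "0 \<le> a" using assms by (simp add: bilinear_bound_def)
  fix u v :: "'a \<times> bool \<Rightarrow> real"
  let ?u = "\<lambda>b i. u (i, b)" and ?v = "\<lambda>b i. v (i, b)"
  have n: "L2_set f (I \<times> UNIV) = sqrt ((L2_set (\<lambda>i. f (i, True)) I)\<^sup>2 + (L2_set (\<lambda>i. f (i, False)) I)\<^sup>2)" 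
    for f :: "'a \<times> bool \<Rightarrow> real"
    by (simp add: L2_set_def sum_times_bool sum_nonneg)
  have "(\<Sum>i\<in>I \<times> UNIV. \<Sum>j\<in>I \<times> UNIV. dilation X i j * u i * v j) =
     (\<Sum>i\<in>I. \<Sum>j\<in>I. X i j * ?u True i * ?v False j) + (\<Sum>i\<in>I. \<Sum>j\<in>I. X j i * ?u False i * ?v True j)"
    by (simp add: sum_times_bool dilation_def)
  also have "\<bar>\<dots>\<bar> \<le> a * L2_set (?u True) I * L2_set (?v False) I + a * L2_set (?u False) I * L2_set (?v True) I"
    by (rule order_trans[OF abs_triangle_ineq add_mono])
      (rule bilinear_boundD[OF assms], rule bilinear_boundD[OF bilinear_bound_transpose[OF assms]])
  also have "\<dots> = a * (L2_set (?u True) I * L2_set (?v False) I + L2_set (?u False) I * L2_set (?v True) I)"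
    by (simp add: algebra_simps)
  also have "\<dots> \<le> a * (L2_set u (I \<times> UNIV) * L2_set v (I \<times> UNIV))"
  proof (rule mult_left_mono[OF _ a0])
    have "x * y' + x' * y \<le> sqrt (x\<^sup>2 + x'\<^sup>2) * sqrt (y\<^sup>2 + y'\<^sup>2)" for x x' y y' :: real
    proof -
      have "(x * y' + x' * y)\<^sup>2 \<le> (x\<^sup>2 + x'\<^sup>2) * (y\<^sup>2 + y'\<^sup>2)"
        using zero_le_power2[of "x * y - x' * y'"] by (simp add: power2_eq_square algebra_simps)
      then show ?thesis unfolding real_sqrt_mult[symmetric] by (rule real_le_rsqrt)
    qed
    then show "L2_set (?u True) I * L2_set (?v False) I + L2_set (?u False) I * L2_set (?v True) I
      \<le> L2_set u (I \<times> UNIV) * L2_set v (I \<times> UNIV)" by (simp add: n)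
  qed
  finally show "\<bar>\<Sum>i\<in>I \<times> UNIV. \<Sum>j\<in>I \<times> UNIV. dilation X i j * u i * v j\<bar> \<le> a * L2_set u (I \<times> UNIV) * L2_set v (I \<times> UNIV)"
    by (simp add: mult.assoc)
qed

lemma hs_norm_dilation: "(hs_norm (I \<times> UNIV) (dilation X))\<^sup>2 = 2 * (hs_norm I X)\<^sup>2"
proof -
  have "(\<Sum>i\<in>I. \<Sum>j\<in>I. (X j i)\<^sup>2) = (\<Sum>i\<in>I. \<Sum>j\<in>I. (X i j)\<^sup>2)" by (rule sum.swap)
  then show ?thesis by (simp add: hs_norm_power2 sum_times_bool dilation_def)
qed

text \<open>
  The dilation has the operator bound of \<open>X\<close> and twice the squared Hilbert-Schmidt norm, which turns
  the factor \<open>2\<close> of the symmetric case into \<open>4\<close>.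
\<close>

theorem rademacher_bilinear_second_moment:
  assumes "finite L" "finite I" and bb: "\<And>l. l \<in> L \<Longrightarrow> bilinear_bound I (X l) (a l)"
    and hs: "\<And>l. l \<in> L \<Longrightarrow> (hs_norm I (X l))\<^sup>2 \<le> s l"
    and as: "\<And>l. l \<in> L \<Longrightarrow> (a l)\<^sup>2 \<le> s l"
    and V: "(\<Sum>l\<in>L. (a l)\<^sup>2) > 0"
    and u: "\<And>\<epsilon>. L2_set (u \<epsilon>) I \<le> 1" and v: "\<And>\<epsilon>. L2_set (v \<epsilon>) I \<le> 1"
  shows "rademacher_mean L (\<lambda>\<epsilon>. (\<Sum>i\<in>I. \<Sum>j\<in>I. sign_sum L X \<epsilon> i j * u \<epsilon> i * v \<epsilon> j)\<^sup>2)
    \<le> 2 * (\<Sum>l\<in>L. (a l)\<^sup>2) * ln (4 * ((\<Sum>l\<in>L. s l) / (\<Sum>l\<in>L. (a l)\<^sup>2)))"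
proof -
  let ?D = "\<lambda>l. dilation (X l)"
  let ?u = "\<lambda>\<epsilon> (i, b). if b then u \<epsilon> i else 0" and ?v = "\<lambda>\<epsilon> (i, b). if b then 0 else v \<epsilon> i"
  have n: "L2_set (?u \<epsilon>) (I \<times> UNIV) = L2_set (u \<epsilon>) I" "L2_set (?v \<epsilon>) (I \<times> UNIV) = L2_set (v \<epsilon>) I" for \<epsilon>
    by (simp_all add: L2_set_def sum_times_bool)
  have eq: "(\<Sum>i\<in>I \<times> UNIV. \<Sum>j\<in>I \<times> UNIV. sign_sum L ?D \<epsilon> i j * ?u \<epsilon> i * ?v \<epsilon> j)
     = (\<Sum>i\<in>I. \<Sum>j\<in>I. sign_sum L X \<epsilon> i j * u \<epsilon> i * v \<epsilon> j)" for \<epsilon>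
    by (simp add: sum_times_bool sign_sum_def dilation_def)
  have "rademacher_mean L (\<lambda>\<epsilon>. (\<Sum>i\<in>I \<times> UNIV. \<Sum>j\<in>I \<times> UNIV. sign_sum L ?D \<epsilon> i j * ?u \<epsilon> i * ?v \<epsilon> j)\<^sup>2)
     \<le> 2 * (\<Sum>l\<in>L. (a l)\<^sup>2) * ln (2 * ((\<Sum>l\<in>L. 2 * s l) / (\<Sum>l\<in>L. (a l)\<^sup>2)))"
  proof (rule rademacher_bilinear_second_moment_symmetric)
    fix l assume l: "l \<in> L"
    show "bilinear_bound (I \<times> UNIV) (dilation (X l)) (a l)" by (rule bilinear_bound_dilation[OF bb[OF l]])
    show "(hs_norm (I \<times> UNIV) (dilation (X l)))\<^sup>2 \<le> 2 * s l" using hs[OF l] by (simp add: hs_norm_dilation)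
    show "(a l)\<^sup>2 \<le> 2 * s l" using as[OF l] zero_le_power2[of "a l"] by linarith
    show "dilation (X l) i j = dilation (X l) j i" for i j
      by (auto simp: dilation_def split: prod.split)
  qed (use assms in \<open>auto simp: n\<close>)
  then show ?thesis unfolding eq by (simp add: sum_distrib_left[symmetric])
qed

section \<open>The space of square-integrable functions\<close>

lemma L2_measurable: "f \<in> L2 M \<Longrightarrow> f \<in> borel_measurable M"
  by (simp add: L2_def)

lemma integrable_mult_L2:
  assumes "f \<in> L2 M" "g \<in> L2 M"
  shows "integrable M (\<lambda>x. f x * g x)"
proof (rule Bochner_Integration.integrable_bound)
  show "integrable M (\<lambda>x. (f x)\<^sup>2 + (g x)\<^sup>2)" using assms by (simp add: L2_def)
  show "(\<lambda>x. f x * g x) \<in> borel_measurable M"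
    using assms[THEN L2_measurable] by (rule borel_measurable_times)
  have "\<bar>a * b\<bar> \<le> \<bar>a\<^sup>2 + b\<^sup>2\<bar>" for a b :: real
  proof -
    have "2 * (\<bar>a\<bar> * \<bar>b\<bar>) \<le> a\<^sup>2 + b\<^sup>2"
      using sum_squares_bound[of "\<bar>a\<bar>" "\<bar>b\<bar>"] by simp
    moreover have "0 \<le> \<bar>a\<bar> * \<bar>b\<bar>" by simp
    ultimately show ?thesis unfolding abs_mult by linarith
  qed
  then show "AE x in M. norm (f x * g x) \<le> norm ((f x)\<^sup>2 + (g x)\<^sup>2)" by simp
qed

lemma L2_zero [simp]: "(\<lambda>_. 0) \<in> L2 M"
  by (simp add: L2_def)

lemma L2_cmult: "f \<in> L2 M \<Longrightarrow> (\<lambda>x. c * f x) \<in> L2 M"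
  by (auto simp: L2_def power_mult_distrib intro: borel_measurable_times)

lemma L2_add:
  assumes "f \<in> L2 M" "g \<in> L2 M"
  shows "(\<lambda>x. f x + g x) \<in> L2 M"
proof -
  have "integrable M (\<lambda>x. (f x)\<^sup>2 + 2 * (f x * g x) + (g x)\<^sup>2)"
    using assms integrable_mult_L2[OF assms] by (simp add: L2_def)
  then have "integrable M (\<lambda>x. (f x + g x)\<^sup>2)"
    by (simp add: power2_sum algebra_simps)
  then show ?thesis using assms by (auto simp: L2_def intro: borel_measurable_add)
qed

lemma L2_diff:
  assumes "f \<in> L2 M" "g \<in> L2 M"
  shows "(\<lambda>x. f x - g x) \<in> L2 M"
  using L2_add[OF assms(1) L2_cmult[OF assms(2), of "-1"]] by simp

lemma L2_sum:
  assumes "\<And>i. i \<in> I \<Longrightarrow> f i \<in> L2 M"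
  shows "(\<lambda>x. \<Sum>i\<in>I. f i x) \<in> L2 M"
  using assms by (induction I rule: infinite_finite_induct) (auto intro: L2_add)

lemma L2_inner_commute: "L2_inner M f g = L2_inner M g f"
  by (simp add: L2_inner_def mult.commute)

lemma L2_inner_zero [simp]: "L2_inner M (\<lambda>_. 0) g = 0" "L2_inner M g (\<lambda>_. 0) = 0"
  by (simp_all add: L2_inner_def)

lemma L2_inner_cmult_left: "L2_inner M (\<lambda>x. c * f x) g = c * L2_inner M f g"
  by (simp add: L2_inner_def mult.assoc)

lemma L2_inner_add_left:
  assumes "f \<in> L2 M" "g \<in> L2 M" "h \<in> L2 M"
  shows "L2_inner M (\<lambda>x. f x + g x) h = L2_inner M f h + L2_inner M g h"
  using assms by (simp add: L2_inner_def distrib_right integrable_mult_L2)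

lemma L2_inner_diff_left:
  assumes "f \<in> L2 M" "g \<in> L2 M" "h \<in> L2 M"
  shows "L2_inner M (\<lambda>x. f x - g x) h = L2_inner M f h - L2_inner M g h"
  using assms by (simp add: L2_inner_def left_diff_distrib integrable_mult_L2)

lemma L2_inner_sum_left:
  assumes "\<And>i. i \<in> I \<Longrightarrow> f i \<in> L2 M" "h \<in> L2 M"
  shows "L2_inner M (\<lambda>x. \<Sum>i\<in>I. f i x) h = (\<Sum>i\<in>I. L2_inner M (f i) h)"
  using assms by (induction I rule: infinite_finite_induct) (auto simp: L2_inner_add_left L2_sum)

lemma L2_inner_cmult_right: "L2_inner M g (\<lambda>x. c * f x) = c * L2_inner M g f"
  using L2_inner_cmult_left[of M c f g] by (simp add: L2_inner_commute)

lemma L2_inner_diff_right: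
  assumes "f \<in> L2 M" "g \<in> L2 M" "h \<in> L2 M"
  shows "L2_inner M h (\<lambda>x. f x - g x) = L2_inner M h f - L2_inner M h g"
  using L2_inner_diff_left[OF assms] by (simp add: L2_inner_commute)

lemma L2_inner_sum_right:
  assumes "\<And>i. i \<in> I \<Longrightarrow> f i \<in> L2 M" "h \<in> L2 M"
  shows "L2_inner M h (\<lambda>x. \<Sum>i\<in>I. f i x) = (\<Sum>i\<in>I. L2_inner M h (f i))"
  using L2_inner_sum_left[of I f M h] assms by (simp add: L2_inner_commute)

lemma L2_inner_self_nonneg: "0 \<le> L2_inner M f f"
  unfolding L2_inner_def by (rule integral_nonneg_AE) simp

lemma L2_norm_nonneg [simp]: "0 \<le> L2_norm M f"
  by (simp add: L2_norm_def L2_inner_self_nonneg)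

lemma L2_norm_power2: "(L2_norm M f)\<^sup>2 = L2_inner M f f"
  by (simp add: L2_norm_def L2_inner_self_nonneg)

lemma L2_norm_power2_integral: "(L2_norm M f)\<^sup>2 = (\<integral>x. (f x)\<^sup>2 \<partial>M)"
  unfolding L2_norm_power2 by (simp add: L2_inner_def power2_eq_square)

lemma L2_norm_zero [simp]: "L2_norm M (\<lambda>_. 0) = 0"
  by (simp add: L2_norm_def)

lemma L2_norm_eq_0_iff:
  assumes "f \<in> L2 M"
  shows "L2_norm M f = 0 \<longleftrightarrow> (AE x in M. f x = 0)"
  using assms integral_nonneg_eq_0_iff_AE[of M "\<lambda>x. (f x)\<^sup>2"]
  by (simp add: L2_norm_def L2_inner_def L2_def power2_eq_square[symmetric])

lemma L2_norm_cmult: "L2_norm M (\<lambda>x. c * f x) = \<bar>c\<bar> * L2_norm M f"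
  by (simp add: L2_norm_def L2_inner_cmult_left L2_inner_cmult_right real_sqrt_mult flip: mult.assoc)

lemma L2_inner_cong_AE:
  assumes "AE x in M. f x = f' x" "f \<in> L2 M" "f' \<in> L2 M" "g \<in> L2 M"
  shows "L2_inner M f g = L2_inner M f' g"
  unfolding L2_inner_def using assms
  by (intro integral_cong_AE borel_measurable_times) (auto dest: L2_measurable)

text \<open>
  The square of \<open>\<parallel>g\<parallel> f - \<parallel>f\<parallel> g\<close> has a nonnegative integral.
\<close>

lemma L2_Cauchy_Schwarz:
  assumes "f \<in> L2 M" "g \<in> L2 M"
  shows "\<bar>L2_inner M f g\<bar> \<le> L2_norm M f * L2_norm M g"
proof -
  have upper: "L2_inner M f g \<le> L2_norm M f * L2_norm M g" if f: "f \<in> L2 M" and g: "g \<in> L2 M" for f g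
  proof (cases "L2_norm M f * L2_norm M g = 0")
    case True
    have zero: "L2_inner M h k = 0" if "L2_norm M h = 0" "h \<in> L2 M" "k \<in> L2 M" for h k
      using L2_inner_cong_AE[where f = h and f' = "\<lambda>_. 0" and g = k and M = M] that L2_norm_eq_0_iff[of h M] by simp
    show ?thesis using True zero[of f g] zero[of g f] f g by (auto simp: L2_inner_commute)
  next
    case False
    define a b where "a = L2_norm M f" and "b = L2_norm M g"
    have ab: "a * b > 0" using False unfolding a_def b_def
      by (metis L2_norm_nonneg less_le mult_nonneg_nonneg)
    have "0 \<le> L2_inner M (\<lambda>x. b * f x - a * g x) (\<lambda>x. b * f x - a * g x)"
      by (rule L2_inner_self_nonneg)
    also have "\<dots> = b * (b * L2_inner M f f) - a * (b * L2_inner M g f) - (b * (a * L2_inner M f g) - a * (a * L2_inner M g g))"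
      using f g by (simp add: L2_inner_diff_left L2_inner_diff_right L2_cmult L2_diff L2_inner_cmult_left L2_inner_cmult_right algebra_simps)
    also have "\<dots> = 2 * (a * b) * (a * b - L2_inner M f g)"
    proof -
      have "L2_inner M f f = a * a" "L2_inner M g g = b * b" "L2_inner M g f = L2_inner M f g"
        using L2_norm_power2[of M f] L2_norm_power2[of M g] L2_inner_commute[of M g f]
        by (simp_all add: a_def b_def power2_eq_square)
      then show ?thesis by (simp add: algebra_simps)
    qed
    finally show ?thesis using ab by (simp add: zero_le_mult_iff a_def b_def)
  qed
  have "- L2_inner M f g = L2_inner M (\<lambda>x. - 1 * f x) g" by (subst L2_inner_cmult_left) simp
  also have "\<dots> \<le> L2_norm M (\<lambda>x. -1 * f x) * L2_norm M g" by (rule upper[OF L2_cmult]) (use assms in auto)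
  also have "\<dots> = L2_norm M f * L2_norm M g" by (subst L2_norm_cmult) simp
  finally show ?thesis using upper[OF assms] by linarith
qed

lemma L2_norm_triangle:
  assumes "f \<in> L2 M" "g \<in> L2 M"
  shows "L2_norm M (\<lambda>x. f x + g x) \<le> L2_norm M f + L2_norm M g"
proof (rule power2_le_imp_le)
  have "(L2_norm M (\<lambda>x. f x + g x))\<^sup>2 = (L2_norm M f)\<^sup>2 + 2 * L2_inner M f g + (L2_norm M g)\<^sup>2"
    using assms L2_inner_add_left[OF assms L2_add[OF assms]] 
      L2_inner_add_left[OF assms assms(1)] L2_inner_add_left[OF assms assms(2)]
    by (simp add: L2_norm_power2 L2_inner_commute)
  also have "\<dots> \<le> (L2_norm M f + L2_norm M g)\<^sup>2"
    using L2_Cauchy_Schwarz[OF assms] by (simp add: power2_sum)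
  finally show "(L2_norm M (\<lambda>x. f x + g x))\<^sup>2 \<le> (L2_norm M f + L2_norm M g)\<^sup>2" .
qed simp

lemma L2_norm_diff_triangle:
  assumes "f \<in> L2 M" "g \<in> L2 M"
  shows "L2_norm M (\<lambda>x. f x - g x) \<le> L2_norm M f + L2_norm M g"
  using L2_norm_triangle[OF assms(1) L2_cmult[OF assms(2), of "-1"]] by (simp add: L2_norm_cmult[where c = "-1" and f = g, simplified])

lemma (in finite_measure) L2_const: "(\<lambda>_. c) \<in> L2 M"
  by (simp add: L2_def)

lemma (in finite_measure) integrable_L2: "f \<in> L2 M \<Longrightarrow> integrable M f"
  using integrable_mult_L2[OF _ L2_const[of 1], of f] by simp

lemma (in finite_measure) integral_abs_le_L2_norm:
  assumes "f \<in> L2 M"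
  shows "(\<integral>x. \<bar>f x\<bar> \<partial>M) \<le> L2_norm M f * sqrt (measure M (space M))"
proof -
  have f: "(\<lambda>x. \<bar>f x\<bar>) \<in> L2 M" using assms by (auto simp: L2_def)
  have "L2_norm M (\<lambda>x. \<bar>f x\<bar>) = L2_norm M f" "L2_norm M (\<lambda>_. 1) = sqrt (measure M (space M))"
    by (simp_all add: L2_norm_def L2_inner_def)
  then show ?thesis
    using L2_Cauchy_Schwarz[OF f L2_const[of 1]] by (simp add: L2_inner_def)
qed

text \<open>
  For a finite measure an \<open>L\<^sup>2\<close> Cauchy sequence is Cauchy in \<open>L\<^sup>1\<close>, so a subsequence converges almost
  everywhere; Fatou's lemma identifies its limit as the limit in \<open>L\<^sup>2\<close>.
\<close>

lemma (in finite_measure) L2_complete: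
  assumes L2: "\<And>n. g n \<in> L2 M"
    and cauchy: "\<And>e. e > 0 \<Longrightarrow> \<exists>N. \<forall>i\<ge>N. \<forall>j\<ge>N. L2_norm M (\<lambda>x. g i x - g j x) < e"
  obtains h where "h \<in> L2 M" "(\<lambda>n. L2_norm M (\<lambda>x. g n x - h x)) \<longlonglongrightarrow> 0"
proof -
  define K where "K = sqrt (measure M (space M)) + 1"
  have K: "K > 0" by (simp add: K_def add_nonneg_pos)
  have m: "g n \<in> borel_measurable M" for n using L2 by (rule L2_measurable)
  note [measurable] = m
  obtain r where r: "strict_mono r" "AE x in M. Cauchy (\<lambda>i. g (r i) x)"
  proof (rule cauchy_L1_AE_cauchy_subseq)
    show "integrable M (g n)" for n using L2 by (rule integrable_L2)
    fix e :: real assume "e > 0"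
    then obtain N where N: "\<And>i j. i \<ge> N \<Longrightarrow> j \<ge> N \<Longrightarrow> L2_norm M (\<lambda>x. g i x - g j x) < e / K"
      using cauchy[of "e / K"] K by auto
    have "(LINT x|M. norm (g i x - g j x)) < e" if "i \<ge> N" "j \<ge> N" for i j
    proof -
      have "(LINT x|M. norm (g i x - g j x)) \<le> L2_norm M (\<lambda>x. g i x - g j x) * sqrt (measure M (space M))"
        using integral_abs_le_L2_norm[OF L2_diff[OF L2 L2]] by simp
      also have "\<dots> \<le> L2_norm M (\<lambda>x. g i x - g j x) * K" by (intro mult_left_mono) (auto simp: K_def)
      also have "\<dots> < e" using N[OF that] K by (simp add: field_simps)
      finally show ?thesis .
    qed
    then show "\<exists>N. \<forall>i\<ge>N. \<forall>j\<ge>N. (LINT x|M. norm (g i x - g j x)) < e" by blast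
  qed
  define h where "h x = lim (\<lambda>i. g (r i) x)" for x
  have h[measurable]: "h \<in> borel_measurable M" unfolding h_def by measurable
  have lim: "AE x in M. (\<lambda>i. g (r i) x) \<longlonglongrightarrow> h x"
    using r(2) by eventually_elim (simp add: h_def convergent_LIMSEQ_iff[symmetric] Cauchy_convergent)
  have bound: "(\<integral>\<^sup>+x. ennreal ((g n x - h x)\<^sup>2) \<partial>M) \<le> ennreal (e\<^sup>2)"
    if N: "\<And>i j. i \<ge> N \<Longrightarrow> j \<ge> N \<Longrightarrow> L2_norm M (\<lambda>x. g i x - g j x) < e" and n: "n \<ge> N" and "e > 0" for e N n
  proof -
    have "(\<integral>\<^sup>+x. ennreal ((g n x - h x)\<^sup>2) \<partial>M) = (\<integral>\<^sup>+x. liminf (\<lambda>i. ennreal ((g n x - g (r i) x)\<^sup>2)) \<partial>M)"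
    proof (rule nn_integral_cong_AE, use lim in eventually_elim)
      fix x assume "(\<lambda>i. g (r i) x) \<longlonglongrightarrow> h x"
      then have "(\<lambda>i. ennreal ((g n x - g (r i) x)\<^sup>2)) \<longlonglongrightarrow> ennreal ((g n x - h x)\<^sup>2)"
        by (intro tendsto_ennrealI tendsto_intros)
      then show "ennreal ((g n x - h x)\<^sup>2) = liminf (\<lambda>i. ennreal ((g n x - g (r i) x)\<^sup>2))"
        by (intro lim_imp_Liminf[symmetric]) auto
    qed
    also have "\<dots> \<le> liminf (\<lambda>i. \<integral>\<^sup>+x. ennreal ((g n x - g (r i) x)\<^sup>2) \<partial>M)"
      by (rule nn_integral_liminf) measurable
    also have "\<dots> \<le> ennreal (e\<^sup>2)"
    proof (rule Liminf_le)
      show "\<forall>\<^sub>F i in sequentially. (\<integral>\<^sup>+x. ennreal ((g n x - g (r i) x)\<^sup>2) \<partial>M) \<le> ennreal (e\<^sup>2)"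
        using eventually_ge_at_top[of N]
      proof eventually_elim
        case (elim i)
        have "r i \<ge> N" using elim seq_suble[OF r(1), of i] by linarith
        then have "(L2_norm M (\<lambda>x. g n x - g (r i) x))\<^sup>2 \<le> e\<^sup>2"
          using N[OF n] by (intro power_mono) (auto intro: less_imp_le)
        moreover have "(\<integral>\<^sup>+x. ennreal ((g n x - g (r i) x)\<^sup>2) \<partial>M) = ennreal ((L2_norm M (\<lambda>x. g n x - g (r i) x))\<^sup>2)"
          unfolding L2_norm_power2_integral using L2_diff[OF L2 L2, of n "r i"]
          by (intro nn_integral_eq_integral) (auto simp: L2_def)
        ultimately show ?case by (simp add: ennreal_leI)
      qed
    qed simp
    finally show ?thesis .
  qed
  have inL2: "(\<lambda>x. g n x - h x) \<in> L2 M" and small: "L2_norm M (\<lambda>x. g n x - h x) \<le> e"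
    if N: "\<And>i j. i \<ge> N \<Longrightarrow> j \<ge> N \<Longrightarrow> L2_norm M (\<lambda>x. g i x - g j x) < e" and n: "n \<ge> N" and e: "e > 0" for e N n
  proof -
    note b = bound[OF N n e]
    have int: "integrable M (\<lambda>x. (g n x - h x)\<^sup>2)"
      by (rule integrableI_bounded) (use b in \<open>auto intro: le_less_trans\<close>)
    then show "(\<lambda>x. g n x - h x) \<in> L2 M" by (simp add: L2_def)
    have "ennreal ((L2_norm M (\<lambda>x. g n x - h x))\<^sup>2) \<le> ennreal (e\<^sup>2)"
      using b nn_integral_eq_integral[OF int] by (simp add: L2_norm_power2_integral)
    then have "(L2_norm M (\<lambda>x. g n x - h x))\<^sup>2 \<le> e\<^sup>2" by simp
    then show "L2_norm M (\<lambda>x. g n x - h x) \<le> e" using e by (auto intro: power2_le_imp_le)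
  qed
  obtain N where N: "\<And>i j. i \<ge> N \<Longrightarrow> j \<ge> N \<Longrightarrow> L2_norm M (\<lambda>x. g i x - g j x) < 1"
    using cauchy[of 1] by auto
  have "(\<lambda>x. g N x - h x) \<in> L2 M" by (rule inL2[OF N order_refl]) auto
  from L2_diff[OF L2[of N] this] have "h \<in> L2 M" by simp
  moreover have "(\<lambda>n. L2_norm M (\<lambda>x. g n x - h x)) \<longlonglongrightarrow> 0"
  proof (rule LIMSEQ_I)
    fix e :: real assume "e > 0"
    then obtain N where "\<And>i j. i \<ge> N \<Longrightarrow> j \<ge> N \<Longrightarrow> L2_norm M (\<lambda>x. g i x - g j x) < e / 2"
      using cauchy[of "e / 2"] by auto
    from small[OF this] \<open>e > 0\<close> show "\<exists>N. \<forall>n\<ge>N. norm (L2_norm M (\<lambda>x. g n x - h x) - 0) < e"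
      by (intro exI[of _ N]) force
  qed
  ultimately show ?thesis by (rule that)
qed

lemma L2_norm_cong:
  assumes "\<And>x. x \<in> space M \<Longrightarrow> f x = g x"
  shows "L2_norm M f = L2_norm M g"
  unfolding L2_norm_def L2_inner_def
  by (rule arg_cong[where f = sqrt], rule Bochner_Integration.integral_cong) (use assms in auto)

section \<open>Orthonormal bases\<close>

text \<open>
  Zorn's lemma.  A function that is orthogonal to a maximal orthonormal set and not almost
  everywhere zero could be normalized and added to the set.
\<close>

lemma L2_onb_exists: "\<exists>E. L2_onb M E"
proof -
  define OS where "OS = {E. E \<subseteq> L2 M \<and> (\<forall>e\<in>E. \<forall>e'\<in>E. L2_inner M e e' = (if e = e' then 1 else 0))}"
  have "\<exists>E\<in>OS. \<forall>X\<in>OS. E \<subseteq> X \<longrightarrow> X = E"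
  proof (rule subset_Zorn')
    fix C assume "subset.chain OS C"
    then have C: "C \<subseteq> OS" "\<And>X Y. X \<in> C \<Longrightarrow> Y \<in> C \<Longrightarrow> X \<subseteq> Y \<or> Y \<subseteq> X"
      by (auto simp: subset.chain_def)
    have "L2_inner M e e' = (if e = e' then 1 else 0)" if e: "e \<in> \<Union>C" "e' \<in> \<Union>C" for e e'
    proof -
      obtain X Y where XY: "X \<in> C" "e \<in> X" "Y \<in> C" "e' \<in> Y" using e by auto
      then obtain Z where "Z \<in> C" "e \<in> Z" "e' \<in> Z" using C(2)[of X Y] by auto
      then show ?thesis using C(1) by (auto simp: OS_def)
    qed
    then show "\<Union>C \<in> OS" using C(1) by (auto simp: OS_def)
  qed
  then obtain E where E: "E \<in> OS" and max: "\<And>X. X \<in> OS \<Longrightarrow> E \<subseteq> X \<Longrightarrow> X = E" by blast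
  have "AE x in M. f x = 0" if f: "f \<in> L2 M" and orth: "\<forall>e\<in>E. L2_inner M f e = 0" for f
  proof (rule ccontr)
    assume "\<not> (AE x in M. f x = 0)"
    then have nz: "L2_norm M f \<noteq> 0" using L2_norm_eq_0_iff[OF f] by simp
    define g where "g = (\<lambda>x. inverse (L2_norm M f) * f x)"
    have g: "g \<in> L2 M" using f by (simp add: g_def L2_cmult)
    have "L2_inner M g g = inverse (L2_norm M f) * (inverse (L2_norm M f) * L2_inner M f f)"
      by (simp only: g_def L2_inner_cmult_left L2_inner_cmult_right)
    moreover have inverse_mult_cancel: "inverse n * (inverse n * (n * n)) = 1" if "n \<noteq> 0" for n :: real
      using that by (simp add: field_simps)
    ultimately have gg: "L2_inner M g g = 1"
      using nz by (simp only: L2_norm_power2[symmetric] power2_eq_square inverse_mult_cancel)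
    have ge: "L2_inner M g e = 0" if "e \<in> E" for e using orth that by (simp add: g_def L2_inner_cmult_left)
    have ge': "L2_inner M e g = 0" if "e \<in> E" for e using ge[OF that] by (simp add: L2_inner_commute)
    have "insert g E \<in> OS"
      using E g gg ge ge' by (auto simp: OS_def)
    then have "g \<in> E" using max[of "insert g E"] by auto
    then show False using gg ge[of g] by simp
  qed
  moreover have "E \<subseteq> L2 M" "\<forall>e\<in>E. \<forall>e'\<in>E. L2_inner M e e' = (if e = e' then 1 else 0)"
    using E by (simp_all add: OS_def)
  ultimately have "L2_onb M E" unfolding L2_onb_def by blast
  then show ?thesis ..
qed

definition L2_project :: "'a measure \<Rightarrow> ('a \<Rightarrow> real) set \<Rightarrow> ('a \<Rightarrow> real) \<Rightarrow> 'a \<Rightarrow> real" where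
  "L2_project M F f = (\<lambda>x. \<Sum>e\<in>F. L2_inner M f e * e x)"

context
  fixes M :: "'a measure" and E :: "('a \<Rightarrow> real) set"
  assumes onb: "L2_onb M E"
begin

lemma onb_L2: "e \<in> E \<Longrightarrow> e \<in> L2 M"
  using onb by (auto simp: L2_onb_def)

lemma onb_inner: "e \<in> E \<Longrightarrow> e' \<in> E \<Longrightarrow> L2_inner M e e' = (if e = e' then 1 else 0)"
  using onb unfolding L2_onb_def by blast

lemma onb_norm: "e \<in> E \<Longrightarrow> L2_norm M e = 1"
  by (simp add: L2_norm_def onb_inner)

lemma onb_combination_L2: "F \<subseteq> E \<Longrightarrow> (\<lambda>x. \<Sum>e\<in>F. c e * e x) \<in> L2 M"
  by (intro L2_sum L2_cmult) (auto intro: onb_L2)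

lemma L2_project_L2: "F \<subseteq> E \<Longrightarrow> L2_project M F f \<in> L2 M"
  unfolding L2_project_def by (rule onb_combination_L2)

lemma onb_combination_inner:
  assumes "finite F" "F \<subseteq> E" "e \<in> E"
  shows "L2_inner M (\<lambda>x. \<Sum>e\<in>F. c e * e x) e = (if e \<in> F then c e else 0)"
proof -
  have "L2_inner M (\<lambda>x. \<Sum>e\<in>F. c e * e x) e = (\<Sum>e'\<in>F. c e' * L2_inner M e' e)"
    using assms onb_L2 by (subst L2_inner_sum_left) (auto intro!: L2_cmult simp: L2_inner_cmult_left)
  also have "\<dots> = (\<Sum>e'\<in>F. if e' = e then c e' else 0)"
    using assms by (intro sum.cong refl) (auto simp: onb_inner)
  finally show ?thesis using assms(1) by simp
qed

lemma onb_combination_norm: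
  assumes "finite F" "F \<subseteq> E"
  shows "L2_norm M (\<lambda>x. \<Sum>e\<in>F. c e * e x) = L2_set c F"
proof -
  have "(L2_norm M (\<lambda>x. \<Sum>e\<in>F. c e * e x))\<^sup>2 = (\<Sum>e\<in>F. L2_inner M (\<lambda>x. \<Sum>e\<in>F. c e * e x) (\<lambda>x. c e * e x))"
    unfolding L2_norm_power2 using assms(2) onb_L2
    by (intro L2_inner_sum_right L2_cmult onb_combination_L2) auto
  also have "\<dots> = (\<Sum>e\<in>F. (c e)\<^sup>2)"
    using onb_combination_inner[OF assms] assms(2)
    by (intro sum.cong refl) (auto simp: L2_inner_cmult_right power2_eq_square)
  finally show ?thesis unfolding L2_set_def by (intro real_sqrt_unique[symmetric]) auto
qed

lemma L2_project_residual:
  assumes "finite F" "F \<subseteq> E" "f \<in> L2 M"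
  shows "(L2_norm M (\<lambda>x. f x - L2_project M F f x))\<^sup>2 = (L2_norm M f)\<^sup>2 - (\<Sum>e\<in>F. (L2_inner M f e)\<^sup>2)"
proof -
  let ?P = "L2_project M F f"
  have P: "?P \<in> L2 M" by (rule L2_project_L2[OF assms(2)])
  have "L2_inner M f ?P = (\<Sum>e\<in>F. L2_inner M f (\<lambda>x. L2_inner M f e * e x))"
    unfolding L2_project_def using assms onb_L2 by (intro L2_inner_sum_right L2_cmult) auto
  then have 1: "L2_inner M f ?P = (\<Sum>e\<in>F. (L2_inner M f e)\<^sup>2)"
    by (simp add: L2_inner_cmult_right power2_eq_square)
  have 2: "L2_inner M ?P ?P = (\<Sum>e\<in>F. (L2_inner M f e)\<^sup>2)"
    using onb_combination_norm[OF assms(1,2), of "L2_inner M f"]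
    unfolding L2_norm_power2[symmetric] L2_project_def
    by (simp add: L2_set_def sum_nonneg)
  have "(L2_norm M (\<lambda>x. f x - ?P x))\<^sup>2 = L2_inner M f f - L2_inner M ?P f - (L2_inner M f ?P - L2_inner M ?P ?P)"
    unfolding L2_norm_power2 using P assms(3) by (simp add: L2_inner_diff_left L2_inner_diff_right L2_diff)
  then show ?thesis using 1 2 by (simp add: L2_norm_power2 L2_inner_commute)
qed

lemma L2_Bessel:
  assumes "finite F" "F \<subseteq> E" "f \<in> L2 M"
  shows "(\<Sum>e\<in>F. (L2_inner M f e)\<^sup>2) \<le> (L2_norm M f)\<^sup>2"
  using L2_project_residual[OF assms] zero_le_power2[of "L2_norm M (\<lambda>x. f x - L2_project M F f x)"] by linarith

lemma L2_project_diff_norm: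
  assumes "finite F" "G \<subseteq> F" "F \<subseteq> E" "f \<in> L2 M"
  shows "(L2_norm M (\<lambda>x. L2_project M F f x - L2_project M G f x))\<^sup>2
    = (\<Sum>e\<in>F. (L2_inner M f e)\<^sup>2) - (\<Sum>e\<in>G. (L2_inner M f e)\<^sup>2)"
proof -
  have "(\<lambda>x. L2_project M F f x - L2_project M G f x) = (\<lambda>x. \<Sum>e\<in>F - G. L2_inner M f e * e x)"
    using assms by (auto simp: L2_project_def sum_diff finite_subset)
  moreover have "(L2_norm M (\<lambda>x. \<Sum>e\<in>F - G. L2_inner M f e * e x))\<^sup>2 = (\<Sum>e\<in>F - G. (L2_inner M f e)\<^sup>2)"
    using assms by (subst onb_combination_norm) (auto simp: L2_set_def sum_nonneg)
  ultimately show ?thesis using assms by (simp add: sum_diff)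
qed

text \<open>
  Parseval's identity in the form used below.  Choose finite sets \<open>F n\<close> along which the partial sums of
  the squared coefficients approach their supremum.  The projections converge by completeness, and
  the difference of \<open>f\<close> and the limit is orthogonal to the basis, hence zero.
\<close>

theorem L2_project_approximates:
  assumes "finite_measure M" "f \<in> L2 M" "\<eta> > 0"
  obtains F where "finite F" "F \<subseteq> E" "L2_norm M (\<lambda>x. f x - L2_project M F f x) < \<eta>"
proof -
  interpret finite_measure M by fact
  define q where "q F = (\<Sum>e\<in>F. (L2_inner M f e)\<^sup>2)" for F
  define \<F> where "\<F> = {F. finite F \<and> F \<subseteq> E}"
  define s where "s = (SUP F\<in>\<F>. q F)"
  have bdd: "bdd_above (q ` \<F>)"
    using L2_Bessel[OF _ _ assms(2)] by (auto simp: q_def \<F>_def intro!: bdd_aboveI[of _ "(L2_norm M f)\<^sup>2"])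
  have ne: "\<F> \<noteq> {}" by (auto simp: \<F>_def)
  have qs: "q F \<le> s" if "F \<in> \<F>" for F unfolding s_def by (rule cSUP_upper[OF that bdd])
  have "\<exists>F\<in>\<F>. s - ((1/2) ^ n)\<^sup>2 < q F" for n :: nat
    using less_cSUP_iff[OF ne bdd, of "s - ((1/2) ^ n)\<^sup>2"] by (simp add: s_def[symmetric])
  then obtain F where F: "\<And>n. F n \<in> \<F>" "\<And>n. s - ((1/2) ^ n)\<^sup>2 < q (F n)" by metis
  have Ff: "finite (F n)" "F n \<subseteq> E" for n using F(1)[of n] by (auto simp: \<F>_def)
  let ?P = "\<lambda>n. L2_project M (F n) f"
  have P: "?P n \<in> L2 M" for n by (rule L2_project_L2[OF Ff(2)])
  have half: "L2_norm M (\<lambda>x. L2_project M (F i \<union> F j) f x - ?P i x) \<le> (1/2) ^ i" for i j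
  proof (rule power2_le_imp_le)
    have "F i \<union> F j \<in> \<F>" using Ff by (auto simp: \<F>_def)
    then show "(L2_norm M (\<lambda>x. L2_project M (F i \<union> F j) f x - ?P i x))\<^sup>2 \<le> ((1/2) ^ i)\<^sup>2"
      using L2_project_diff_norm[of "F i \<union> F j" "F i" f] Ff assms(2) qs[of "F i \<union> F j"] F(2)[of i]
      by (simp add: q_def)
  qed simp
  have dist: "L2_norm M (\<lambda>x. ?P i x - ?P j x) \<le> (1/2) ^ i + (1/2) ^ j" for i j
  proof -
    let ?Q = "L2_project M (F i \<union> F j) f"
    have Q: "?Q \<in> L2 M" using Ff by (intro L2_project_L2) auto
    have "L2_norm M (\<lambda>x. ?P i x - ?P j x) = L2_norm M (\<lambda>x. (?Q x - ?P j x) - (?Q x - ?P i x))" by simp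
    also have "\<dots> \<le> L2_norm M (\<lambda>x. ?Q x - ?P j x) + L2_norm M (\<lambda>x. ?Q x - ?P i x)"
      using P Q by (intro L2_norm_diff_triangle L2_diff)
    also have "\<dots> \<le> (1/2) ^ j + (1/2) ^ i"
      using half[of i j] half[of j i] by (intro add_mono) (auto simp: Un_commute)
    finally show ?thesis by simp
  qed
  have pow: "\<exists>N. \<forall>i\<ge>N. (1/2::real) ^ i < e" if e: "e > 0" for e
  proof -
    obtain N where N: "(1/2::real) ^ N < e" using real_arch_pow_inv[of e "1/2"] e by auto
    have "(1/2::real) ^ i < e" if "i \<ge> N" for i
      by (rule le_less_trans[OF power_decreasing[OF that] N]) auto
    then show ?thesis by blast
  qed
  obtain h where h: "h \<in> L2 M" "(\<lambda>n. L2_norm M (\<lambda>x. ?P n x - h x)) \<longlonglongrightarrow> 0"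
  proof (rule L2_complete[of ?P])
    show "?P n \<in> L2 M" for n by (rule P)
    fix e :: real assume "e > 0"
    then obtain N where N: "\<And>i. i \<ge> N \<Longrightarrow> (1/2::real) ^ i < e / 2" using pow[of "e / 2"] by auto
    have "L2_norm M (\<lambda>x. ?P i x - ?P j x) < e" if "i \<ge> N" "j \<ge> N" for i j
      using dist[of i j] N[OF that(1)] N[OF that(2)] by linarith
    then show "\<exists>N. \<forall>i\<ge>N. \<forall>j\<ge>N. L2_norm M (\<lambda>x. ?P i x - ?P j x) < e" by blast
  qed
  have "L2_inner M (\<lambda>x. f x - h x) e = 0" if e: "e \<in> E" for e
  proof -
    have bound: "\<bar>L2_inner M (\<lambda>x. f x - h x) e\<bar> \<le> (1/2) ^ n + L2_norm M (\<lambda>x. ?P n x - h x)" for n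
    proof -
      have eL: "e \<in> L2 M" by (rule onb_L2[OF e])
      have Pe: "L2_inner M (?P n) e = (if e \<in> F n then L2_inner M f e else 0)"
        unfolding L2_project_def by (rule onb_combination_inner[OF Ff e])
      have "\<bar>L2_inner M f e - L2_inner M (?P n) e\<bar> \<le> (1/2) ^ n"
      proof (cases "e \<in> F n")
        case False
        have "insert e (F n) \<in> \<F>" using Ff e by (auto simp: \<F>_def)
        then have "(L2_inner M f e)\<^sup>2 \<le> ((1/2) ^ n)\<^sup>2"
          using qs[of "insert e (F n)"] F(2)[of n] False Ff by (simp add: q_def)
        then have "\<bar>L2_inner M f e\<bar> \<le> (1/2) ^ n" by (rule power2_le_iff_abs_le[THEN iffD1, rotated]) simp
        then show ?thesis using False Pe by simp
      qed (simp add: Pe)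
      moreover have "\<bar>L2_inner M (\<lambda>x. ?P n x - h x) e\<bar> \<le> L2_norm M (\<lambda>x. ?P n x - h x)"
        using L2_Cauchy_Schwarz[OF L2_diff[OF P[of n] h(1)] eL] onb_norm[OF e] by simp
      moreover have "L2_inner M (\<lambda>x. f x - h x) e = (L2_inner M f e - L2_inner M (?P n) e) + L2_inner M (\<lambda>x. ?P n x - h x) e"
        using assms(2) h(1) P[of n] eL by (simp add: L2_inner_diff_left)
      ultimately show ?thesis by linarith
    qed
    have "(\<lambda>n. (1/2) ^ n + L2_norm M (\<lambda>x. ?P n x - h x)) \<longlonglongrightarrow> 0 + 0"
      by (intro tendsto_add h(2) LIMSEQ_power_zero) simp
    then have "\<bar>L2_inner M (\<lambda>x. f x - h x) e\<bar> \<le> 0 + 0"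
      by (rule LIMSEQ_le_const) (use bound in blast)
    then show ?thesis by simp
  qed
  then have "AE x in M. f x - h x = 0"
    using onb L2_diff[OF assms(2) h(1)] unfolding L2_onb_def by blast
  then have fh: "L2_norm M (\<lambda>x. f x - h x) = 0"
    using L2_norm_eq_0_iff[OF L2_diff[OF assms(2) h(1)]] by simp
  obtain n where n: "L2_norm M (\<lambda>x. ?P n x - h x) < \<eta>"
    using LIMSEQ_D[OF h(2) assms(3)] by auto
  have "L2_norm M (\<lambda>x. f x - ?P n x) = L2_norm M (\<lambda>x. (f x - h x) - (?P n x - h x))" by simp
  also have "\<dots> \<le> L2_norm M (\<lambda>x. f x - h x) + L2_norm M (\<lambda>x. ?P n x - h x)"
    using assms(2) h(1) P by (intro L2_norm_diff_triangle L2_diff)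
  finally show ?thesis using fh n by (intro that[OF Ff(1) Ff(2), of n]) simp
qed

end

section \<open>Integral operators with bounded kernels\<close>

text \<open>
  Only the action on \<open>L2 M\<close> and the values on \<open>space M\<close> are prescribed, as operators act on
  representatives.
\<close>

definition has_bounded_kernel ::
  "'a measure \<Rightarrow> (('a \<Rightarrow> real) \<Rightarrow> 'a \<Rightarrow> real) \<Rightarrow> ('a \<Rightarrow> 'a \<Rightarrow> real) \<Rightarrow> real \<Rightarrow> bool" where
  "has_bounded_kernel M T k C \<longleftrightarrow> case_prod k \<in> borel_measurable (M \<Otimes>\<^sub>M M) \<and>
     (\<forall>x\<in>space M. \<forall>y\<in>space M. \<bar>k x y\<bar> \<le> C) \<and>
     (\<forall>f\<in>L2 M. \<forall>x\<in>space M. T f x = (\<integral>y. k x y * f y \<partial>M))"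

text \<open>
  Testing an operator against such pairs makes its norm a supremum of linear functionals of the
  operator.
\<close>

definition L2_test_pairs :: "'a measure \<Rightarrow> (('a \<Rightarrow> real) \<times> ('a \<Rightarrow> real)) set" where
  "L2_test_pairs M = {(f, g). f \<in> L2 M \<and> g \<in> L2 M \<and> L2_norm M f \<le> 1 \<and> L2_norm M g \<le> 1}"

lemma zero_test_pair: "((\<lambda>_. 0), (\<lambda>_. 0)) \<in> L2_test_pairs M"
  by (simp add: L2_test_pairs_def)

lemma has_bounded_kernel_cmult:
  assumes "has_bounded_kernel M T k C"
  shows "has_bounded_kernel M (\<lambda>f x. c * T f x) (\<lambda>x y. c * k x y) (\<bar>c\<bar> * C)"
  unfolding has_bounded_kernel_def
proof (intro conjI ballI)
  have [measurable]: "case_prod k \<in> borel_measurable (M \<Otimes>\<^sub>M M)"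
    using assms by (simp add: has_bounded_kernel_def)
  show "(\<lambda>(x, y). c * k x y) \<in> borel_measurable (M \<Otimes>\<^sub>M M)" by measurable
  show "\<bar>c * k x y\<bar> \<le> \<bar>c\<bar> * C" if "x \<in> space M" "y \<in> space M" for x y
    using assms that by (simp add: has_bounded_kernel_def abs_mult mult_left_mono)
  show "c * T f x = (\<integral>y. c * k x y * f y \<partial>M)" if "f \<in> L2 M" "x \<in> space M" for f x
    using assms that by (simp add: has_bounded_kernel_def mult.assoc)
qed

context finite_measure
begin

context
  fixes T :: "('a \<Rightarrow> real) \<Rightarrow> 'a \<Rightarrow> real" and k :: "'a \<Rightarrow> 'a \<Rightarrow> real" and C :: real
  assumes T: "has_bounded_kernel M T k C"
begin

lemma kernel_measurable: "case_prod k \<in> borel_measurable (M \<Otimes>\<^sub>M M)"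
  and kernel_bound: "x \<in> space M \<Longrightarrow> y \<in> space M \<Longrightarrow> \<bar>k x y\<bar> \<le> C"
  and kernel_apply: "f \<in> L2 M \<Longrightarrow> x \<in> space M \<Longrightarrow> T f x = (\<integral>y. k x y * f y \<partial>M)"
  using T by (auto simp: has_bounded_kernel_def)

lemma kernel_slice_measurable: "x \<in> space M \<Longrightarrow> (\<lambda>y. k x y) \<in> borel_measurable M"
  using measurable_compose[OF measurable_Pair1' kernel_measurable] by simp

lemma kernel_slice_L2: "x \<in> space M \<Longrightarrow> k x \<in> L2 M"
  unfolding L2_def
proof safe
  assume x: "x \<in> space M"
  show "k x \<in> borel_measurable M" using kernel_slice_measurable[OF x] by simp
  then show "integrable M (\<lambda>y. (k x y)\<^sup>2)"
  proof (intro integrable_const_bound[of _ "C\<^sup>2"] AE_I2)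
    fix y assume "y \<in> space M"
    then show "norm ((k x y)\<^sup>2) \<le> C\<^sup>2"
      using power_mono[OF kernel_bound[OF x], of y 2] by simp
  qed simp
qed

lemma kernel_slice_norm_le:
  assumes "x \<in> space M"
  shows "(L2_norm M (k x))\<^sup>2 \<le> C\<^sup>2 * measure M (space M)"
proof -
  have "(L2_norm M (k x))\<^sup>2 = (\<integral>y. (k x y)\<^sup>2 \<partial>M)" by (rule L2_norm_power2_integral)
  also have "\<dots> \<le> (\<integral>y. C\<^sup>2 \<partial>M)"
  proof (rule integral_mono)
    show "integrable M (\<lambda>y. (k x y)\<^sup>2)" using kernel_slice_L2[OF assms] by (simp add: L2_def)
    show "(k x y)\<^sup>2 \<le> C\<^sup>2" if "y \<in> space M" for y
      using power_mono[OF kernel_bound[OF assms that], of 2] by simp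
  qed simp
  finally show ?thesis by (simp add: mult.commute)
qed

lemma kernel_apply_inner: "f \<in> L2 M \<Longrightarrow> x \<in> space M \<Longrightarrow> T f x = L2_inner M f (k x)"
  by (simp add: kernel_apply L2_inner_def mult.commute)

lemma kernel_op_measurable:
  assumes "f \<in> L2 M"
  shows "T f \<in> borel_measurable M"
proof -
  have [measurable]: "f \<in> borel_measurable M" using assms by (rule L2_measurable)
  note [measurable] = kernel_measurable
  have "(\<lambda>x. \<integral>y. k x y * f y \<partial>M) \<in> borel_measurable M" by measurable
  then show ?thesis using kernel_apply[OF assms] by (simp cong: measurable_cong)
qed

lemma kernel_op_L2:
  assumes "f \<in> L2 M"
  shows "T f \<in> L2 M"
  unfolding L2_def
proof safe
  show "T f \<in> borel_measurable M" by (rule kernel_op_measurable[OF assms])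
  then show "integrable M (\<lambda>x. (T f x)\<^sup>2)"
  proof (intro integrable_const_bound[of _ "(L2_norm M f)\<^sup>2 * (C\<^sup>2 * measure M (space M))"] AE_I2)
    fix x assume x: "x \<in> space M"
    have "\<bar>T f x\<bar>\<^sup>2 \<le> (L2_norm M f * L2_norm M (k x))\<^sup>2"
      unfolding kernel_apply_inner[OF assms x]
      by (intro power_mono L2_Cauchy_Schwarz assms kernel_slice_L2 x) auto
    also have "\<dots> \<le> (L2_norm M f)\<^sup>2 * (C\<^sup>2 * measure M (space M))"
      unfolding power_mult_distrib by (intro mult_left_mono kernel_slice_norm_le x) auto
    finally show "norm ((T f x)\<^sup>2) \<le> (L2_norm M f)\<^sup>2 * (C\<^sup>2 * measure M (space M))" by simp
  qed simp
qed

text \<open>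
  Bessel's inequality for each slice \<open>k x\<close> of the kernel, integrated over \<open>x\<close>.
\<close>

lemma kernel_hs_le:
  assumes "L2_onb M E" "finite F" "F \<subseteq> E"
  shows "(\<Sum>e\<in>F. (L2_norm M (T e))\<^sup>2) \<le> (C * measure M (space M))\<^sup>2"
proof -
  have eL: "e \<in> L2 M" if "e \<in> F" for e using that assms(3) onb_L2[OF assms(1)] by blast
  have int: "integrable M (\<lambda>x. (T e x)\<^sup>2)" if "e \<in> F" for e
    using kernel_op_L2[OF eL[OF that]] by (simp add: L2_def)
  have "(\<Sum>e\<in>F. (L2_norm M (T e))\<^sup>2) = (\<integral>x. (\<Sum>e\<in>F. (T e x)\<^sup>2) \<partial>M)"
    unfolding L2_norm_power2_integral using int by (simp add: Bochner_Integration.integral_sum)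
  also have "\<dots> \<le> (\<integral>x. C\<^sup>2 * measure M (space M) \<partial>M)"
  proof (rule integral_mono)
    show "integrable M (\<lambda>x. \<Sum>e\<in>F. (T e x)\<^sup>2)" using int by (rule Bochner_Integration.integrable_sum)
    fix x assume x: "x \<in> space M"
    have "(\<Sum>e\<in>F. (T e x)\<^sup>2) = (\<Sum>e\<in>F. (L2_inner M (k x) e)\<^sup>2)"
      by (intro sum.cong refl) (simp add: kernel_apply_inner[OF eL x] L2_inner_commute)
    also have "\<dots> \<le> (L2_norm M (k x))\<^sup>2"
      by (rule L2_Bessel[OF assms kernel_slice_L2[OF x]])
    finally show "(\<Sum>e\<in>F. (T e x)\<^sup>2) \<le> C\<^sup>2 * measure M (space M)"
      using kernel_slice_norm_le[OF x] by linarith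
  qed simp
  finally show ?thesis by (simp add: power2_eq_square mult_ac)
qed

lemma kernel_op_norm_le:
  assumes "f \<in> L2 M" "0 \<le> C"
  shows "L2_norm M (T f) \<le> (C * measure M (space M)) * L2_norm M f"
proof (rule power2_le_imp_le)
  have "(L2_norm M (T f))\<^sup>2 = (\<integral>x. (T f x)\<^sup>2 \<partial>M)" by (rule L2_norm_power2_integral)
  also have "\<dots> \<le> (\<integral>x. (L2_norm M f)\<^sup>2 * (C\<^sup>2 * measure M (space M)) \<partial>M)"
  proof (rule integral_mono)
    show "integrable M (\<lambda>x. (T f x)\<^sup>2)" using kernel_op_L2[OF assms(1)] by (simp add: L2_def)
    fix x assume x: "x \<in> space M"
    have "\<bar>T f x\<bar>\<^sup>2 \<le> (L2_norm M f * L2_norm M (k x))\<^sup>2"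
      unfolding kernel_apply_inner[OF assms(1) x]
      by (intro power_mono L2_Cauchy_Schwarz assms kernel_slice_L2 x) auto
    also have "\<dots> \<le> (L2_norm M f)\<^sup>2 * (C\<^sup>2 * measure M (space M))"
      unfolding power_mult_distrib by (intro mult_left_mono kernel_slice_norm_le x) auto
    finally show "(T f x)\<^sup>2 \<le> (L2_norm M f)\<^sup>2 * (C\<^sup>2 * measure M (space M))" by simp
  qed simp
  also have "\<dots> = ((C * measure M (space M)) * L2_norm M f)\<^sup>2"
    by (simp add: power_mult_distrib power2_eq_square mult_ac)
  finally show "(L2_norm M (T f))\<^sup>2 \<le> ((C * measure M (space M)) * L2_norm M f)\<^sup>2" .
qed (use assms in auto)

lemma kernel_op_adjoint:
  assumes f: "f \<in> L2 M" and g: "g \<in> L2 M"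
  shows "L2_inner M (T f) g = L2_inner M f (\<lambda>y. \<integral>x. k x y * g x \<partial>M)"
proof -
  interpret P: pair_sigma_finite M M ..
  have [measurable]: "f \<in> borel_measurable M" "g \<in> borel_measurable M" using f g by (auto dest: L2_measurable)
  note [measurable] = kernel_measurable
  have int: "integrable (M \<Otimes>\<^sub>M M) (\<lambda>(x, y). k x y * f y * g x)"
  proof (rule P.Fubini_integrable)
    show "(\<lambda>(x, y). k x y * f y * g x) \<in> borel_measurable (M \<Otimes>\<^sub>M M)" by measurable
    have i: "integrable M (\<lambda>y. k x y * f y * g x)" if "x \<in> space M" for x
      using integrable_mult_L2[OF kernel_slice_L2[OF that] f] by simp
    then show "AE x in M. integrable M (\<lambda>y. case (x, y) of (x, y) \<Rightarrow> k x y * f y * g x)" by simp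
    have "integrable M (\<lambda>x. \<integral>y. norm (k x y * f y * g x) \<partial>M)"
    proof (rule Bochner_Integration.integrable_bound)
      show "integrable M (\<lambda>x. C * (\<integral>y. \<bar>f y\<bar> \<partial>M) * g x)" using integrable_L2[OF g] by simp
      show "AE x in M. norm (\<integral>y. norm (k x y * f y * g x) \<partial>M) \<le> norm (C * (\<integral>y. \<bar>f y\<bar> \<partial>M) * g x)"
      proof (rule AE_I2)
        fix x assume x: "x \<in> space M"
        have C0: "0 \<le> C" using kernel_bound[OF x x] by linarith
        have "(\<integral>y. norm (k x y * f y * g x) \<partial>M) \<le> (\<integral>y. C * \<bar>f y\<bar> * \<bar>g x\<bar> \<partial>M)"
        proof (rule integral_mono)
          show "integrable M (\<lambda>y. norm (k x y * f y * g x))" using i[OF x] by simp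
          show "integrable M (\<lambda>y. C * \<bar>f y\<bar> * \<bar>g x\<bar>)" using integrable_L2[OF f] by simp
          show "norm (k x y * f y * g x) \<le> C * \<bar>f y\<bar> * \<bar>g x\<bar>" if "y \<in> space M" for y
            unfolding norm_mult real_norm_def abs_mult
            by (intro mult_right_mono kernel_bound x that) auto
        qed
        then show "norm (\<integral>y. norm (k x y * f y * g x) \<partial>M) \<le> norm (C * (\<integral>y. \<bar>f y\<bar> \<partial>M) * g x)"
          using C0 by (simp add: abs_mult)
      qed
    qed measurable
    then show "integrable M (\<lambda>x. \<integral>y. norm (case (x, y) of (x, y) \<Rightarrow> k x y * f y * g x) \<partial>M)" by simp
  qed
  have "L2_inner M (T f) g = (\<integral>x. (\<integral>y. k x y * f y * g x \<partial>M) \<partial>M)"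
    unfolding L2_inner_def by (intro Bochner_Integration.integral_cong refl) (simp add: kernel_apply[OF f])
  also have "\<dots> = (\<integral>y. (\<integral>x. k x y * f y * g x \<partial>M) \<partial>M)"
    using P.Fubini_integral[OF int] by simp
  also have "\<dots> = L2_inner M f (\<lambda>y. \<integral>x. k x y * g x \<partial>M)"
    unfolding L2_inner_def
  proof (intro Bochner_Integration.integral_cong refl)
    fix y
    have "(\<integral>x. k x y * f y * g x \<partial>M) = (\<integral>x. f y * (k x y * g x) \<partial>M)" by (simp add: mult_ac)
    then show "(\<integral>x. k x y * f y * g x \<partial>M) = f y * (\<integral>x. k x y * g x \<partial>M)" by simp
  qed
  finally show ?thesis .
qed

end

lemma kernel_transpose:
  assumes "has_bounded_kernel M T k C"
  shows "has_bounded_kernel M (\<lambda>g y. \<integral>x. k x y * g x \<partial>M) (\<lambda>y x. k x y) C"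
proof -
  have [measurable]: "case_prod k \<in> borel_measurable (M \<Otimes>\<^sub>M M)" by (rule kernel_measurable[OF assms])
  have "(\<lambda>(y, x). k x y) \<in> borel_measurable (M \<Otimes>\<^sub>M M)" by measurable
  then show ?thesis using assms by (auto simp: has_bounded_kernel_def)
qed

context
  fixes T :: "('a \<Rightarrow> real) \<Rightarrow> 'a \<Rightarrow> real" and k :: "'a \<Rightarrow> 'a \<Rightarrow> real" and C :: real
  assumes T: "has_bounded_kernel M T k C"
begin

text \<open>
  The operator with the transposed kernel is an adjoint, so the choice in the definition of the
  adjoint is not vacuous.
\<close>

lemma L2_adjoint_inner:
  assumes "f \<in> L2 M" "g \<in> L2 M"
  shows "L2_adjoint M T g \<in> L2 M" "L2_inner M f (L2_adjoint M T g) = L2_inner M (T f) g"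
proof -
  have "\<exists>T'. (\<forall>g\<in>L2 M. T' g \<in> L2 M) \<and> (\<forall>f\<in>L2 M. \<forall>g\<in>L2 M. L2_inner M (T f) g = L2_inner M f (T' g))"
    using kernel_op_adjoint[OF T] kernel_op_L2[OF kernel_transpose[OF T]]
    by (intro exI[of _ "\<lambda>g y. \<integral>x. k x y * g x \<partial>M"]) simp
  then have "(\<forall>g\<in>L2 M. L2_adjoint M T g \<in> L2 M) \<and>
    (\<forall>f\<in>L2 M. \<forall>g\<in>L2 M. L2_inner M (T f) g = L2_inner M f (L2_adjoint M T g))"
    unfolding L2_adjoint_def by (rule someI_ex)
  then show "L2_adjoint M T g \<in> L2 M" "L2_inner M f (L2_adjoint M T g) = L2_inner M (T f) g"
    using assms by auto
qed

text \<open>\<open>tr (T* T)\<close> is the squared Hilbert-Schmidt norm.\<close>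

lemma L2_trace_adjoint_comp:
  "L2_trace M (L2_adjoint M T \<circ> T) = (\<Sum>\<^sub>\<infinity>e\<in>(SOME E. L2_onb M E). (L2_norm M (T e))\<^sup>2)"
proof -
  have onb: "L2_onb M (SOME E. L2_onb M E)" by (rule someI_ex[OF L2_onb_exists])
  have "L2_inner M ((L2_adjoint M T \<circ> T) e) e = (L2_norm M (T e))\<^sup>2" if "e \<in> (SOME E. L2_onb M E)" for e
  proof -
    have e: "e \<in> L2 M" by (rule onb_L2[OF onb that])
    then show ?thesis
      using L2_adjoint_inner(2)[OF e kernel_op_L2[OF T e]] by (simp add: L2_norm_power2 L2_inner_commute)
  qed
  then show ?thesis unfolding L2_trace_def Let_def by (rule infsum_cong)
qed

lemma kernel_hs_summable:
  assumes "L2_onb M E"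
  shows "(\<lambda>e. (L2_norm M (T e))\<^sup>2) summable_on E"
  by (rule nonneg_bdd_above_summable_on)
    (auto intro!: bdd_aboveI[of _ "(C * measure M (space M))\<^sup>2"] kernel_hs_le[OF T assms])

lemma finite_hs_le_infsum:
  assumes "L2_onb M E" "finite F" "F \<subseteq> E"
  shows "(\<Sum>e\<in>F. (L2_norm M (T e))\<^sup>2) \<le> (\<Sum>\<^sub>\<infinity>e\<in>E. (L2_norm M (T e))\<^sup>2)"
  using finite_sum_le_infsum[OF kernel_hs_summable[OF assms(1)] assms(2,3)] by simp

lemma infsum_hs_le:
  assumes "L2_onb M E"
  shows "(\<Sum>\<^sub>\<infinity>e\<in>E. (L2_norm M (T e))\<^sup>2) \<le> (C * measure M (space M))\<^sup>2"
  by (rule infsum_le_finite_sums[OF kernel_hs_summable[OF assms]]) (rule kernel_hs_le[OF T assms])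

subsection \<open>Operator norm\<close>

lemma kernel_op_norm_le_abs:
  assumes "f \<in> L2 M"
  shows "L2_norm M (T f) \<le> (\<bar>C\<bar> * measure M (space M)) * L2_norm M f"
proof (rule kernel_op_norm_le[OF _ assms])
  show "has_bounded_kernel M T k \<bar>C\<bar>"
    using T abs_ge_self[of C] unfolding has_bounded_kernel_def by (meson order_trans)
qed simp

lemma onorm_quotients_bdd: "bdd_above ((\<lambda>f. L2_norm M (T f) / L2_norm M f) ` L2 M)"
proof (rule bdd_aboveI2)
  fix f assume "f \<in> L2 M"
  then show "L2_norm M (T f) / L2_norm M f \<le> \<bar>C\<bar> * measure M (space M)"
    using kernel_op_norm_le_abs[of f] by (cases "L2_norm M f = 0") (auto simp: pos_divide_le_eq less_le)
qed

lemma L2_onorm_nonneg: "0 \<le> L2_onorm M T"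
  unfolding L2_onorm_def by (rule cSUP_upper2[OF onorm_quotients_bdd L2_zero]) simp

lemma L2_onorm:
  assumes "f \<in> L2 M"
  shows "L2_norm M (T f) \<le> L2_onorm M T * L2_norm M f"
proof (cases "L2_norm M f = 0")
  case True
  then show ?thesis using kernel_op_norm_le_abs[OF assms] by simp
next
  case False
  then have "L2_norm M f > 0" by (simp add: less_le)
  moreover have "L2_norm M (T f) / L2_norm M f \<le> L2_onorm M T"
    unfolding L2_onorm_def by (rule cSUP_upper[OF assms onorm_quotients_bdd])
  ultimately show ?thesis by (simp add: pos_divide_le_eq)
qed

lemma L2_onorm_le:
  assumes "0 \<le> c" "\<And>f. f \<in> L2 M \<Longrightarrow> L2_norm M (T f) \<le> c * L2_norm M f"
  shows "L2_onorm M T \<le> c"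
  unfolding L2_onorm_def
proof (rule cSUP_least)
  show "L2 M \<noteq> {}" using L2_zero by blast
  fix f assume f: "f \<in> L2 M"
  show "L2_norm M (T f) / L2_norm M f \<le> c"
    using assms(1) assms(2)[OF f] by (cases "L2_norm M f = 0") (auto simp: pos_divide_le_eq less_le)
qed

lemma kernel_inner_le:
  assumes "f \<in> L2 M" "g \<in> L2 M"
  shows "\<bar>L2_inner M (T f) g\<bar> \<le> L2_onorm M T * L2_norm M f * L2_norm M g"
proof -
  have "\<bar>L2_inner M (T f) g\<bar> \<le> L2_norm M (T f) * L2_norm M g"
    by (rule L2_Cauchy_Schwarz[OF kernel_op_L2[OF T assms(1)] assms(2)])
  also have "\<dots> \<le> L2_onorm M T * L2_norm M f * L2_norm M g"
    by (rule mult_right_mono[OF L2_onorm[OF assms(1)]]) simp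
  finally show ?thesis .
qed

text \<open>
  Linearity is read off from the adjoint, because \<open>T\<close> is specified only on \<open>space M\<close>.
\<close>

lemma kernel_inner_combination:
  assumes "\<And>e. e \<in> F \<Longrightarrow> e \<in> L2 M" "g \<in> L2 M"
  shows "L2_inner M (T (\<lambda>x. \<Sum>e\<in>F. c e * e x)) g = (\<Sum>e\<in>F. c e * L2_inner M (T e) g)"
proof -
  have "L2_inner M (T (\<lambda>x. \<Sum>e\<in>F. c e * e x)) g = L2_inner M (\<lambda>x. \<Sum>e\<in>F. c e * e x) (L2_adjoint M T g)"
    using assms by (intro L2_adjoint_inner(2)[symmetric] L2_sum L2_cmult)
  also have "\<dots> = (\<Sum>e\<in>F. c e * L2_inner M e (L2_adjoint M T g))"
    using assms L2_adjoint_inner(1)[OF assms(2,2)]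
    by (subst L2_inner_sum_left) (auto intro: L2_cmult simp: L2_inner_cmult_left)
  also have "\<dots> = (\<Sum>e\<in>F. c e * L2_inner M (T e) g)"
    using assms by (intro sum.cong refl) (simp add: L2_adjoint_inner(2))
  finally show ?thesis .
qed

lemma kernel_inner_diff:
  assumes "f \<in> L2 M" "f' \<in> L2 M" "g \<in> L2 M"
  shows "L2_inner M (T (\<lambda>x. f x - f' x)) g = L2_inner M (T f) g - L2_inner M (T f') g"
  using assms L2_adjoint_inner[of _ g] L2_adjoint_inner(2)[OF L2_diff[OF assms(1,2)] assms(3)]
  by (simp add: L2_inner_diff_left flip: L2_adjoint_inner(2))

lemma kernel_inner_cmult:
  assumes "f \<in> L2 M" "g \<in> L2 M"
  shows "L2_inner M (T (\<lambda>x. c * f x)) g = c * L2_inner M (T f) g"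
  using kernel_inner_combination[of "{f}" g "\<lambda>_. c"] assms by simp

lemma test_pair_inner_le:
  assumes "d \<in> L2_test_pairs M"
  shows "\<bar>L2_inner M (T (fst d)) (snd d)\<bar> \<le> L2_onorm M T"
proof -
  have d: "fst d \<in> L2 M" "snd d \<in> L2 M" "L2_norm M (fst d) \<le> 1" "L2_norm M (snd d) \<le> 1"
    using assms by (auto simp: L2_test_pairs_def)
  have "\<bar>L2_inner M (T (fst d)) (snd d)\<bar> \<le> L2_onorm M T * (L2_norm M (fst d) * L2_norm M (snd d))"
    using kernel_inner_le[OF d(1,2)] by (simp add: mult.assoc)
  also have "\<dots> \<le> L2_onorm M T * 1"
    using d(3,4) L2_onorm_nonneg by (intro mult_left_mono mult_le_one) auto
  finally show ?thesis by simp
qed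

lemma L2_onorm_le_test_pairs:
  assumes "0 \<le> c" "\<And>d. d \<in> L2_test_pairs M \<Longrightarrow> L2_inner M (T (fst d)) (snd d) \<le> c"
  shows "L2_onorm M T \<le> c"
proof (rule L2_onorm_le[OF assms(1)])
  fix f assume f: "f \<in> L2 M"
  define a b where "a = L2_norm M f" and "b = L2_norm M (T f)"
  have ab: "0 \<le> a" "0 \<le> b" by (simp_all add: a_def b_def)
  show "L2_norm M (T f) \<le> c * L2_norm M f"
  proof (cases "a = 0 \<or> b = 0")
    case True
    then show ?thesis using L2_onorm[OF f] assms(1) ab by (auto simp: a_def b_def)
  next
    case False
    then have pos: "a > 0" "b > 0" using ab by auto
    let ?f = "\<lambda>x. inverse a * f x" and ?g = "\<lambda>x. inverse b * T f x"
    have Tf: "T f \<in> L2 M" by (rule kernel_op_L2[OF T f])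
    have "(?f, ?g) \<in> L2_test_pairs M"
      using pos f Tf unfolding L2_test_pairs_def
      by (simp add: L2_cmult L2_norm_cmult a_def[symmetric] b_def[symmetric])
    from assms(2)[OF this] have "L2_inner M (T ?f) ?g \<le> c" by simp
    also have "L2_inner M (T ?f) ?g = inverse b * (inverse a * L2_inner M (T f) (T f))"
      using f Tf by (simp only: L2_inner_cmult_right kernel_inner_cmult[OF f Tf])
    also have "\<dots> = b / a"
      using pos by (simp add: L2_norm_power2[symmetric] b_def[symmetric] power2_eq_square divide_inverse)
    finally show ?thesis using pos by (simp add: a_def b_def pos_divide_le_eq)
  qed
qed

text \<open>
  On the span of finitely many basis elements this is the Cauchy-Schwarz inequality for the
  coefficients; projections of the test function exhaust the general case.
\<close>

lemma L2_onorm_power2_le_hs: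
  assumes "L2_onb M E"
  shows "(L2_onorm M T)\<^sup>2 \<le> (\<Sum>\<^sub>\<infinity>e\<in>E. (L2_norm M (T e))\<^sup>2)"
proof -
  define s where "s = (\<Sum>\<^sub>\<infinity>e\<in>E. (L2_norm M (T e))\<^sup>2)"
  have s0: "0 \<le> s" unfolding s_def by (rule infsum_nonneg) simp
  have "L2_onorm M T \<le> sqrt s"
  proof (rule L2_onorm_le_test_pairs)
    fix d assume "d \<in> L2_test_pairs M"
    then have d: "fst d \<in> L2 M" "snd d \<in> L2 M" "L2_norm M (fst d) \<le> 1" "L2_norm M (snd d) \<le> 1"
      by (auto simp: L2_test_pairs_def)
    let ?f = "fst d" and ?g = "snd d"
    show "L2_inner M (T ?f) ?g \<le> sqrt s"
    proof (rule field_le_epsilon)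
      fix \<eta> :: real assume "\<eta> > 0"
      define \<rho> where "\<rho> = \<eta> / (L2_onorm M T + 1)"
      have \<rho>: "\<rho> > 0" "\<rho> * L2_onorm M T \<le> \<eta>"
        using \<open>\<eta> > 0\<close> L2_onorm_nonneg by (auto simp: \<rho>_def field_simps add_nonneg_pos)
      obtain F where F: "finite F" "F \<subseteq> E" and app: "L2_norm M (\<lambda>x. ?f x - L2_project M F ?f x) < \<rho>"
        using L2_project_approximates[OF assms finite_measure_axioms d(1) \<rho>(1)] by metis
      have P: "L2_project M F ?f \<in> L2 M" by (rule L2_project_L2[OF assms F(2)])
      have eL: "e \<in> L2 M" if "e \<in> F" for e using that F(2) onb_L2[OF assms] by blast
      have "L2_inner M (T (L2_project M F ?f)) ?g = (\<Sum>e\<in>F. L2_inner M ?f e * L2_inner M (T e) ?g)"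
        unfolding L2_project_def by (rule kernel_inner_combination[OF eL d(2)])
      also have "\<dots> \<le> L2_set (L2_inner M ?f) F * L2_set (\<lambda>e. L2_inner M (T e) ?g) F"
        using sum_mult_le_L2_set[of "L2_inner M ?f" "\<lambda>e. L2_inner M (T e) ?g" F] by linarith
      also have "\<dots> \<le> 1 * sqrt s"
      proof (rule mult_mono)
        show "L2_set (L2_inner M ?f) F \<le> 1"
          unfolding L2_set_def using L2_Bessel[OF assms F d(1)] power_mono[OF d(3), of 2] by simp
        have "(\<Sum>e\<in>F. (L2_inner M (T e) ?g)\<^sup>2) \<le> (\<Sum>e\<in>F. (L2_norm M (T e))\<^sup>2)"
        proof (rule sum_mono)
          fix e assume "e \<in> F"
          then have "\<bar>L2_inner M (T e) ?g\<bar> \<le> L2_norm M (T e) * L2_norm M ?g"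
            by (intro L2_Cauchy_Schwarz kernel_op_L2[OF T] eL d(2))
          also have "\<dots> \<le> L2_norm M (T e) * 1" by (rule mult_left_mono[OF d(4)]) simp
          finally show "(L2_inner M (T e) ?g)\<^sup>2 \<le> (L2_norm M (T e))\<^sup>2"
            using power_mono[of "\<bar>L2_inner M (T e) ?g\<bar>" "L2_norm M (T e)" 2] by simp
        qed
        also have "\<dots> \<le> s" unfolding s_def by (rule finite_hs_le_infsum[OF assms F])
        finally show "L2_set (\<lambda>e. L2_inner M (T e) ?g) F \<le> sqrt s" by (simp add: L2_set_def)
      qed (use s0 in auto)
      finally have 1: "L2_inner M (T (L2_project M F ?f)) ?g \<le> sqrt s" by simp
      have "L2_inner M (T ?f) ?g - L2_inner M (T (L2_project M F ?f)) ?g = L2_inner M (T (\<lambda>x. ?f x - L2_project M F ?f x)) ?g"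
        by (rule kernel_inner_diff[OF d(1) P d(2), symmetric])
      also have "\<dots> \<le> L2_onorm M T * L2_norm M (\<lambda>x. ?f x - L2_project M F ?f x) * L2_norm M ?g"
        using kernel_inner_le[OF L2_diff[OF d(1) P] d(2)] by linarith
      also have "\<dots> \<le> L2_onorm M T * \<rho> * 1"
        using app d(4) L2_onorm_nonneg \<rho>(1) by (intro mult_mono mult_nonneg_nonneg) auto
      finally show "L2_inner M (T ?f) ?g \<le> sqrt s + \<eta>" using 1 \<rho>(2) by (simp add: mult.commute)
    qed
  qed (use s0 in simp)
  then have "(L2_onorm M T)\<^sup>2 \<le> (sqrt s)\<^sup>2" by (rule power_mono[OF _ L2_onorm_nonneg])
  then show ?thesis using s0 by (simp add: s_def)
qed

lemma L2_onorm_power2_eq_SUP: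
  "(L2_onorm M T)\<^sup>2 = (SUP d\<in>L2_test_pairs M. (L2_inner M (T (fst d)) (snd d))\<^sup>2)" (is "_ = ?S")
proof (rule antisym)
  have le: "(L2_inner M (T (fst d)) (snd d))\<^sup>2 \<le> (L2_onorm M T)\<^sup>2" if "d \<in> L2_test_pairs M" for d
    using power_mono[OF test_pair_inner_le[OF that], of 2] by simp
  then have bdd: "bdd_above ((\<lambda>d. (L2_inner M (T (fst d)) (snd d))\<^sup>2) ` L2_test_pairs M)"
    by (intro bdd_aboveI2)
  show "?S \<le> (L2_onorm M T)\<^sup>2"
    by (rule cSUP_least) (use zero_test_pair le in auto)
  have S: "(L2_inner M (T (fst d)) (snd d))\<^sup>2 \<le> ?S" if "d \<in> L2_test_pairs M" for d
    by (rule cSUP_upper[OF that bdd])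
  have S0: "0 \<le> ?S" using S[OF zero_test_pair] by (rule order_trans[rotated]) simp
  have "L2_onorm M T \<le> sqrt ?S"
    by (rule L2_onorm_le_test_pairs) (use S S0 in \<open>auto intro: real_le_rsqrt\<close>)
  then have "(L2_onorm M T)\<^sup>2 \<le> (sqrt ?S)\<^sup>2" by (rule power_mono[OF _ L2_onorm_nonneg])
  then show "(L2_onorm M T)\<^sup>2 \<le> ?S" using S0 by simp
qed

end

end

lemma L2_onorm_cong:
  assumes "\<And>f x. f \<in> L2 M \<Longrightarrow> x \<in> space M \<Longrightarrow> T f x = T' f x"
  shows "L2_onorm M T = L2_onorm M T'"
  unfolding L2_onorm_def
proof (rule SUP_cong[OF refl])
  fix f assume "f \<in> L2 M"
  then have "L2_norm M (T f) = L2_norm M (T' f)" by (intro L2_norm_cong assms)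
  then show "L2_norm M (T f) / L2_norm M f = L2_norm M (T' f) / L2_norm M f" by simp
qed

lemma (in finite_measure) L2_onorm_cmult:
  assumes T: "has_bounded_kernel M T k C" and c: "0 < c"
  shows "L2_onorm M (\<lambda>f x. c * T f x) = c * L2_onorm M T"
proof (rule antisym)
  have cT: "has_bounded_kernel M (\<lambda>f x. c * T f x) (\<lambda>x y. c * k x y) (\<bar>c\<bar> * C)"
    by (rule has_bounded_kernel_cmult[OF T])
  show "L2_onorm M (\<lambda>f x. c * T f x) \<le> c * L2_onorm M T"
    by (rule L2_onorm_le[OF cT]) (use c L2_onorm_nonneg[OF T] L2_onorm[OF T] in \<open>auto simp: L2_norm_cmult mult.assoc\<close>)
  have "L2_onorm M T \<le> L2_onorm M (\<lambda>f x. c * T f x) / c"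
  proof (rule L2_onorm_le[OF T])
    show "0 \<le> L2_onorm M (\<lambda>f x. c * T f x) / c" using c L2_onorm_nonneg[OF cT] by simp
    fix f assume "f \<in> L2 M"
    from L2_onorm[OF cT this] c show "L2_norm M (T f) \<le> L2_onorm M (\<lambda>f x. c * T f x) / c * L2_norm M f"
      by (simp add: L2_norm_cmult field_simps)
  qed
  then show "c * L2_onorm M T \<le> L2_onorm M (\<lambda>f x. c * T f x)" using c by (simp add: field_simps)
qed

subsection \<open>Dependence of a kernel operator on its kernel\<close>

context finite_measure
begin

lemma has_bounded_kernel_diff:
  assumes T: "has_bounded_kernel M T k C" and T': "has_bounded_kernel M T' k' C'"
    and B: "\<And>x y. x \<in> space M \<Longrightarrow> y \<in> space M \<Longrightarrow> \<bar>k x y - k' x y\<bar> \<le> B"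
  shows "has_bounded_kernel M (\<lambda>f x. T f x - T' f x) (\<lambda>x y. k x y - k' x y) B"
  unfolding has_bounded_kernel_def
proof (intro conjI ballI B)
  note [measurable] = kernel_measurable[OF T] kernel_measurable[OF T']
  show "(\<lambda>(x, y). k x y - k' x y) \<in> borel_measurable (M \<Otimes>\<^sub>M M)" by measurable
  fix f x assume fx: "f \<in> L2 M" "x \<in> space M"
  have "integrable M (\<lambda>y. k x y * f y)" "integrable M (\<lambda>y. k' x y * f y)"
    using integrable_mult_L2[OF kernel_slice_L2[OF T fx(2)] fx(1)] integrable_mult_L2[OF kernel_slice_L2[OF T' fx(2)] fx(1)]
    by auto
  then show "T f x - T' f x = (\<integral>y. (k x y - k' x y) * f y \<partial>M)"
    using kernel_apply[OF T fx] kernel_apply[OF T' fx] by (simp add: left_diff_distrib)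
qed

lemma has_bounded_kernel_sum:
  assumes "\<And>l. l \<in> L \<Longrightarrow> has_bounded_kernel M (T l) (k l) (C l)"
  shows "has_bounded_kernel M (\<lambda>f x. \<Sum>l\<in>L. T l f x) (\<lambda>x y. \<Sum>l\<in>L. k l x y) (\<Sum>l\<in>L. C l)"
  unfolding has_bounded_kernel_def
proof (intro conjI ballI)
  show "(\<lambda>(x, y). \<Sum>l\<in>L. k l x y) \<in> borel_measurable (M \<Otimes>\<^sub>M M)"
    unfolding case_prod_unfold
    by (intro borel_measurable_sum) (use kernel_measurable[OF assms] in \<open>simp add: case_prod_unfold\<close>)
  show "\<bar>\<Sum>l\<in>L. k l x y\<bar> \<le> (\<Sum>l\<in>L. C l)" if "x \<in> space M" "y \<in> space M" for x y
    by (rule order_trans[OF sum_abs sum_mono]) (rule kernel_bound[OF assms that])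
  fix f x assume fx: "f \<in> L2 M" "x \<in> space M"
  have "integrable M (\<lambda>y. k l x y * f y)" if "l \<in> L" for l
    using integrable_mult_L2[OF kernel_slice_L2[OF assms[OF that] fx(2)] fx(1)] .
  then show "(\<Sum>l\<in>L. T l f x) = (\<integral>y. (\<Sum>l\<in>L. k l x y) * f y \<partial>M)"
    by (simp add: kernel_apply[OF assms fx] sum_distrib_right Bochner_Integration.integral_sum)
qed

text \<open>
  The norm, the bilinear form and the Hilbert-Schmidt norm are Lipschitz functions of the kernel in the
  supremum norm.  For kernels that depend on a parameter this yields their measurability in the
  parameter.
\<close>

lemma kernel_perturbation:
  assumes T: "has_bounded_kernel M T k C" and T': "has_bounded_kernel M T' k' C'"
    and B: "\<And>x y. x \<in> space M \<Longrightarrow> y \<in> space M \<Longrightarrow> \<bar>k x y - k' x y\<bar> \<le> B" and B0: "0 \<le> B"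
  shows "\<bar>L2_onorm M T - L2_onorm M T'\<bar> \<le> B * measure M (space M)" (is ?A)
    and "d \<in> L2_test_pairs M \<Longrightarrow>
      \<bar>L2_inner M (T (fst d)) (snd d) - L2_inner M (T' (fst d)) (snd d)\<bar> \<le> B * measure M (space M)"
    and "L2_onb M E \<Longrightarrow> \<bar>sqrt (\<Sum>\<^sub>\<infinity>e\<in>E. (L2_norm M (T e))\<^sup>2) - sqrt (\<Sum>\<^sub>\<infinity>e\<in>E. (L2_norm M (T' e))\<^sup>2)\<bar> \<le> B * measure M (space M)"
proof -
  let ?m = "B * measure M (space M)"
  have m0: "0 \<le> ?m" using B0 by simp
  have D: "has_bounded_kernel M (\<lambda>f x. T f x - T' f x) (\<lambda>x y. k x y - k' x y) B"
    by (rule has_bounded_kernel_diff[OF T T' B])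
  have Dn: "L2_norm M (\<lambda>x. T f x - T' f x) \<le> ?m * L2_norm M f" if "f \<in> L2 M" for f
    using kernel_op_norm_le[OF D that B0] .
  have tri: "L2_norm M (U f) \<le> L2_norm M (U' f) + ?m * L2_norm M f"
    if "f \<in> L2 M" "U f \<in> L2 M" "U' f \<in> L2 M" "L2_norm M (\<lambda>x. U f x - U' f x) \<le> ?m * L2_norm M f"
    for U U' :: "('a \<Rightarrow> real) \<Rightarrow> 'a \<Rightarrow> real" and f
    using L2_norm_triangle[OF that(3) L2_diff[OF that(2,3)]] that(4) by simp
  have Dn': "L2_norm M (\<lambda>x. T' f x - T f x) \<le> ?m * L2_norm M f" if "f \<in> L2 M" for f
    using Dn[OF that] L2_norm_cmult[where c = "- 1" and f = "\<lambda>x. T f x - T' f x" and M = M] by simp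
  have "L2_onorm M T \<le> L2_onorm M T' + ?m"
  proof (rule L2_onorm_le[OF T])
    show "0 \<le> L2_onorm M T' + ?m" using L2_onorm_nonneg[OF T'] m0 by simp
    fix f assume f: "f \<in> L2 M"
    show "L2_norm M (T f) \<le> (L2_onorm M T' + ?m) * L2_norm M f"
      using tri[where U = T and U' = T', OF f kernel_op_L2[OF T f] kernel_op_L2[OF T' f] Dn[OF f]] L2_onorm[OF T' f]
      by (simp add: distrib_right)
  qed
  moreover have "L2_onorm M T' \<le> L2_onorm M T + ?m"
  proof (rule L2_onorm_le[OF T'])
    show "0 \<le> L2_onorm M T + ?m" using L2_onorm_nonneg[OF T] m0 by simp
    fix f assume f: "f \<in> L2 M"
    show "L2_norm M (T' f) \<le> (L2_onorm M T + ?m) * L2_norm M f"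
      using tri[where U = T' and U' = T, OF f kernel_op_L2[OF T' f] kernel_op_L2[OF T f] Dn'[OF f]] L2_onorm[OF T f]
      by (simp add: distrib_right)
  qed
  ultimately show ?A by (simp add: abs_le_iff)
  show "\<bar>L2_inner M (T (fst d)) (snd d) - L2_inner M (T' (fst d)) (snd d)\<bar> \<le> ?m" if "d \<in> L2_test_pairs M"
  proof -
    have d: "fst d \<in> L2 M" "snd d \<in> L2 M" using that by (auto simp: L2_test_pairs_def)
    have "L2_onorm M (\<lambda>f x. T f x - T' f x) \<le> ?m" by (rule L2_onorm_le[OF D m0 Dn])
    moreover have "\<bar>L2_inner M (\<lambda>x. T (fst d) x - T' (fst d) x) (snd d)\<bar> \<le> L2_onorm M (\<lambda>f x. T f x - T' f x)"
      using test_pair_inner_le[OF D that] .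
    ultimately show ?thesis
      using L2_inner_diff_left[OF kernel_op_L2[OF T d(1)] kernel_op_L2[OF T' d(1)] d(2)] by simp
  qed
  assume onb: "L2_onb M E"
  have hs: "sqrt (\<Sum>\<^sub>\<infinity>e\<in>E. (L2_norm M (U e))\<^sup>2) \<le> sqrt (\<Sum>\<^sub>\<infinity>e\<in>E. (L2_norm M (U' e))\<^sup>2) + ?m"
    if U: "has_bounded_kernel M U j J" and U': "has_bounded_kernel M U' j' J'"
      and D': "has_bounded_kernel M (\<lambda>f x. U f x - U' f x) i B" for U U' j j' J J' i
  proof -
    let ?s = "sqrt (\<Sum>\<^sub>\<infinity>e\<in>E. (L2_norm M (U' e))\<^sup>2)"
    have s0: "0 \<le> ?s + ?m" using m0 by (intro add_nonneg_nonneg) (auto intro: infsum_nonneg)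
    have "(\<Sum>\<^sub>\<infinity>e\<in>E. (L2_norm M (U e))\<^sup>2) \<le> (?s + ?m)\<^sup>2"
    proof (rule infsum_le_finite_sums[OF kernel_hs_summable[OF U onb]])
      fix F assume F: "finite F" "F \<subseteq> E"
      have eL: "e \<in> L2 M" if "e \<in> F" for e using that F(2) onb_L2[OF onb] by blast
      have "L2_set (\<lambda>e. L2_norm M (U e)) F \<le> L2_set (\<lambda>e. L2_norm M (U' e) + L2_norm M (\<lambda>x. U e x - U' e x)) F"
      proof (rule L2_set_mono)
        fix e assume "e \<in> F"
        then have "U e \<in> L2 M" "U' e \<in> L2 M" using eL kernel_op_L2[OF U] kernel_op_L2[OF U'] by auto
        then show "L2_norm M (U e) \<le> L2_norm M (U' e) + L2_norm M (\<lambda>x. U e x - U' e x)"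
          using L2_norm_triangle[OF _ L2_diff, of "U' e" M "U e" "U' e"] by simp
      qed simp
      also have "\<dots> \<le> L2_set (\<lambda>e. L2_norm M (U' e)) F + L2_set (\<lambda>e. L2_norm M (\<lambda>x. U e x - U' e x)) F"
        by (rule L2_set_triangle_ineq)
      also have "\<dots> \<le> ?s + ?m"
      proof (rule add_mono)
        show "L2_set (\<lambda>e. L2_norm M (U' e)) F \<le> ?s"
          unfolding L2_set_def by (rule real_sqrt_le_mono) (rule finite_hs_le_infsum[OF U' onb F])
        have "sqrt (\<Sum>e\<in>F. (L2_norm M (\<lambda>x. U e x - U' e x))\<^sup>2) \<le> sqrt (?m\<^sup>2)"
          by (rule real_sqrt_le_mono) (rule kernel_hs_le[OF D' onb F])
        then show "L2_set (\<lambda>e. L2_norm M (\<lambda>x. U e x - U' e x)) F \<le> ?m"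
          using m0 by (simp add: L2_set_def)
      qed
      finally have "(L2_set (\<lambda>e. L2_norm M (U e)) F)\<^sup>2 \<le> (?s + ?m)\<^sup>2" by (rule power_mono) simp
      then show "(\<Sum>e\<in>F. (L2_norm M (U e))\<^sup>2) \<le> (?s + ?m)\<^sup>2" by (simp add: L2_set_power2)
    qed
    then have "sqrt (\<Sum>\<^sub>\<infinity>e\<in>E. (L2_norm M (U e))\<^sup>2) \<le> sqrt ((?s + ?m)\<^sup>2)" by (rule real_sqrt_le_mono)
    then show ?thesis using s0 by simp
  qed
  have D'': "has_bounded_kernel M (\<lambda>f x. T' f x - T f x) (\<lambda>x y. k' x y - k x y) B"
    by (rule has_bounded_kernel_diff[OF T' T]) (use B in \<open>simp add: abs_minus_commute\<close>)
  from hs[OF T T' D] hs[OF T' T D'']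
  show "\<bar>sqrt (\<Sum>\<^sub>\<infinity>e\<in>E. (L2_norm M (T e))\<^sup>2) - sqrt (\<Sum>\<^sub>\<infinity>e\<in>E. (L2_norm M (T' e))\<^sup>2)\<bar> \<le> ?m"
    by (simp add: abs_le_iff)
qed

end

lemma bounded_kernel_Fubini:
  fixes k :: "'a \<Rightarrow> 'b \<Rightarrow> real" and f :: "'b \<Rightarrow> real"
  assumes N: "finite_measure N" and M: "finite_measure M"
    and k: "case_prod k \<in> borel_measurable (N \<Otimes>\<^sub>M M)" and C: "\<And>\<nu> y. \<nu> \<in> space N \<Longrightarrow> y \<in> space M \<Longrightarrow> \<bar>k \<nu> y\<bar> \<le> C"
    and f: "integrable M f"
  shows "integrable N (\<lambda>\<nu>. \<integral>y. k \<nu> y * f y \<partial>M)"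
    and "(\<integral>\<nu>. (\<integral>y. k \<nu> y * f y \<partial>M) \<partial>N) = (\<integral>y. (\<integral>\<nu>. k \<nu> y \<partial>N) * f y \<partial>M)"
proof -
  interpret N: finite_measure N by fact
  interpret M: finite_measure M by fact
  interpret P: pair_sigma_finite N M ..
  note [measurable] = k borel_measurable_integrable[OF f]
  have i: "integrable M (\<lambda>y. k \<nu> y * f y)" if \<nu>: "\<nu> \<in> space N" for \<nu>
  proof (rule Bochner_Integration.integrable_bound)
    show "integrable M (\<lambda>y. C * f y)" using f by simp
    have "(\<lambda>y. k \<nu> y) \<in> borel_measurable M" using measurable_compose[OF measurable_Pair1'[OF \<nu>] k] by simp
    then show "(\<lambda>y. k \<nu> y * f y) \<in> borel_measurable M" by measurable
    show "AE y in M. norm (k \<nu> y * f y) \<le> norm (C * f y)"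
      by (rule AE_I2) (use C[OF \<nu>] in \<open>force simp: abs_mult intro!: mult_right_mono\<close>)
  qed
  have int: "integrable (N \<Otimes>\<^sub>M M) (\<lambda>(\<nu>, y). k \<nu> y * f y)"
  proof (rule P.Fubini_integrable)
    show "(\<lambda>(\<nu>, y). k \<nu> y * f y) \<in> borel_measurable (N \<Otimes>\<^sub>M M)" by measurable
    show "AE \<nu> in N. integrable M (\<lambda>y. case (\<nu>, y) of (\<nu>, y) \<Rightarrow> k \<nu> y * f y)" using i by simp
    have "integrable N (\<lambda>\<nu>. \<integral>y. norm (k \<nu> y * f y) \<partial>M)"
    proof (rule N.integrable_const_bound[of _ "\<integral>y. norm (C * f y) \<partial>M"])
      show "AE \<nu> in N. norm (\<integral>y. norm (k \<nu> y * f y) \<partial>M) \<le> (\<integral>y. norm (C * f y) \<partial>M)"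
      proof (rule AE_I2)
        fix \<nu> assume \<nu>: "\<nu> \<in> space N"
        have "(\<integral>y. norm (k \<nu> y * f y) \<partial>M) \<le> (\<integral>y. norm (C * f y) \<partial>M)"
        proof (rule integral_mono)
          show "integrable M (\<lambda>y. norm (k \<nu> y * f y))" using i[OF \<nu>] by simp
          show "integrable M (\<lambda>y. norm (C * f y))" using f by simp
          show "norm (k \<nu> y * f y) \<le> norm (C * f y)" if "y \<in> space M" for y
            using C[OF \<nu> that] by (auto simp: abs_mult intro!: mult_right_mono)
        qed
        then show "norm (\<integral>y. norm (k \<nu> y * f y) \<partial>M) \<le> (\<integral>y. norm (C * f y) \<partial>M)" by simp
      qed
    qed measurable
    then show "integrable N (\<lambda>\<nu>. \<integral>y. norm (case (\<nu>, y) of (\<nu>, y) \<Rightarrow> k \<nu> y * f y) \<partial>M)" by simp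
  qed
  show "integrable N (\<lambda>\<nu>. \<integral>y. k \<nu> y * f y \<partial>M)" using P.integrable_fst[OF int] by simp
  show "(\<integral>\<nu>. (\<integral>y. k \<nu> y * f y \<partial>M) \<partial>N) = (\<integral>y. (\<integral>\<nu>. k \<nu> y \<partial>N) * f y \<partial>M)"
    using P.Fubini_integral[OF int] by simp
qed

section \<open>Rademacher sums of operators\<close>

context finite_measure
begin

lemma operator_matrix_bilinear:
  assumes T: "has_bounded_kernel M T k C" and onb: "L2_onb M E" and F: "finite F" "F \<subseteq> E"
  shows "(\<Sum>e\<in>F. \<Sum>e'\<in>F. L2_inner M (T e) e' * u e * v e')
    = L2_inner M (T (\<lambda>x. \<Sum>e\<in>F. u e * e x)) (\<lambda>x. \<Sum>e\<in>F. v e * e x)"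
proof -
  have eL: "e \<in> L2 M" if "e \<in> F" for e using that F(2) onb_L2[OF onb] by blast
  have comb: "(\<lambda>x. \<Sum>e\<in>F. v e * e x) \<in> L2 M" by (rule onb_combination_L2[OF onb F(2)])
  have "L2_inner M (T (\<lambda>x. \<Sum>e\<in>F. u e * e x)) (\<lambda>x. \<Sum>e\<in>F. v e * e x)
     = (\<Sum>e\<in>F. u e * L2_inner M (T e) (\<lambda>x. \<Sum>e\<in>F. v e * e x))"
    by (rule kernel_inner_combination[OF T eL comb])
  also have "\<dots> = (\<Sum>e\<in>F. u e * (\<Sum>e'\<in>F. v e' * L2_inner M (T e) e'))"
    by (intro sum.cong refl arg_cong2[where f = "(*)"], subst L2_inner_sum_right)
      (auto simp: L2_inner_cmult_right intro: eL L2_cmult kernel_op_L2[OF T])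
  finally show ?thesis by (simp add: sum_distrib_left mult_ac)
qed

lemma bilinear_bound_operator_matrix:
  assumes T: "has_bounded_kernel M T k C" and onb: "L2_onb M E" and F: "finite F" "F \<subseteq> E"
  shows "bilinear_bound F (\<lambda>e e'. L2_inner M (T e) e') (L2_onorm M T)"
  unfolding bilinear_bound_def
proof (intro conjI allI)
  show "0 \<le> L2_onorm M T" by (rule L2_onorm_nonneg[OF T])
  fix u v
  show "\<bar>\<Sum>e\<in>F. \<Sum>e'\<in>F. L2_inner M (T e) e' * u e * v e'\<bar> \<le> L2_onorm M T * L2_set u F * L2_set v F"
    unfolding operator_matrix_bilinear[OF assms]
    using kernel_inner_le[OF T onb_combination_L2[OF onb F(2)] onb_combination_L2[OF onb F(2)], of u v]
    by (simp only: onb_combination_norm[OF onb F])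
qed

lemma hs_norm_operator_matrix:
  assumes T: "has_bounded_kernel M T k C" and onb: "L2_onb M E" and F: "finite F" "F \<subseteq> E"
  shows "(hs_norm F (\<lambda>e e'. L2_inner M (T e) e'))\<^sup>2 \<le> (\<Sum>\<^sub>\<infinity>e\<in>E. (L2_norm M (T e))\<^sup>2)"
proof -
  have eL: "e \<in> L2 M" if "e \<in> F" for e using that F(2) onb_L2[OF onb] by blast
  have "(hs_norm F (\<lambda>e e'. L2_inner M (T e) e'))\<^sup>2 \<le> (\<Sum>e\<in>F. (L2_norm M (T e))\<^sup>2)"
    unfolding hs_norm_power2 by (intro sum_mono L2_Bessel[OF onb F] kernel_op_L2[OF T] eL)
  also have "\<dots> \<le> (\<Sum>\<^sub>\<infinity>e\<in>E. (L2_norm M (T e))\<^sup>2)"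
    by (rule finite_hs_le_infsum[OF T onb F])
  finally show ?thesis .
qed

lemma L2_project_norm_le:
  assumes "L2_onb M E" "finite F" "F \<subseteq> E" "f \<in> L2 M"
  shows "L2_norm M (L2_project M F f) \<le> L2_norm M f"
  unfolding L2_project_def onb_combination_norm[OF assms(1-3)] L2_set_def
  using real_sqrt_le_mono[OF L2_Bessel[OF assms]] by simp

text \<open>
  Enlarging the finite set improves the projection, so a common set serves finitely many functions.
\<close>

lemma test_pairs_finite_approximation:
  assumes onb: "L2_onb M E" and G: "finite G" "G \<subseteq> L2 M" and "\<eta> > 0"
  obtains F where "finite F" "F \<subseteq> E" "\<And>f. f \<in> G \<Longrightarrow> L2_norm M (\<lambda>x. f x - L2_project M F f x) < \<eta>"
proof -
  have "\<exists>F. finite F \<and> F \<subseteq> E \<and> L2_norm M (\<lambda>x. f x - L2_project M F f x) < \<eta>" if "f \<in> G" for f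
    by (rule L2_project_approximates[OF onb finite_measure_axioms subsetD[OF G(2) that] \<open>\<eta> > 0\<close>]) blast
  then obtain \<Phi> where \<Phi>: "\<And>f. f \<in> G \<Longrightarrow> finite (\<Phi> f) \<and> \<Phi> f \<subseteq> E \<and> L2_norm M (\<lambda>x. f x - L2_project M (\<Phi> f) f x) < \<eta>"
    by metis
  define F where "F = (\<Union>f\<in>G. \<Phi> f)"
  have F: "finite F" "F \<subseteq> E" using \<Phi> G(1) by (auto simp: F_def)
  have "L2_norm M (\<lambda>x. f x - L2_project M F f x) < \<eta>" if f: "f \<in> G" for f
  proof -
    have fL: "f \<in> L2 M" using f G(2) by auto
    have sub: "finite (\<Phi> f)" "\<Phi> f \<subseteq> E" "\<Phi> f \<subseteq> F" using \<Phi>[OF f] f by (auto simp: F_def)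
    have "(\<Sum>e\<in>\<Phi> f. (L2_inner M f e)\<^sup>2) \<le> (\<Sum>e\<in>F. (L2_inner M f e)\<^sup>2)"
      by (rule sum_mono2) (use F sub in auto)
    then have "(L2_norm M (\<lambda>x. f x - L2_project M F f x))\<^sup>2 \<le> (L2_norm M (\<lambda>x. f x - L2_project M (\<Phi> f) f x))\<^sup>2"
      using L2_project_residual[OF onb F fL] L2_project_residual[OF onb sub(1,2) fL] by linarith
    then have "L2_norm M (\<lambda>x. f x - L2_project M F f x) \<le> L2_norm M (\<lambda>x. f x - L2_project M (\<Phi> f) f x)"
      by (rule power2_le_imp_le) simp
    then show ?thesis using \<Phi>[OF f] by linarith
  qed
  then show ?thesis by (rule that[OF F])
qed

text \<open>
  For each of the finitely many sign vectors a nearly optimal test pair is fixed.  A finite part \<open>F\<close> of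
  the basis approximates all these functions, and on \<open>F\<close> the operators are finite matrices whose
  operator and Hilbert-Schmidt norms do not exceed those of the operators.
\<close>

theorem rademacher_onorm_second_moment:
  fixes T :: "'l \<Rightarrow> ('a \<Rightarrow> real) \<Rightarrow> 'a \<Rightarrow> real"
  assumes L: "finite L" and T: "\<And>l. l \<in> L \<Longrightarrow> has_bounded_kernel M (T l) (k l) (C l)"
    and onb: "L2_onb M E"
  defines "a \<equiv> \<lambda>l. L2_onorm M (T l)" and "s \<equiv> \<lambda>l. \<Sum>\<^sub>\<infinity>e\<in>E. (L2_norm M (T l e))\<^sup>2"
  assumes V: "(\<Sum>l\<in>L. (a l)\<^sup>2) > 0"
  shows "rademacher_mean L (\<lambda>\<epsilon>. SUP d\<in>L2_test_pairs M. (\<Sum>l\<in>L. \<epsilon> l * L2_inner M (T l (fst d)) (snd d))\<^sup>2)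
    \<le> 2 * (\<Sum>l\<in>L. (a l)\<^sup>2) * ln (4 * ((\<Sum>l\<in>L. s l) / (\<Sum>l\<in>L. (a l)\<^sup>2)))"
proof (rule field_le_epsilon)
  fix \<eta> :: real assume \<eta>: "\<eta> > 0"
  let ?D = "L2_test_pairs M"
  let ?\<Sigma> = "PiE L (\<lambda>_. {-1, 1::real})"
  define B where "B \<epsilon> f g = (\<Sum>l\<in>L. \<epsilon> l * L2_inner M (T l f) g)" for \<epsilon> f g
  define A where "A = (\<Sum>l\<in>L. a l)"
  have a0: "0 \<le> a l" if "l \<in> L" for l unfolding a_def by (rule L2_onorm_nonneg[OF T[OF that]])
  have A0: "0 \<le> A" unfolding A_def by (rule sum_nonneg) (rule a0)
  have B: "\<bar>B \<epsilon> f g\<bar> \<le> A * L2_norm M f * L2_norm M g"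
    if "\<epsilon> \<in> ?\<Sigma>" "f \<in> L2 M" "g \<in> L2 M" for \<epsilon> f g
  proof -
    have "\<bar>B \<epsilon> f g\<bar> \<le> (\<Sum>l\<in>L. \<bar>\<epsilon> l * L2_inner M (T l f) g\<bar>)" unfolding B_def by (rule sum_abs)
    also have "\<dots> \<le> (\<Sum>l\<in>L. a l * L2_norm M f * L2_norm M g)"
    proof (rule sum_mono)
      fix l assume l: "l \<in> L"
      have "\<epsilon> l \<in> {-1, 1}" using that(1) l by (rule PiE_mem)
      then have "\<bar>\<epsilon> l\<bar> = 1" by auto
      then show "\<bar>\<epsilon> l * L2_inner M (T l f) g\<bar> \<le> a l * L2_norm M f * L2_norm M g"
        using kernel_inner_le[OF T[OF l] that(2,3)] by (simp add: abs_mult a_def)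
    qed
    finally show ?thesis by (simp add: A_def sum_distrib_right)
  qed
  have Bdiff1: "B \<epsilon> (\<lambda>x. f x - f' x) g = B \<epsilon> f g - B \<epsilon> f' g"
    if "f \<in> L2 M" "f' \<in> L2 M" "g \<in> L2 M" for \<epsilon> f f' g
    using that by (simp add: B_def kernel_inner_diff[OF T] right_diff_distrib sum_subtractf)
  have Bdiff2: "B \<epsilon> f (\<lambda>x. g x - g' x) = B \<epsilon> f g - B \<epsilon> f g'"
    if "f \<in> L2 M" "g \<in> L2 M" "g' \<in> L2 M" for \<epsilon> f g g'
    using that by (simp add: B_def L2_inner_diff_right kernel_op_L2[OF T] right_diff_distrib sum_subtractf)
  \<comment> \<open>Two test functions that are off by \<open>\<rho>\<close> change the square of the form by at most \<open>4 A\<^sup>2 \<rho> \<le> \<eta> / 2\<close>.\<close>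
  define \<rho> where "\<rho> = \<eta> / (8 * A\<^sup>2 + 1)"
  have "8 * A\<^sup>2 + 1 > 0" by (simp add: add_nonneg_pos)
  then have \<rho>: "\<rho> > 0" "8 * A\<^sup>2 * \<rho> \<le> \<eta>" using \<eta> by (auto simp: \<rho>_def field_simps)
  have nearmax: "\<exists>d\<in>?D. \<epsilon> \<in> ?\<Sigma> \<longrightarrow> (SUP d\<in>?D. (B \<epsilon> (fst d) (snd d))\<^sup>2) - \<eta> / 2 < (B \<epsilon> (fst d) (snd d))\<^sup>2" for \<epsilon>
  proof (cases "\<epsilon> \<in> ?\<Sigma>")
    case True
    have "bdd_above ((\<lambda>d. (B \<epsilon> (fst d) (snd d))\<^sup>2) ` ?D)"
    proof (rule bdd_aboveI2)
      fix d assume "d \<in> ?D"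
      then have d: "fst d \<in> L2 M" "snd d \<in> L2 M" "L2_norm M (fst d) \<le> 1" "L2_norm M (snd d) \<le> 1"
        by (auto simp: L2_test_pairs_def)
      have "\<bar>B \<epsilon> (fst d) (snd d)\<bar> \<le> A * L2_norm M (fst d) * L2_norm M (snd d)" by (rule B[OF True d(1,2)])
      also have "\<dots> \<le> A * 1 * 1" using A0 d(3,4) by (intro mult_mono mult_nonneg_nonneg) auto
      finally show "(B \<epsilon> (fst d) (snd d))\<^sup>2 \<le> A\<^sup>2"
        using power_mono[of "\<bar>B \<epsilon> (fst d) (snd d)\<bar>" A 2] by simp
    qed
    moreover have "?D \<noteq> {}" using zero_test_pair by blast
    moreover have "(SUP d\<in>?D. (B \<epsilon> (fst d) (snd d))\<^sup>2) - \<eta> / 2 < (SUP d\<in>?D. (B \<epsilon> (fst d) (snd d))\<^sup>2)"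
      using \<eta> by simp
    ultimately have "\<exists>d\<in>?D. (SUP d\<in>?D. (B \<epsilon> (fst d) (snd d))\<^sup>2) - \<eta> / 2 < (B \<epsilon> (fst d) (snd d))\<^sup>2"
      by (subst (asm) less_cSUP_iff)
    then show ?thesis by (rule bexE) (rule bexI, rule impI)
  next
    case False
    then show ?thesis by (intro bexI[OF _ zero_test_pair]) simp
  qed
  then have "\<forall>\<epsilon>. \<exists>d. d \<in> ?D \<and> (\<epsilon> \<in> ?\<Sigma> \<longrightarrow> (SUP d\<in>?D. (B \<epsilon> (fst d) (snd d))\<^sup>2) - \<eta> / 2 < (B \<epsilon> (fst d) (snd d))\<^sup>2)"
    unfolding Bex_def by (rule allI)
  from choice[OF this] obtain d where dd: "\<forall>\<epsilon>. d \<epsilon> \<in> ?D \<and> (\<epsilon> \<in> ?\<Sigma> \<longrightarrow>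
    (SUP d\<in>?D. (B \<epsilon> (fst d) (snd d))\<^sup>2) - \<eta> / 2 < (B \<epsilon> (fst (d \<epsilon>)) (snd (d \<epsilon>)))\<^sup>2)" ..
  have d: "d \<epsilon> \<in> ?D" for \<epsilon>
    using dd by simp
  have d': "(SUP d\<in>?D. (B \<epsilon> (fst d) (snd d))\<^sup>2) - \<eta> / 2 < (B \<epsilon> (fst (d \<epsilon>)) (snd (d \<epsilon>)))\<^sup>2" if "\<epsilon> \<in> ?\<Sigma>" for \<epsilon>
    using dd that by simp
  define f where "f \<epsilon> = fst (d \<epsilon>)" for \<epsilon>
  define g where "g \<epsilon> = snd (d \<epsilon>)" for \<epsilon>
  have fg: "f \<epsilon> \<in> L2 M" "g \<epsilon> \<in> L2 M" "L2_norm M (f \<epsilon>) \<le> 1" "L2_norm M (g \<epsilon>) \<le> 1" for \<epsilon>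
    using d[of \<epsilon>] by (auto simp: L2_test_pairs_def f_def g_def)
  obtain F where F: "finite F" "F \<subseteq> E"
    and app: "\<And>h. h \<in> f ` ?\<Sigma> \<union> g ` ?\<Sigma> \<Longrightarrow> L2_norm M (\<lambda>x. h x - L2_project M F h x) < \<rho>"
    by (rule test_pairs_finite_approximation[OF onb _ _ \<rho>(1), of "f ` ?\<Sigma> \<union> g ` ?\<Sigma>"])
      (use L fg(1,2) in \<open>auto simp: finite_PiE\<close>)
  let ?Pf = "\<lambda>\<epsilon>. L2_project M F (f \<epsilon>)" and ?Pg = "\<lambda>\<epsilon>. L2_project M F (g \<epsilon>)"
  let ?X = "\<lambda>l e e'. L2_inner M (T l e) e'"
  let ?u = "\<lambda>\<epsilon> e. L2_inner M (f \<epsilon>) e" and ?v = "\<lambda>\<epsilon> e. L2_inner M (g \<epsilon>) e"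
  have P: "L2_project M F h \<in> L2 M" for h by (rule L2_project_L2[OF onb F(2)])
  have B_matrix: "B \<epsilon> (?Pf \<epsilon>) (?Pg \<epsilon>) = (\<Sum>e\<in>F. \<Sum>e'\<in>F. sign_sum L ?X \<epsilon> e e' * ?u \<epsilon> e * ?v \<epsilon> e')" for \<epsilon>
  proof -
    have "B \<epsilon> (?Pf \<epsilon>) (?Pg \<epsilon>) = (\<Sum>l\<in>L. \<epsilon> l * (\<Sum>e\<in>F. \<Sum>e'\<in>F. ?X l e e' * ?u \<epsilon> e * ?v \<epsilon> e'))"
      unfolding B_def L2_project_def
      by (intro sum.cong refl) (simp only: operator_matrix_bilinear[OF T onb F])
    also have "\<dots> = (\<Sum>l\<in>L. \<Sum>e\<in>F. \<Sum>e'\<in>F. \<epsilon> l * ?X l e e' * ?u \<epsilon> e * ?v \<epsilon> e')"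
      by (simp only: sum_distrib_left mult.assoc)
    also have "\<dots> = (\<Sum>e\<in>F. \<Sum>l\<in>L. \<Sum>e'\<in>F. \<epsilon> l * ?X l e e' * ?u \<epsilon> e * ?v \<epsilon> e')" by (rule sum.swap)
    also have "\<dots> = (\<Sum>e\<in>F. \<Sum>e'\<in>F. \<Sum>l\<in>L. \<epsilon> l * ?X l e e' * ?u \<epsilon> e * ?v \<epsilon> e')"
      by (rule sum.cong[OF refl], rule sum.swap)
    also have "\<dots> = (\<Sum>e\<in>F. \<Sum>e'\<in>F. sign_sum L ?X \<epsilon> e e' * ?u \<epsilon> e * ?v \<epsilon> e')"
      by (simp only: sign_sum_def sum_distrib_right)
    finally show ?thesis .
  qed
  have close: "(B \<epsilon> (f \<epsilon>) (g \<epsilon>))\<^sup>2 \<le> (B \<epsilon> (?Pf \<epsilon>) (?Pg \<epsilon>))\<^sup>2 + \<eta> / 2" if \<epsilon>: "\<epsilon> \<in> ?\<Sigma>" for \<epsilon>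
  proof -
    let ?b = "B \<epsilon> (f \<epsilon>) (g \<epsilon>)" and ?b' = "B \<epsilon> (?Pf \<epsilon>) (?Pg \<epsilon>)"
    have Pn: "L2_norm M (?Pf \<epsilon>) \<le> 1" "L2_norm M (?Pg \<epsilon>) \<le> 1"
      using L2_project_norm_le[OF onb F fg(1)[of \<epsilon>]] L2_project_norm_le[OF onb F fg(2)[of \<epsilon>]] fg(3,4)[of \<epsilon>] by linarith+
    have b: "\<bar>?b\<bar> \<le> A"
      using B[OF \<epsilon> fg(1)[of \<epsilon>] fg(2)[of \<epsilon>]] mult_left_mono[OF mult_le_one[OF fg(3)[of \<epsilon>] L2_norm_nonneg fg(4)[of \<epsilon>]] A0]
      by (simp add: mult.assoc)
    have b': "\<bar>?b'\<bar> \<le> A"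
      using B[OF \<epsilon> P P, of "f \<epsilon>" "g \<epsilon>"] mult_left_mono[OF mult_le_one[OF Pn(1) L2_norm_nonneg Pn(2)] A0]
      by (simp add: mult.assoc)
    have "?b - ?b' = B \<epsilon> (\<lambda>x. f \<epsilon> x - ?Pf \<epsilon> x) (g \<epsilon>) + B \<epsilon> (?Pf \<epsilon>) (\<lambda>x. g \<epsilon> x - ?Pg \<epsilon> x)"
      by (simp only: Bdiff1[OF fg(1) P fg(2)] Bdiff2[OF P fg(2) P])
    also have "\<bar>\<dots>\<bar> \<le> A * \<rho> * 1 + A * 1 * \<rho>"
    proof (rule order_trans[OF abs_triangle_ineq add_mono])
      show "\<bar>B \<epsilon> (\<lambda>x. f \<epsilon> x - ?Pf \<epsilon> x) (g \<epsilon>)\<bar> \<le> A * \<rho> * 1"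
        by (rule order_trans[OF B[OF \<epsilon> L2_diff[OF fg(1) P] fg(2)]])
          (use app[of "f \<epsilon>"] \<epsilon> fg(4)[of \<epsilon>] A0 \<rho>(1) in \<open>intro mult_mono mult_nonneg_nonneg, auto intro: less_imp_le\<close>)
      show "\<bar>B \<epsilon> (?Pf \<epsilon>) (\<lambda>x. g \<epsilon> x - ?Pg \<epsilon> x)\<bar> \<le> A * 1 * \<rho>"
        by (rule order_trans[OF B[OF \<epsilon> P L2_diff[OF fg(2) P]]])
          (use app[of "g \<epsilon>"] \<epsilon> Pn(1) A0 \<rho>(1) in \<open>intro mult_mono mult_nonneg_nonneg, auto intro: less_imp_le\<close>)
    qed
    finally have "\<bar>?b - ?b'\<bar> \<le> 2 * A * \<rho>" by simp
    moreover have "\<bar>?b + ?b'\<bar> \<le> 2 * A" using b b' by linarith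
    ultimately have "\<bar>?b - ?b'\<bar> * \<bar>?b + ?b'\<bar> \<le> (2 * A * \<rho>) * (2 * A)"
      using A0 \<rho>(1) by (intro mult_mono) auto
    then have "(?b - ?b') * (?b + ?b') \<le> 4 * A\<^sup>2 * \<rho>"
      unfolding abs_mult[symmetric] by (simp add: power2_eq_square algebra_simps)
    then show ?thesis using \<rho>(2) by (simp add: power2_eq_square algebra_simps)
  qed
  have "rademacher_mean L (\<lambda>\<epsilon>. SUP d\<in>?D. (B \<epsilon> (fst d) (snd d))\<^sup>2)
    \<le> rademacher_mean L (\<lambda>\<epsilon>. (\<Sum>e\<in>F. \<Sum>e'\<in>F. sign_sum L ?X \<epsilon> e e' * ?u \<epsilon> e * ?v \<epsilon> e')\<^sup>2 + \<eta>)"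
  proof (rule rademacher_mean_mono)
    fix \<epsilon> assume \<epsilon>: "\<epsilon> \<in> ?\<Sigma>"
    show "(SUP d\<in>?D. (B \<epsilon> (fst d) (snd d))\<^sup>2) \<le> (\<Sum>e\<in>F. \<Sum>e'\<in>F. sign_sum L ?X \<epsilon> e e' * ?u \<epsilon> e * ?v \<epsilon> e')\<^sup>2 + \<eta>"
      using d'[OF \<epsilon>] close[OF \<epsilon>] unfolding B_matrix[symmetric] f_def[symmetric] g_def[symmetric] by linarith
  qed
  also have "\<dots> = rademacher_mean L (\<lambda>\<epsilon>. (\<Sum>e\<in>F. \<Sum>e'\<in>F. sign_sum L ?X \<epsilon> e e' * ?u \<epsilon> e * ?v \<epsilon> e')\<^sup>2) + \<eta>"
    by (simp add: rademacher_mean_add rademacher_mean_const L)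
  also have "\<dots> \<le> 2 * (\<Sum>l\<in>L. (a l)\<^sup>2) * ln (4 * ((\<Sum>l\<in>L. s l) / (\<Sum>l\<in>L. (a l)\<^sup>2))) + \<eta>"
  proof (intro add_right_mono rademacher_bilinear_second_moment L F(1) V)
    fix l assume l: "l \<in> L"
    show "bilinear_bound F (?X l) (a l)" unfolding a_def by (rule bilinear_bound_operator_matrix[OF T[OF l] onb F])
    show "(hs_norm F (?X l))\<^sup>2 \<le> s l" unfolding s_def by (rule hs_norm_operator_matrix[OF T[OF l] onb F])
    show "(a l)\<^sup>2 \<le> s l" unfolding a_def s_def by (rule L2_onorm_power2_le_hs[OF T[OF l] onb])
  next
    fix \<epsilon>
    show "L2_set (?u \<epsilon>) F \<le> 1" "L2_set (?v \<epsilon>) F \<le> 1"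
      unfolding L2_set_def
      using L2_Bessel[OF onb F fg(1)[of \<epsilon>]] power_mono[OF fg(3)[of \<epsilon>], of 2]
        L2_Bessel[OF onb F fg(2)[of \<epsilon>]] power_mono[OF fg(4)[of \<epsilon>], of 2] by auto
  qed
  finally show "rademacher_mean L (\<lambda>\<epsilon>. SUP d\<in>?D. (\<Sum>l\<in>L. \<epsilon> l * L2_inner M (T l (fst d)) (snd d))\<^sup>2)
    \<le> 2 * (\<Sum>l\<in>L. (a l)\<^sup>2) * ln (4 * ((\<Sum>l\<in>L. s l) / (\<Sum>l\<in>L. (a l)\<^sup>2))) + \<eta>"
    unfolding B_def .
qed

end

section \<open>Symmetrization of the supremum of a centred process\<close>

text \<open>
  For the process \<open>d \<mapsto> \<langle>T f, g\<rangle>\<close>, indexed by the test pairs \<open>d = (f, g)\<close>, this is the squared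
  operator norm of \<open>T\<close>.
\<close>

definition sup_square :: "'d set \<Rightarrow> ('d \<Rightarrow> real) \<Rightarrow> real" where
  "sup_square D w = (SUP d\<in>D. (w d)\<^sup>2)"

lemma sup_square_bdd:
  fixes w :: "'d \<Rightarrow> real"
  assumes "\<And>d. d \<in> D \<Longrightarrow> \<bar>w d\<bar> \<le> B"
  shows "bdd_above ((\<lambda>d. (w d)\<^sup>2) ` D)"
proof (rule bdd_aboveI2)
  fix d assume "d \<in> D"
  from power_mono[OF assms[OF this] abs_ge_zero, of 2] show "(w d)\<^sup>2 \<le> B\<^sup>2" by simp
qed

lemma sup_square_upper:
  assumes "\<And>d. d \<in> D \<Longrightarrow> \<bar>w d\<bar> \<le> B" "d \<in> D"
  shows "(w d)\<^sup>2 \<le> sup_square D w"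
  unfolding sup_square_def by (rule cSUP_upper[OF assms(2) sup_square_bdd[OF assms(1)]])

lemma sup_square_least: "D \<noteq> {} \<Longrightarrow> (\<And>d. d \<in> D \<Longrightarrow> (w d)\<^sup>2 \<le> c) \<Longrightarrow> sup_square D w \<le> c"
  unfolding sup_square_def by (rule cSUP_least)

lemma sup_square_nonneg:
  assumes "D \<noteq> {}" "\<And>d. d \<in> D \<Longrightarrow> \<bar>w d\<bar> \<le> B"
  shows "0 \<le> sup_square D w"
proof -
  obtain d where d: "d \<in> D" using assms(1) by blast
  have "0 \<le> (w d)\<^sup>2" by simp
  also have "\<dots> \<le> sup_square D w" using d by (intro sup_square_upper[where B = B] assms(2))
  finally show ?thesis .
qed

lemma sup_square_le:
  assumes "D \<noteq> {}" "\<And>d. d \<in> D \<Longrightarrow> \<bar>w d\<bar> \<le> B"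
  shows "sup_square D w \<le> B\<^sup>2"
proof (rule sup_square_least[OF assms(1)])
  fix d assume "d \<in> D"
  from power_mono[OF assms(2)[OF this] abs_ge_zero, of 2] show "(w d)\<^sup>2 \<le> B\<^sup>2" by simp
qed

lemma sup_square_cmult:
  assumes "D \<noteq> {}" "\<And>d. d \<in> D \<Longrightarrow> \<bar>w d\<bar> \<le> B"
  shows "sup_square D (\<lambda>d. 2 * w d) = 4 * sup_square D w"
proof (rule antisym)
  show "sup_square D (\<lambda>d. 2 * w d) \<le> 4 * sup_square D w"
  proof (rule sup_square_least[OF assms(1)])
    fix d assume "d \<in> D"
    then have "(w d)\<^sup>2 \<le> sup_square D w" by (intro sup_square_upper[where B = B] assms(2))
    then show "(2 * w d)\<^sup>2 \<le> 4 * sup_square D w" by (simp add: power_mult_distrib)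
  qed
  have "sup_square D w \<le> sup_square D (\<lambda>d. 2 * w d) / 4"
  proof (rule sup_square_least[OF assms(1)])
    fix d assume "d \<in> D"
    moreover have "\<bar>2 * w d\<bar> \<le> 2 * B" if "d \<in> D" for d using assms(2)[OF that] by simp
    ultimately have "(2 * w d)\<^sup>2 \<le> sup_square D (\<lambda>d. 2 * w d)" by (intro sup_square_upper)
    then show "(w d)\<^sup>2 \<le> sup_square D (\<lambda>d. 2 * w d) / 4" by (simp add: power_mult_distrib)
  qed
  then show "4 * sup_square D w \<le> sup_square D (\<lambda>d. 2 * w d)" by simp
qed

lemma sup_square_diff_le:
  assumes "D \<noteq> {}" "\<And>d. d \<in> D \<Longrightarrow> \<bar>w d\<bar> \<le> B" "\<And>d. d \<in> D \<Longrightarrow> \<bar>w' d\<bar> \<le> B"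
    and "\<And>d. d \<in> D \<Longrightarrow> \<bar>w d - w' d\<bar> \<le> \<rho>"
  shows "\<bar>sup_square D w - sup_square D w'\<bar> \<le> 2 * B * \<rho>"
proof -
  have key: "sup_square D v \<le> sup_square D v' + 2 * B * \<rho>"
    if "\<And>d. d \<in> D \<Longrightarrow> \<bar>v d\<bar> \<le> B" "\<And>d. d \<in> D \<Longrightarrow> \<bar>v' d\<bar> \<le> B" "\<And>d. d \<in> D \<Longrightarrow> \<bar>v d - v' d\<bar> \<le> \<rho>" for v v'
  proof (rule sup_square_least[OF assms(1)])
    fix d assume d: "d \<in> D"
    have "(v d)\<^sup>2 - (v' d)\<^sup>2 = (v d - v' d) * (v d + v' d)" by (simp add: power2_eq_square algebra_simps)
    also have "\<dots> \<le> \<bar>v d - v' d\<bar> * \<bar>v d + v' d\<bar>" by (simp add: abs_mult[symmetric])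
    also have "\<dots> \<le> \<rho> * (2 * B)"
      using that(1)[OF d] that(2)[OF d] that(3)[OF d] by (intro mult_mono) auto
    finally have "(v d)\<^sup>2 - (v' d)\<^sup>2 \<le> \<rho> * (2 * B)" .
    moreover have "(v' d)\<^sup>2 \<le> sup_square D v'" using d by (intro sup_square_upper[where B = B] that(2))
    ultimately show "(v d)\<^sup>2 \<le> sup_square D v' + 2 * B * \<rho>" by (simp add: mult.commute)
  qed
  have "sup_square D w \<le> sup_square D w' + 2 * B * \<rho>"
    by (rule key) (use assms in auto)
  moreover have "sup_square D w' \<le> sup_square D w + 2 * B * \<rho>"
    by (rule key) (use assms in \<open>auto simp: abs_minus_commute\<close>)
  ultimately show ?thesis by (simp add: abs_le_iff)
qed

text \<open>
  The index set \<open>D\<close> may be uncountable.  The uniform Lipschitz bound makes the supremum a continuous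
  function of finitely many coordinates, and these are measurable.
\<close>

lemma sup_square_sum_measurable:
  fixes x :: "nat \<Rightarrow> real \<Rightarrow> 'd \<Rightarrow> real" and t :: "'a \<Rightarrow> nat \<Rightarrow> real"
  assumes D: "D \<noteq> {}" and K: "finite K" and z: "\<And>d. d \<in> D \<Longrightarrow> \<bar>z d\<bar> \<le> Z"
    and bnd: "\<And>l s d. l \<in> K \<Longrightarrow> d \<in> D \<Longrightarrow> \<bar>x l s d\<bar> \<le> B"
    and lip: "\<And>l s s' d. l \<in> K \<Longrightarrow> d \<in> D \<Longrightarrow> \<bar>x l s d - x l s' d\<bar> \<le> B * \<bar>s - s'\<bar>"
    and t: "\<And>l. l \<in> K \<Longrightarrow> (\<lambda>\<omega>. t \<omega> l) \<in> borel_measurable M"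
  shows "(\<lambda>\<omega>. sup_square D (\<lambda>d. z d + (\<Sum>l\<in>K. x l (t \<omega> l) d))) \<in> borel_measurable M"
proof -
  define H where "H y = sup_square D (\<lambda>d. z d + (\<Sum>l\<in>K. x l (y l) d))" for y :: "nat \<Rightarrow> real"
  have bound: "\<bar>z d + (\<Sum>l\<in>K. x l (y l) d)\<bar> \<le> Z + real (card K) * B" if "d \<in> D" for y d
  proof -
    have "\<bar>\<Sum>l\<in>K. x l (y l) d\<bar> \<le> (\<Sum>l\<in>K. B)"
      by (rule order_trans[OF sum_abs sum_mono]) (rule bnd[OF _ that])
    then show ?thesis using z[OF that] by (simp add: abs_le_iff)
  qed
  have Hd: "\<bar>H y - H y'\<bar> \<le> 2 * (Z + real (card K) * B) * (\<Sum>l\<in>K. B * \<bar>y l - y' l\<bar>)" for y y'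
    unfolding H_def
  proof (rule sup_square_diff_le[OF D])
    fix d assume d: "d \<in> D"
    show "\<bar>z d + (\<Sum>l\<in>K. x l (y l) d)\<bar> \<le> Z + real (card K) * B" "\<bar>z d + (\<Sum>l\<in>K. x l (y' l) d)\<bar> \<le> Z + real (card K) * B"
      using bound[OF d] by auto
    have "\<bar>\<Sum>l\<in>K. x l (y l) d - x l (y' l) d\<bar> \<le> (\<Sum>l\<in>K. B * \<bar>y l - y' l\<bar>)"
      by (rule order_trans[OF sum_abs sum_mono]) (rule lip[OF _ d])
    then show "\<bar>(z d + (\<Sum>l\<in>K. x l (y l) d)) - (z d + (\<Sum>l\<in>K. x l (y' l) d))\<bar> \<le> (\<Sum>l\<in>K. B * \<bar>y l - y' l\<bar>)"
      by (simp add: sum_subtractf)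
  qed
  have "continuous_on UNIV H"
    unfolding continuous_on_eq_continuous_at[OF open_UNIV] isCont_def
  proof
    fix y :: "nat \<Rightarrow> real"
    have coord: "((\<lambda>y'. y' l) \<longlongrightarrow> y l) (at y)" for l
      using continuous_on_product_coordinates[of l, where ?'b = real]
      unfolding continuous_on_eq_continuous_at[OF open_UNIV] isCont_def by simp
    have "((\<lambda>y'. 2 * (Z + real (card K) * B) * (\<Sum>l\<in>K. B * \<bar>y' l - y l\<bar>)) \<longlongrightarrow>
       2 * (Z + real (card K) * B) * (\<Sum>l\<in>K. B * \<bar>y l - y l\<bar>)) (at y)"
      by (intro tendsto_intros coord)
    then have "((\<lambda>y'. 2 * (Z + real (card K) * B) * (\<Sum>l\<in>K. B * \<bar>y' l - y l\<bar>)) \<longlongrightarrow> 0) (at y)" by simp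
    then have "((\<lambda>y'. H y' - H y) \<longlongrightarrow> 0) (at y)"
      by (rule Lim_null_comparison[rotated]) (use Hd in auto)
    then show "(H \<longlongrightarrow> H y) (at y)" by (rule LIM_zero_cancel)
  qed
  then have H: "H \<in> borel_measurable borel" by (rule borel_measurable_continuous_onI)
  let ?t = "\<lambda>\<omega> l. if l \<in> K then t \<omega> l else 0"
  have "?t \<in> borel_measurable M"
  proof (rule measurable_coordinatewise_then_product)
    show "(\<lambda>\<omega>. ?t \<omega> l) \<in> borel_measurable M" for l by (cases "l \<in> K") (use t in auto)
  qed
  from measurable_compose[OF this H] show ?thesis by (simp add: H_def)
qed

text \<open>
  As \<open>X\<close> is centred, the mean of \<open>(w - 2 X)\<^sup>2\<close> is \<open>w\<^sup>2 + 4 \<bbbE> X\<^sup>2\<close>, hence \<open>w\<^sup>2\<close> is at most \<open>\<bbbE> sup (w - 2 X)\<^sup>2\<close>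
  at every index.  Together with \<open>(w + x)\<^sup>2 \<le> 1/2 (w + 2 x)\<^sup>2 + 1/2 w\<^sup>2\<close> this averages the two signs of \<open>2 X\<close>.
\<close>

lemma symmetrization_one_variable:
  fixes X :: "real \<Rightarrow> 'd \<Rightarrow> real"
  assumes N: "prob_space N" "sets N = sets borel" and D: "D \<noteq> {}"
    and w: "\<And>d. d \<in> D \<Longrightarrow> \<bar>w d\<bar> \<le> Z"
    and bnd: "\<And>s d. d \<in> D \<Longrightarrow> \<bar>X s d\<bar> \<le> B"
    and lip: "\<And>s s' d. d \<in> D \<Longrightarrow> \<bar>X s d - X s' d\<bar> \<le> B * \<bar>s - s'\<bar>"
    and zero: "\<And>d. d \<in> D \<Longrightarrow> (\<integral>s. X s d \<partial>N) = 0"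
  shows "(\<integral>\<^sup>+s. ennreal (sup_square D (\<lambda>d. w d + X s d)) \<partial>N)
    \<le> (\<integral>\<^sup>+s. ennreal (1/2 * sup_square D (\<lambda>d. w d + 2 * X s d) + 1/2 * sup_square D (\<lambda>d. w d + -2 * X s d)) \<partial>N)"
proof -
  interpret prob_space N by fact
  have N_borel: "borel_measurable N = borel_measurable borel" by (rule measurable_cong_sets[OF N(2) refl])
  have B0: "0 \<le> B" using D bnd by (meson abs_ge_zero ex_in_conv order_trans)
  let ?\<phi> = "\<lambda>c s. sup_square D (\<lambda>d. w d + c * X s d)"
  have bound: "\<bar>w d + c * X s d\<bar> \<le> Z + 2 * B" if "d \<in> D" "\<bar>c\<bar> \<le> 2" for c s d
  proof -
    have "\<bar>c * X s d\<bar> \<le> 2 * B" unfolding abs_mult using that bnd[OF that(1)] by (intro mult_mono) auto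
    then show ?thesis using w[OF that(1)] by linarith
  qed
  have meas: "?\<phi> c \<in> borel_measurable N" if "\<bar>c\<bar> \<le> 2" for c
  proof -
    have "(\<lambda>s. sup_square D (\<lambda>d. w d + (\<Sum>l\<in>{0::nat}. c * X s d))) \<in> borel_measurable N"
    proof (rule sup_square_sum_measurable[where x = "\<lambda>l s d. c * X s d" and t = "\<lambda>s l. s" and B = "2 * B"])
      show "\<bar>c * X s d\<bar> \<le> 2 * B" if "d \<in> D" for s d
        unfolding abs_mult using \<open>\<bar>c\<bar> \<le> 2\<close> bnd[OF that] by (intro mult_mono) auto
      show "\<bar>c * X s d - c * X s' d\<bar> \<le> 2 * B * \<bar>s - s'\<bar>" if "d \<in> D" for s s' d
      proof -
        have "\<bar>c * X s d - c * X s' d\<bar> = \<bar>c\<bar> * \<bar>X s d - X s' d\<bar>" by (simp add: abs_mult[symmetric] right_diff_distrib)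
        also have "\<dots> \<le> 2 * (B * \<bar>s - s'\<bar>)" using \<open>\<bar>c\<bar> \<le> 2\<close> lip[OF that] by (intro mult_mono) auto
        finally show ?thesis by simp
      qed
    qed (use D w in \<open>auto simp: N_borel\<close>)
    then show ?thesis by simp
  qed
  have int: "integrable N (?\<phi> c)" if "\<bar>c\<bar> \<le> 2" for c
  proof (rule integrable_const_bound[of _ "(Z + 2 * B)\<^sup>2"])
    show "AE s in N. norm (?\<phi> c s) \<le> (Z + 2 * B)\<^sup>2"
      by (rule AE_I2) (use sup_square_nonneg[OF D bound[OF _ that]] sup_square_le[OF D bound[OF _ that]] in \<open>simp add: abs_of_nonneg\<close>)
  qed (rule meas[OF that])
  have nn: "0 \<le> ?\<phi> c s" if "\<bar>c\<bar> \<le> 2" for c s by (rule sup_square_nonneg[OF D bound[OF _ that]])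
  define J where "J = (\<integral>s. ?\<phi> (-2) s \<partial>N)"
  have wJ: "(w d)\<^sup>2 \<le> J" if d: "d \<in> D" for d
  proof -
    have Xm: "(\<lambda>s. X s d) \<in> borel_measurable N"
    proof -
      have "B-lipschitz_on UNIV (\<lambda>s. X s d)"
        using lip[OF d] B0 by (intro lipschitz_onI) (auto simp: dist_real_def)
      then show ?thesis unfolding N_borel by (intro borel_measurable_continuous_onI lipschitz_on_continuous_on)
    qed
    have X: "integrable N (\<lambda>s. X s d)" by (rule integrable_const_bound[of _ B]) (use bnd[OF d] Xm in auto)
    have X2: "integrable N (\<lambda>s. (X s d)\<^sup>2)"
      by (rule integrable_const_bound[of _ "B\<^sup>2"]) (use power_mono[OF bnd[OF d] abs_ge_zero, of _ 2] Xm in auto)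
    have "(w d)\<^sup>2 \<le> (w d)\<^sup>2 + 4 * (\<integral>s. (X s d)\<^sup>2 \<partial>N)" by simp
    also have "\<dots> = (\<integral>s. (w d)\<^sup>2 - 4 * w d * X s d + 4 * (X s d)\<^sup>2 \<partial>N)"
      using X X2 zero[OF d] by (simp add: prob_space)
    also have "\<dots> \<le> J" unfolding J_def
    proof (rule integral_mono)
      show "integrable N (\<lambda>s. (w d)\<^sup>2 - 4 * w d * X s d + 4 * (X s d)\<^sup>2)" using X X2 by simp
      show "integrable N (?\<phi> (-2))" by (rule int) simp
      fix s
      have "(w d)\<^sup>2 - 4 * w d * X s d + 4 * (X s d)\<^sup>2 = (w d + -2 * X s d)\<^sup>2"
        by (simp add: power2_eq_square algebra_simps)
      also have "\<dots> \<le> ?\<phi> (-2) s" by (rule sup_square_upper[OF _ d]) (rule bound, auto)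
      finally show "(w d)\<^sup>2 - 4 * w d * X s d + 4 * (X s d)\<^sup>2 \<le> ?\<phi> (-2) s" .
    qed
    finally show ?thesis .
  qed
  have ptw: "?\<phi> 1 s \<le> 1/2 * ?\<phi> 2 s + 1/2 * J" for s
  proof (rule sup_square_least[OF D])
    fix d assume d: "d \<in> D"
    have "(w d + 1 * X s d)\<^sup>2 \<le> 1/2 * (w d + 2 * X s d)\<^sup>2 + 1/2 * (w d)\<^sup>2"
      using zero_le_power2[of "X s d"] by (simp add: power2_eq_square algebra_simps)
    also have "\<dots> \<le> 1/2 * ?\<phi> 2 s + 1/2 * J"
      by (intro add_mono mult_left_mono wJ d sup_square_upper[OF _ d]) (rule bound, auto)
    finally show "(w d + 1 * X s d)\<^sup>2 \<le> 1/2 * ?\<phi> 2 s + 1/2 * J" .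
  qed
  have "(\<integral>s. ?\<phi> 1 s \<partial>N) \<le> (\<integral>s. 1/2 * ?\<phi> 2 s + 1/2 * J \<partial>N)"
    using int[of 1] int[of 2] ptw by (intro integral_mono) auto
  also have "\<dots> = (\<integral>s. 1/2 * ?\<phi> 2 s + 1/2 * ?\<phi> (-2) s \<partial>N)"
  proof -
    have "(\<integral>s. 1/2 * f s + 1/2 * (\<integral>s. g s \<partial>N) \<partial>N) = (\<integral>s. 1/2 * f s + 1/2 * g s \<partial>N)"
      if "integrable N f" "integrable N g" for f g :: "real \<Rightarrow> real"
      using that by (simp add: prob_space)
    then show ?thesis unfolding J_def using int[of 2] int[of "-2"] by simp
  qed
  finally have "ennreal (\<integral>s. ?\<phi> 1 s \<partial>N) \<le> ennreal (\<integral>s. 1/2 * ?\<phi> 2 s + 1/2 * ?\<phi> (-2) s \<partial>N)"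
    by (rule ennreal_leI)
  also have "ennreal (\<integral>s. ?\<phi> 1 s \<partial>N) = (\<integral>\<^sup>+s. ennreal (?\<phi> 1 s) \<partial>N)"
    using int[of 1] nn[of 1] by (intro nn_integral_eq_integral[symmetric]) auto
  also have "ennreal (\<integral>s. 1/2 * ?\<phi> 2 s + 1/2 * ?\<phi> (-2) s \<partial>N) = (\<integral>\<^sup>+s. ennreal (1/2 * ?\<phi> 2 s + 1/2 * ?\<phi> (-2) s) \<partial>N)"
    using int[of 2] int[of "-2"] nn[of 2] nn[of "-2"] by (intro nn_integral_eq_integral[symmetric]) auto
  finally show ?thesis by simp
qed

definition sign_process :: "'d set \<Rightarrow> nat set \<Rightarrow> (nat \<Rightarrow> real \<Rightarrow> 'd \<Rightarrow> real) \<Rightarrow> ('d \<Rightarrow> real) \<Rightarrow> (nat \<Rightarrow> real) \<Rightarrow> (nat \<Rightarrow> real) \<Rightarrow> real" where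
  "sign_process D K x z c t = sup_square D (\<lambda>d. z d + (\<Sum>l\<in>K. c l * x l (t l) d))"

lemma sign_process_insert:
  assumes "finite K" "k \<notin> K"
  shows "sign_process D (insert k K) x z c (t(k := s)) = sign_process D K x (\<lambda>d. z d + c k * x k s d) c t"
proof -
  have "(\<Sum>l\<in>insert k K. c l * x l ((t(k := s)) l) d) = c k * x k s d + (\<Sum>l\<in>K. c l * x l (t l) d)" for d
  proof -
    have "(\<Sum>l\<in>K. c l * x l ((t(k := s)) l) d) = (\<Sum>l\<in>K. c l * x l (t l) d)"
      using assms(2) by (intro sum.cong) auto
    then show ?thesis using assms by simp
  qed
  then show ?thesis by (simp add: sign_process_def add.assoc)
qed

lemma sign_process_cong: "(\<And>l. l \<in> K \<Longrightarrow> c l = c' l) \<Longrightarrow> sign_process D K x z c t = sign_process D K x z c' t"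
  by (simp add: sign_process_def cong: sum.cong_simp)

text \<open>
  Induction on the number of variables.  The one-variable estimate is applied to the inner integral over
  the new variable; after exchanging the integrals, the induction hypothesis applies with the new
  summand absorbed into \<open>z\<close>, which is the reason for carrying an arbitrary bounded \<open>z\<close>.
\<close>

lemma symmetrization_product:
  fixes x :: "nat \<Rightarrow> real \<Rightarrow> 'd \<Rightarrow> real"
  assumes N: "\<And>l. prob_space (N l)" "\<And>l. sets (N l) = sets borel"
    and D: "D \<noteq> {}" and K: "finite K" and z: "\<And>d. d \<in> D \<Longrightarrow> \<bar>z d\<bar> \<le> Z"
    and bnd: "\<And>l s d. l \<in> K \<Longrightarrow> d \<in> D \<Longrightarrow> \<bar>x l s d\<bar> \<le> B"
    and lip: "\<And>l s s' d. l \<in> K \<Longrightarrow> d \<in> D \<Longrightarrow> \<bar>x l s d - x l s' d\<bar> \<le> B * \<bar>s - s'\<bar>"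
    and zero: "\<And>l d. l \<in> K \<Longrightarrow> d \<in> D \<Longrightarrow> (\<integral>s. x l s d \<partial>N l) = 0"
  shows "(\<integral>\<^sup>+t. ennreal (sign_process D K x z (\<lambda>_. 1) t) \<partial>PiM K N)
    \<le> (\<integral>\<^sup>+t. ennreal (rademacher_mean K (\<lambda>\<epsilon>. sign_process D K x z (\<lambda>l. 2 * \<epsilon> l) t)) \<partial>PiM K N)"
  using K z bnd lip zero
proof (induction K arbitrary: z Z rule: finite_induct)
  case empty
  then show ?case by (simp add: sign_process_def rademacher_mean_const)
next
  case (insert k K)
  interpret product_sigma_finite N
    using N(1) by (auto simp: product_sigma_finite_def intro: prob_space_imp_sigma_finite)
  note ins = insert.hyps
  have B0: "0 \<le> B"
  proof -
    obtain d where "d \<in> D" using D by blast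
    from insert.prems(2)[OF insertI1 this, of 0] show ?thesis using abs_ge_zero order_trans by blast
  qed
  have meas: "(\<lambda>t. sign_process D J x y c t) \<in> borel_measurable (PiM J N)"
    if "J \<subseteq> insert k K" "\<And>d. d \<in> D \<Longrightarrow> \<bar>y d\<bar> \<le> Y" "\<And>l. l \<in> J \<Longrightarrow> \<bar>c l\<bar> \<le> 2" for J y Y c
    unfolding sign_process_def
  proof (rule sup_square_sum_measurable[OF D _ that(2), where x = "\<lambda>l s d. c l * x l s d" and t = "\<lambda>t. t" and B = "2 * B"])
    show "finite J" using that(1) ins(1) finite_subset by blast
    fix l s s' d assume l: "l \<in> J" and d: "d \<in> D"
    then have l': "l \<in> insert k K" using that(1) by blast
    show "\<bar>c l * x l s d\<bar> \<le> 2 * B"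
      unfolding abs_mult using that(3)[OF l] insert.prems(2)[OF l' d] by (intro mult_mono) auto
    have "\<bar>c l * x l s d - c l * x l s' d\<bar> = \<bar>c l\<bar> * \<bar>x l s d - x l s' d\<bar>"
      by (simp add: abs_mult[symmetric] right_diff_distrib)
    also have "\<dots> \<le> 2 * (B * \<bar>s - s'\<bar>)" using that(3)[OF l] insert.prems(3)[OF l' d] by (intro mult_mono) auto
    finally show "\<bar>c l * x l s d - c l * x l s' d\<bar> \<le> 2 * B * \<bar>s - s'\<bar>" by simp
  next
    fix l assume "l \<in> J"
    then have "(\<lambda>t. t l) \<in> measurable (PiM J N) (N l)" by (rule measurable_component_singleton)
    then show "(\<lambda>t. t l) \<in> borel_measurable (PiM J N)" by (simp cong: measurable_cong_sets[OF refl N(2)])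
  qed
  have one: "\<bar>1::real\<bar> \<le> 2" by simp
  let ?p = "\<lambda>s d. z d + 2 * x k s d" and ?m = "\<lambda>s d. z d + -2 * x k s d"
  have pm: "\<bar>z d + c * x k s d\<bar> \<le> Z + 2 * B" if "d \<in> D" "\<bar>c\<bar> \<le> 2" for c s d
  proof -
    have "\<bar>c * x k s d\<bar> \<le> 2 * B"
      unfolding abs_mult using that insert.prems(2)[OF insertI1 that(1)] by (intro mult_mono) auto
    then show ?thesis using insert.prems(1)[OF that(1)] by linarith
  qed
  have nn: "0 \<le> sign_process D K x y c t" if "\<And>d. d \<in> D \<Longrightarrow> \<bar>y d\<bar> \<le> Y" "\<And>l. l \<in> K \<Longrightarrow> \<bar>c l\<bar> \<le> 2" for y Y c t
    unfolding sign_process_def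
  proof (rule sup_square_nonneg[OF D])
    fix d assume d: "d \<in> D"
    have "\<bar>\<Sum>l\<in>K. c l * x l (t l) d\<bar> \<le> (\<Sum>l\<in>K. 2 * B)"
    proof (rule order_trans[OF sum_abs sum_mono])
      fix l assume l: "l \<in> K"
      then show "\<bar>c l * x l (t l) d\<bar> \<le> 2 * B"
        unfolding abs_mult using that(2)[OF l] insert.prems(2)[OF insertI2[OF l] d] by (intro mult_mono) auto
    qed
    then show "\<bar>y d + (\<Sum>l\<in>K. c l * x l (t l) d)\<bar> \<le> Y + (\<Sum>l\<in>K. 2 * B)" using that(1)[OF d] by linarith
  qed
  define R where "R y t = rademacher_mean K (\<lambda>\<epsilon>. sign_process D K x y (\<lambda>l. 2 * \<epsilon> l) t)" for y t
  have sg: "\<bar>2 * \<epsilon> l\<bar> \<le> 2" if "\<epsilon> \<in> PiE K (\<lambda>_. {-1, 1::real})" "l \<in> K" for \<epsilon> l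
  proof -
    have "\<epsilon> l \<in> {-1, 1}" by (rule PiE_mem[OF that])
    then show ?thesis by auto
  qed
  have Rnn: "0 \<le> R y t" if "\<And>d. d \<in> D \<Longrightarrow> \<bar>y d\<bar> \<le> Y" for y Y t
    unfolding R_def rademacher_mean_def
    by (intro divide_nonneg_nonneg sum_nonneg nn[OF that]) (use sg in auto)
  have Rmeas: "R y \<in> borel_measurable (PiM K N)" if "\<And>d. d \<in> D \<Longrightarrow> \<bar>y d\<bar> \<le> Y" for y Y
    unfolding R_def rademacher_mean_def
    by (intro borel_measurable_divide borel_measurable_sum borel_measurable_const meas[OF _ that]) (use sg in auto)
  have IH: "(\<integral>\<^sup>+t. ennreal (sign_process D K x y (\<lambda>_. 1) t) \<partial>PiM K N) \<le> (\<integral>\<^sup>+t. ennreal (R y t) \<partial>PiM K N)"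
    if "\<And>d. d \<in> D \<Longrightarrow> \<bar>y d\<bar> \<le> Y" for y Y
    unfolding R_def using that insert.prems(2-4) by (intro insert.IH) auto
  let ?c2 = "(\<lambda>_. 1)(k := 2) :: nat \<Rightarrow> real" and ?c3 = "(\<lambda>_. 1)(k := -2) :: nat \<Rightarrow> real"
  let ?G = "\<lambda>t. 1/2 * sign_process D (insert k K) x z ?c2 t + 1/2 * sign_process D (insert k K) x z ?c3 t"
  have Gmeas: "?G \<in> borel_measurable (PiM (insert k K) N)"
    by (intro borel_measurable_add borel_measurable_times borel_measurable_const meas[OF _ insert.prems(1)]) auto
  have G: "?G (t(k := s)) = 1/2 * sign_process D K x (?p s) (\<lambda>_. 1) t + 1/2 * sign_process D K x (?m s) (\<lambda>_. 1) t" for t s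
  proof -
    have *: "sign_process D K x y ((\<lambda>_. 1)(k := b)) t = sign_process D K x y (\<lambda>_. 1) t" for y b
      by (rule sign_process_cong) (use ins(2) in auto)
    show ?thesis unfolding sign_process_insert[OF ins] by (simp add: *)
  qed
  let ?R = "\<lambda>t. rademacher_mean (insert k K) (\<lambda>\<epsilon>. sign_process D (insert k K) x z (\<lambda>l. 2 * \<epsilon> l) t)"
  have Rins: "?R (t(k := s)) = 1/2 * R (?p s) t + 1/2 * R (?m s) t" for t s
  proof -
    have *: "sign_process D K x y (\<lambda>l. 2 * (\<epsilon>(k := b)) l) t = sign_process D K x y (\<lambda>l. 2 * \<epsilon> l) t" for y b and \<epsilon> :: "nat \<Rightarrow> real"
      by (rule sign_process_cong) (use ins(2) in auto)
    show ?thesis unfolding rademacher_mean_insert[OF ins] sign_process_insert[OF ins] * R_def by simp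
  qed
  have sgi: "\<bar>2 * \<epsilon> l\<bar> \<le> 2" if "\<epsilon> \<in> PiE (insert k K) (\<lambda>_. {-1, 1::real})" "l \<in> insert k K" for \<epsilon> l
  proof -
    have "\<epsilon> l \<in> {-1, 1}" by (rule PiE_mem[OF that])
    then show ?thesis by auto
  qed
  have Rimeas: "?R \<in> borel_measurable (PiM (insert k K) N)"
    unfolding rademacher_mean_def
    by (intro borel_measurable_divide borel_measurable_sum borel_measurable_const meas[OF _ insert.prems(1)]) (use sgi in auto)
  have "(\<integral>\<^sup>+t. ennreal (sign_process D (insert k K) x z (\<lambda>_. 1) t) \<partial>PiM (insert k K) N)
    = (\<integral>\<^sup>+t. (\<integral>\<^sup>+s. ennreal (sign_process D (insert k K) x z (\<lambda>_. 1) (t(k := s))) \<partial>N k) \<partial>PiM K N)"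
    by (rule product_nn_integral_insert[OF ins])
      (intro measurable_compose[OF meas[OF order_refl insert.prems(1)] measurable_ennreal], auto)
  also have "\<dots> \<le> (\<integral>\<^sup>+t. (\<integral>\<^sup>+s. ennreal (?G (t(k := s))) \<partial>N k) \<partial>PiM K N)"
  proof (rule nn_integral_mono)
    fix t
    let ?w = "\<lambda>d. z d + (\<Sum>l\<in>K. 1 * x l (t l) d)"
    have w: "\<bar>?w d\<bar> \<le> Z + real (card K) * B" if d: "d \<in> D" for d
    proof -
      have "\<bar>\<Sum>l\<in>K. 1 * x l (t l) d\<bar> \<le> (\<Sum>l\<in>K. B)"
        by (rule order_trans[OF sum_abs sum_mono]) (use insert.prems(2)[OF insertI2 d] in simp)
      then show ?thesis using insert.prems(1)[OF d] by (simp add: abs_le_iff)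
    qed
    have eq: "sign_process D K x (\<lambda>d. z d + c * x k s d) (\<lambda>_. 1) t = sup_square D (\<lambda>d. ?w d + c * x k s d)" for c s
      unfolding sign_process_def by (simp add: add_ac)
    have "(\<integral>\<^sup>+s. ennreal (sup_square D (\<lambda>d. ?w d + x k s d)) \<partial>N k)
      \<le> (\<integral>\<^sup>+s. ennreal (1/2 * sup_square D (\<lambda>d. ?w d + 2 * x k s d) + 1/2 * sup_square D (\<lambda>d. ?w d + -2 * x k s d)) \<partial>N k)"
      by (rule symmetrization_one_variable[OF N D w, where B = B])
        (use insert.prems(2-4) in auto)
    then show "(\<integral>\<^sup>+s. ennreal (sign_process D (insert k K) x z (\<lambda>_. 1) (t(k := s))) \<partial>N k) \<le> (\<integral>\<^sup>+s. ennreal (?G (t(k := s))) \<partial>N k)"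
      unfolding G unfolding sign_process_insert[OF ins] eq eq[of 1, simplified] by simp
  qed
  also have "\<dots> = (\<integral>\<^sup>+t. ennreal (?G t) \<partial>PiM (insert k K) N)"
    by (rule product_nn_integral_insert[OF ins, symmetric]) (intro measurable_compose[OF Gmeas measurable_ennreal])
  also have "\<dots> = (\<integral>\<^sup>+s. (\<integral>\<^sup>+t. ennreal (?G (t(k := s))) \<partial>PiM K N) \<partial>N k)"
    by (rule product_nn_integral_insert_rev[OF ins]) (intro measurable_compose[OF Gmeas measurable_ennreal])
  also have "\<dots> \<le> (\<integral>\<^sup>+s. (\<integral>\<^sup>+t. ennreal (?R (t(k := s))) \<partial>PiM K N) \<partial>N k)"
  proof (rule nn_integral_mono)
    fix s
    have p: "\<bar>?p s d\<bar> \<le> Z + 2 * B" if "d \<in> D" for d by (rule pm[OF that]) simp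
    have m: "\<bar>?m s d\<bar> \<le> Z + 2 * B" if "d \<in> D" for d by (rule pm[OF that]) simp
    have half: "(\<integral>\<^sup>+t. ennreal (1/2 * f t + 1/2 * g t) \<partial>PiM K N)
       = ennreal (1/2) * (\<integral>\<^sup>+t. ennreal (f t) \<partial>PiM K N) + ennreal (1/2) * (\<integral>\<^sup>+t. ennreal (g t) \<partial>PiM K N)"
      if "f \<in> borel_measurable (PiM K N)" "g \<in> borel_measurable (PiM K N)" "\<And>t. 0 \<le> f t" "\<And>t. 0 \<le> g t" for f g
    proof -
      have "(\<integral>\<^sup>+t. ennreal (1/2 * f t + 1/2 * g t) \<partial>PiM K N) = (\<integral>\<^sup>+t. ennreal (1/2) * ennreal (f t) + ennreal (1/2) * ennreal (g t) \<partial>PiM K N)"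
      proof (rule nn_integral_cong)
        fix t
        show "ennreal (1/2 * f t + 1/2 * g t) = ennreal (1/2) * ennreal (f t) + ennreal (1/2) * ennreal (g t)"
          using that(3)[of t] that(4)[of t] by (simp only: ennreal_plus ennreal_mult mult_nonneg_nonneg zero_le_divide_1_iff zero_le_numeral)
      qed
      also have "\<dots> = ennreal (1/2) * (\<integral>\<^sup>+t. ennreal (f t) \<partial>PiM K N) + ennreal (1/2) * (\<integral>\<^sup>+t. ennreal (g t) \<partial>PiM K N)"
        using that(1,2) by (subst nn_integral_add) (auto simp: nn_integral_cmult)
      finally show ?thesis .
    qed
    show "(\<integral>\<^sup>+t. ennreal (?G (t(k := s))) \<partial>PiM K N) \<le> (\<integral>\<^sup>+t. ennreal (?R (t(k := s))) \<partial>PiM K N)"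
      unfolding G Rins
      by (subst half, (rule meas[OF _ p] meas[OF _ m] nn[OF p] nn[OF m]; auto)+,
          subst half, (rule Rmeas[OF p] Rmeas[OF m] Rnn[OF p] Rnn[OF m]; assumption)+,
          intro add_mono mult_left_mono IH[OF p] IH[OF m], auto)
  qed
  also have "\<dots> = (\<integral>\<^sup>+t. ennreal (?R t) \<partial>PiM (insert k K) N)"
    by (rule product_nn_integral_insert_rev[OF ins, symmetric]) (intro measurable_compose[OF Rimeas measurable_ennreal])
  finally show ?case .
qed

text \<open>
  By independence the joint law of the parameters is a product measure.  The factor \<open>4\<close> is the square
  of the factor \<open>2\<close> in front of the signs.
\<close>

theorem (in prob_space) symmetrization:
  fixes x :: "nat \<Rightarrow> real \<Rightarrow> 'd \<Rightarrow> real" and \<mu> :: "nat \<Rightarrow> 'a \<Rightarrow> real"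
  assumes L: "finite L" "L \<noteq> {}" and indep: "indep_vars (\<lambda>_. borel) \<mu> L" and D: "D \<noteq> {}"
    and bnd: "\<And>l s d. l \<in> L \<Longrightarrow> d \<in> D \<Longrightarrow> \<bar>x l s d\<bar> \<le> B"
    and lip: "\<And>l s s' d. l \<in> L \<Longrightarrow> d \<in> D \<Longrightarrow> \<bar>x l s d - x l s' d\<bar> \<le> B * \<bar>s - s'\<bar>"
    and zero: "\<And>l d. l \<in> L \<Longrightarrow> d \<in> D \<Longrightarrow> expectation (\<lambda>\<omega>. x l (\<mu> l \<omega>) d) = 0"
  defines "S \<equiv> \<lambda>c \<omega>. sup_square D (\<lambda>d. \<Sum>l\<in>L. c l * x l (\<mu> l \<omega>) d)"
  shows "integrable M (S (\<lambda>_. 1))"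
    and "integrable M (\<lambda>\<omega>. rademacher_mean L (\<lambda>\<epsilon>. S \<epsilon> \<omega>))"
    and "expectation (S (\<lambda>_. 1)) \<le> 4 * expectation (\<lambda>\<omega>. rademacher_mean L (\<lambda>\<epsilon>. S \<epsilon> \<omega>))"
proof -
  have rv: "\<mu> l \<in> borel_measurable M" if "l \<in> L" for l
    using indep that by (auto simp: indep_vars_def)
  have B0: "0 \<le> B"
  proof -
    obtain l d where "l \<in> L" "d \<in> D" using L D by blast
    from bnd[OF this, of 0] show ?thesis using abs_ge_zero order_trans by blast
  qed
  have scaled: "\<bar>c * x l s d\<bar> \<le> 2 * B" "\<bar>c * x l s d - c * x l s' d\<bar> \<le> 2 * B * \<bar>s - s'\<bar>"
    if "l \<in> L" "d \<in> D" "\<bar>c\<bar> \<le> 2" for c l d s s'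
  proof -
    show "\<bar>c * x l s d\<bar> \<le> 2 * B" unfolding abs_mult using that bnd[OF that(1,2)] by (intro mult_mono) auto
    have "\<bar>c * x l s d - c * x l s' d\<bar> = \<bar>c\<bar> * \<bar>x l s d - x l s' d\<bar>"
      by (simp add: abs_mult[symmetric] right_diff_distrib)
    also have "\<dots> \<le> 2 * (B * \<bar>s - s'\<bar>)" using that(3) lip[OF that(1,2)] by (intro mult_mono) auto
    finally show "\<bar>c * x l s d - c * x l s' d\<bar> \<le> 2 * B * \<bar>s - s'\<bar>" by simp
  qed
  have meas: "(\<lambda>\<omega>. sign_process D L x (\<lambda>_. 0) c (t \<omega>)) \<in> borel_measurable M'"
    if "\<And>l. l \<in> L \<Longrightarrow> (\<lambda>\<omega>. t \<omega> l) \<in> borel_measurable M'" "\<And>l. l \<in> L \<Longrightarrow> \<bar>c l\<bar> \<le> 2" for t c and M' :: "'e measure"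
    unfolding sign_process_def
    by (rule sup_square_sum_measurable[OF D L(1), where x = "\<lambda>l s d. c l * x l s d" and Z = 0 and B = "2 * B"])
      (use scaled that in auto)
  have Ssp: "S c \<omega> = sign_process D L x (\<lambda>_. 0) c (\<lambda>l. \<mu> l \<omega>)" for c \<omega>
    by (simp add: S_def sign_process_def)
  have Smeas: "S c \<in> borel_measurable M" if "\<And>l. l \<in> L \<Longrightarrow> \<bar>c l\<bar> \<le> 2" for c
    unfolding Ssp by (rule meas[OF rv that])
  have bound: "\<bar>\<Sum>l\<in>L. c l * x l (\<mu> l \<omega>) d\<bar> \<le> (\<Sum>l\<in>L. 2 * B)" if "d \<in> D" "\<And>l. l \<in> L \<Longrightarrow> \<bar>c l\<bar> \<le> 2" for c d \<omega>
    by (rule order_trans[OF sum_abs sum_mono]) (rule scaled(1)[OF _ that(1) that(2)])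
  have Sint: "integrable M (S c)" and Snn: "\<And>\<omega>. 0 \<le> S c \<omega>" if c: "\<And>l. l \<in> L \<Longrightarrow> \<bar>c l\<bar> \<le> 2" for c
  proof -
    show nn: "0 \<le> S c \<omega>" for \<omega> unfolding S_def by (rule sup_square_nonneg[OF D bound[OF _ c]])
    have le: "S c \<omega> \<le> (\<Sum>l\<in>L. 2 * B)\<^sup>2" for \<omega> unfolding S_def by (rule sup_square_le[OF D bound[OF _ c]])
    show "integrable M (S c)"
      by (rule integrable_const_bound[OF AE_I2 Smeas[OF c]]) (use nn le in simp)
  qed
  show int1: "integrable M (S (\<lambda>_. 1))" by (rule Sint) simp
  have sg: "\<bar>\<epsilon> l\<bar> \<le> 2" "\<bar>2 * \<epsilon> l\<bar> \<le> 2" if "\<epsilon> \<in> PiE L (\<lambda>_. {-1, 1::real})" "l \<in> L" for \<epsilon> l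
  proof -
    have "\<epsilon> l \<in> {-1, 1}" by (rule PiE_mem[OF that])
    then show "\<bar>\<epsilon> l\<bar> \<le> 2" "\<bar>2 * \<epsilon> l\<bar> \<le> 2" by auto
  qed
  show int2: "integrable M (\<lambda>\<omega>. rademacher_mean L (\<lambda>\<epsilon>. S \<epsilon> \<omega>))"
    unfolding rademacher_mean_def
    by (intro integrable_divide Bochner_Integration.integrable_sum Sint) (rule sg(1))
  have twice: "S (\<lambda>l. 2 * \<epsilon> l) \<omega> = 4 * S \<epsilon> \<omega>" if "\<epsilon> \<in> PiE L (\<lambda>_. {-1, 1::real})" for \<epsilon> \<omega>
  proof -
    have "sup_square D (\<lambda>d. 2 * (\<Sum>l\<in>L. \<epsilon> l * x l (\<mu> l \<omega>) d)) = 4 * sup_square D (\<lambda>d. \<Sum>l\<in>L. \<epsilon> l * x l (\<mu> l \<omega>) d)"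
      by (rule sup_square_cmult[OF D bound]) (use sg(1)[OF that] in auto)
    then show ?thesis by (simp add: S_def sum_distrib_left mult.assoc)
  qed
  define N where "N l = (if l \<in> L then distr M borel (\<mu> l) else return borel 0)" for l
  have N: "prob_space (N l)" "sets (N l) = sets borel" for l
    by (auto simp: N_def intro: prob_space_distr rv prob_space_return)
  define \<tau> where "\<tau> \<omega> = (\<lambda>l\<in>L. \<mu> l \<omega>)" for \<omega>
  have \<tau>m: "\<tau> \<in> measurable M (PiM L (\<lambda>_. borel))" unfolding \<tau>_def by (rule measurable_restrict) (rule rv)
  have "distr M (PiM L (\<lambda>_. borel)) (\<lambda>\<omega>. \<lambda>l\<in>L. \<mu> l \<omega>) = PiM L (\<lambda>l. distr M borel (\<mu> l))"
    using indep_vars_iff_distr_eq_PiM'[OF L(2), where M' = "\<lambda>_. borel" and X = \<mu>] rv indep by simp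
  also have "\<dots> = PiM L N" by (rule PiM_cong) (auto simp: N_def)
  finally have PN: "PiM L N = distr M (PiM L (\<lambda>_. borel)) \<tau>" by (simp add: \<tau>_def[abs_def])
  have S\<tau>: "sign_process D L x (\<lambda>_. 0) c (\<tau> \<omega>) = S c \<omega>" for c \<omega>
    by (simp add: Ssp sign_process_def \<tau>_def)
  have comp: "(\<lambda>t. t l) \<in> borel_measurable (PiM L (\<lambda>_. borel))" if "l \<in> L" for l
    using that by (rule measurable_component_singleton)
  have "(\<integral>\<^sup>+\<omega>. ennreal (S (\<lambda>_. 1) \<omega>) \<partial>M) = (\<integral>\<^sup>+t. ennreal (sign_process D L x (\<lambda>_. 0) (\<lambda>_. 1) t) \<partial>PiM L N)"
    unfolding PN S\<tau>[symmetric]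
    by (rule nn_integral_distr[OF \<tau>m, symmetric]) (intro measurable_compose[OF meas measurable_ennreal] comp, auto)
  also have "\<dots> \<le> (\<integral>\<^sup>+t. ennreal (rademacher_mean L (\<lambda>\<epsilon>. sign_process D L x (\<lambda>_. 0) (\<lambda>l. 2 * \<epsilon> l) t)) \<partial>PiM L N)"
  proof (rule symmetrization_product[OF N D L(1)])
    fix l d assume l: "l \<in> L" and d: "d \<in> D"
    have "B-lipschitz_on UNIV (\<lambda>s. x l s d)"
      using lip[OF l d] B0 by (intro lipschitz_onI) (auto simp: dist_real_def)
    then have "(\<lambda>s. x l s d) \<in> borel_measurable borel"
      by (intro borel_measurable_continuous_onI lipschitz_on_continuous_on)
    then show "(\<integral>s. x l s d \<partial>N l) = 0"
      using zero[OF l d] l rv[OF l] by (simp add: N_def integral_distr)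
  qed (use bnd lip in auto)
  also have "\<dots> = (\<integral>\<^sup>+\<omega>. ennreal (rademacher_mean L (\<lambda>\<epsilon>. sign_process D L x (\<lambda>_. 0) (\<lambda>l. 2 * \<epsilon> l) (\<tau> \<omega>))) \<partial>M)"
  proof -
    have RM: "(\<lambda>t. rademacher_mean L (\<lambda>\<epsilon>. sign_process D L x (\<lambda>_. 0) (\<lambda>l. 2 * \<epsilon> l) t)) \<in> borel_measurable (PiM L (\<lambda>_. borel))"
      unfolding rademacher_mean_def
      by (intro borel_measurable_divide borel_measurable_sum borel_measurable_const) (auto intro!: meas comp sg(2))
    show ?thesis
      unfolding PN by (rule nn_integral_distr[OF \<tau>m]) (use measurable_compose[OF RM measurable_ennreal] in simp)
  qed
  also have "\<dots> = (\<integral>\<^sup>+\<omega>. ennreal (4 * rademacher_mean L (\<lambda>\<epsilon>. S \<epsilon> \<omega>)) \<partial>M)"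
  proof (rule nn_integral_cong)
    fix \<omega>
    have "rademacher_mean L (\<lambda>\<epsilon>. S (\<lambda>l. 2 * \<epsilon> l) \<omega>) = rademacher_mean L (\<lambda>\<epsilon>. 4 * S \<epsilon> \<omega>)"
      by (rule rademacher_mean_cong) (rule twice)
    then show "ennreal (rademacher_mean L (\<lambda>\<epsilon>. sign_process D L x (\<lambda>_. 0) (\<lambda>l. 2 * \<epsilon> l) (\<tau> \<omega>))) = ennreal (4 * rademacher_mean L (\<lambda>\<epsilon>. S \<epsilon> \<omega>))"
      by (simp add: S\<tau> rademacher_mean_cmult)
  qed
  finally have le: "(\<integral>\<^sup>+\<omega>. ennreal (S (\<lambda>_. 1) \<omega>) \<partial>M) \<le> (\<integral>\<^sup>+\<omega>. ennreal (4 * rademacher_mean L (\<lambda>\<epsilon>. S \<epsilon> \<omega>)) \<partial>M)" .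
  have nn2: "0 \<le> rademacher_mean L (\<lambda>\<epsilon>. S \<epsilon> \<omega>)" for \<omega>
    unfolding rademacher_mean_def by (intro divide_nonneg_nonneg sum_nonneg Snn) (auto intro: sg(1))
  have "ennreal (expectation (S (\<lambda>_. 1))) = (\<integral>\<^sup>+\<omega>. ennreal (S (\<lambda>_. 1) \<omega>) \<partial>M)"
    using int1 Snn[of "\<lambda>_. 1"] by (intro nn_integral_eq_integral[symmetric]) auto
  also have "\<dots> \<le> ennreal (expectation (\<lambda>\<omega>. 4 * rademacher_mean L (\<lambda>\<epsilon>. S \<epsilon> \<omega>)))"
    using le int2 nn2 by (subst (asm) (2) nn_integral_eq_integral) auto
  finally show "expectation (S (\<lambda>_. 1)) \<le> 4 * expectation (\<lambda>\<omega>. rademacher_mean L (\<lambda>\<epsilon>. S \<epsilon> \<omega>))"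
    using nn2 by (simp add: ennreal_le_iff integral_nonneg_AE)
qed

section \<open>Sums of independent centred random operators\<close>

lemma lipschitz_borel_measurable:
  fixes g :: "real \<Rightarrow> real"
  assumes "\<And>t t'. \<bar>g t - g t'\<bar> \<le> B * \<bar>t - t'\<bar>" "0 \<le> B"
  shows "g \<in> borel_measurable borel"
proof -
  have "B-lipschitz_on UNIV g" using assms by (intro lipschitz_onI) (auto simp: dist_real_def)
  then show ?thesis by (intro borel_measurable_continuous_onI lipschitz_on_continuous_on)
qed

text \<open>
  Symmetrization, followed by the estimate for Rademacher sums at each outcome.  Both sides of the
  latter are \<open>0\<close> when all norms vanish; otherwise \<open>W \<ge> V\<close>, so the logarithm is nonnegative, and
  \<open>ln t \<le> t\<close> bounds the right-hand side by a multiple of \<open>W\<close>.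
\<close>

theorem (in finite_measure) random_operator_second_moment:
  fixes T :: "nat \<Rightarrow> real \<Rightarrow> ('a \<Rightarrow> real) \<Rightarrow> 'a \<Rightarrow> real" and k :: "nat \<Rightarrow> real \<Rightarrow> 'a \<Rightarrow> 'a \<Rightarrow> real"
    and \<mu> :: "nat \<Rightarrow> 'w \<Rightarrow> real"
  assumes P: "prob_space P" and L: "finite L" "L \<noteq> {}"
    and indep: "prob_space.indep_vars P (\<lambda>_. borel) \<mu> L"
    and T: "\<And>l t. l \<in> L \<Longrightarrow> has_bounded_kernel M (T l t) (k l t) B"
    and lip: "\<And>l t t' x y. l \<in> L \<Longrightarrow> x \<in> space M \<Longrightarrow> y \<in> space M \<Longrightarrow> \<bar>k l t x y - k l t' x y\<bar> \<le> B * \<bar>t - t'\<bar>"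
    and B: "0 \<le> B"
    and zero: "\<And>l d. l \<in> L \<Longrightarrow> d \<in> L2_test_pairs M \<Longrightarrow> (\<integral>\<omega>. L2_inner M (T l (\<mu> l \<omega>) (fst d)) (snd d) \<partial>P) = 0"
    and onb: "L2_onb M E"
  defines "V \<equiv> \<lambda>\<omega>. \<Sum>l\<in>L. (L2_onorm M (T l (\<mu> l \<omega>)))\<^sup>2"
    and "W \<equiv> \<lambda>\<omega>. \<Sum>l\<in>L. \<Sum>\<^sub>\<infinity>e\<in>E. (L2_norm M (T l (\<mu> l \<omega>) e))\<^sup>2"
  defines "lhs \<equiv> \<lambda>\<omega>. (L2_onorm M (\<lambda>f x. \<Sum>l\<in>L. T l (\<mu> l \<omega>) f x))\<^sup>2"
    and "rhs \<equiv> \<lambda>\<omega>. if V \<omega> = 0 then 0 else (ln (W \<omega> / V \<omega>) + 2.7) * V \<omega>"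
  shows "integrable P lhs" and "integrable P rhs"
    and "(\<integral>\<omega>. lhs \<omega> \<partial>P) \<le> 8 * (\<integral>\<omega>. rhs \<omega> \<partial>P)"
proof -
  interpret P: prob_space P by fact
  let ?D = "L2_test_pairs M"
  let ?m = "measure M (space M)"
  define K where "K = B * ?m"
  have K0: "0 \<le> K" using B by (simp add: K_def)
  define x where "x l t d = L2_inner M (T l t (fst d)) (snd d)" for l t d
  define a where "a l t = L2_onorm M (T l t)" for l t
  define h where "h l t = sqrt (\<Sum>\<^sub>\<infinity>e\<in>E. (L2_norm M (T l t e))\<^sup>2)" for l t
  have a0: "0 \<le> a l t" and aK: "a l t \<le> K" if "l \<in> L" for l t
    using L2_onorm_nonneg[OF T[OF that]] L2_onorm_le[OF T[OF that] K0[unfolded K_def] kernel_op_norm_le[OF T[OF that] _ B]]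
    by (auto simp: a_def K_def)
  have h2: "(h l t)\<^sup>2 = (\<Sum>\<^sub>\<infinity>e\<in>E. (L2_norm M (T l t e))\<^sup>2)" for l t
    unfolding h_def by (rule real_sqrt_pow2) (auto intro: infsum_nonneg)
  have hK: "(h l t)\<^sup>2 \<le> K\<^sup>2" if "l \<in> L" for l t
    unfolding h2 K_def by (rule infsum_hs_le[OF T[OF that] onb])
  have ah: "(a l t)\<^sup>2 \<le> (h l t)\<^sup>2" if "l \<in> L" for l t
    unfolding h2 a_def by (rule L2_onorm_power2_le_hs[OF T[OF that] onb])
  have Bt: "0 \<le> B * \<bar>t - t'\<bar>" for t t' using B by simp
  have pert: "B * \<bar>t - t'\<bar> * ?m = K * \<bar>t - t'\<bar>" for t t' by (simp add: K_def)
  have alip: "\<bar>a l t - a l t'\<bar> \<le> K * \<bar>t - t'\<bar>" if "l \<in> L" for l t t'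
    using kernel_perturbation(1)[OF T[OF that] T[OF that] lip[OF that] Bt] unfolding a_def pert .
  have hlip: "\<bar>h l t - h l t'\<bar> \<le> K * \<bar>t - t'\<bar>" if "l \<in> L" for l t t'
    using kernel_perturbation(3)[OF T[OF that] T[OF that] lip[OF that] Bt onb] unfolding h_def pert .
  have xlip: "\<bar>x l t d - x l t' d\<bar> \<le> K * \<bar>t - t'\<bar>" if "l \<in> L" "d \<in> ?D" for l t t' d
    using kernel_perturbation(2)[OF T[OF that(1)] T[OF that(1)] lip[OF that(1)] Bt that(2)] unfolding x_def pert .
  have xa: "\<bar>x l t d\<bar> \<le> a l t" if "l \<in> L" "d \<in> ?D" for l t d
    unfolding x_def a_def by (rule test_pair_inner_le[OF T[OF that(1)] that(2)])
  have xK: "\<bar>x l t d\<bar> \<le> K" if "l \<in> L" "d \<in> ?D" for l t d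
    using xa[OF that, of t] aK[OF that(1), of t] by linarith
  have D: "?D \<noteq> {}" using zero_test_pair by blast
  have rv: "\<mu> l \<in> borel_measurable P" if "l \<in> L" for l
    using indep that by (auto simp: P.indep_vars_def)
  have xzero: "P.expectation (\<lambda>\<omega>. x l (\<mu> l \<omega>) d) = 0" if "l \<in> L" "d \<in> ?D" for l d
    unfolding x_def by (rule zero[OF that])
  define S where "S c \<omega> = sup_square ?D (\<lambda>d. \<Sum>l\<in>L. c l * x l (\<mu> l \<omega>) d)" for c \<omega>
  have symm: "integrable P (S (\<lambda>_. 1))" "integrable P (\<lambda>\<omega>. rademacher_mean L (\<lambda>\<epsilon>. S \<epsilon> \<omega>))"
    "P.expectation (S (\<lambda>_. 1)) \<le> 4 * P.expectation (\<lambda>\<omega>. rademacher_mean L (\<lambda>\<epsilon>. S \<epsilon> \<omega>))"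
    unfolding S_def[abs_def] using xK xlip xzero
    by (intro P.symmetrization[OF L indep D, where x = x and B = K]; blast)+
  \<comment> \<open>The unsigned process is the squared norm of the sum of the operators.\<close>
  have lhs_S: "lhs \<omega> = S (\<lambda>_. 1) \<omega>" for \<omega>
  proof -
    have sum: "has_bounded_kernel M (\<lambda>f x. \<Sum>l\<in>L. T l (\<mu> l \<omega>) f x) (\<lambda>x y. \<Sum>l\<in>L. k l (\<mu> l \<omega>) x y) (\<Sum>l\<in>L. B)"
      by (rule has_bounded_kernel_sum) (rule T)
    have "L2_inner M (\<lambda>y. \<Sum>l\<in>L. T l (\<mu> l \<omega>) (fst d) y) (snd d) = (\<Sum>l\<in>L. 1 * x l (\<mu> l \<omega>) d)" if "d \<in> ?D" for d
      unfolding x_def using that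
      by (subst L2_inner_sum_left) (auto simp: L2_test_pairs_def intro: kernel_op_L2[OF T])
    then show ?thesis
      unfolding lhs_def S_def sup_square_def L2_onorm_power2_eq_SUP[OF sum] by (intro SUP_cong) simp_all
  qed
  have int_lhs: "integrable P lhs" using symm(1) unfolding lhs_S[abs_def] .
  then show "integrable P lhs" .
  have VW: "V \<omega> = (\<Sum>l\<in>L. (a l (\<mu> l \<omega>))\<^sup>2)" "W \<omega> = (\<Sum>l\<in>L. (h l (\<mu> l \<omega>))\<^sup>2)" for \<omega>
    by (simp_all add: V_def W_def a_def h2)
  have V0: "0 \<le> V \<omega>" for \<omega> unfolding VW by (rule sum_nonneg) simp
  have V_le_W: "V \<omega> \<le> W \<omega>" for \<omega> unfolding VW by (rule sum_mono) (rule ah)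
  have W_le: "W \<omega> \<le> (\<Sum>l\<in>L. K\<^sup>2)" for \<omega> unfolding VW by (rule sum_mono) (rule hK)
  have am: "(\<lambda>\<omega>. a l (\<mu> l \<omega>)) \<in> borel_measurable P" if "l \<in> L" for l
    by (rule measurable_compose[OF rv[OF that] lipschitz_borel_measurable[OF alip[OF that] K0]])
  have hm: "(\<lambda>\<omega>. h l (\<mu> l \<omega>)) \<in> borel_measurable P" if "l \<in> L" for l
    by (rule measurable_compose[OF rv[OF that] lipschitz_borel_measurable[OF hlip[OF that] K0]])
  have [measurable]: "V \<in> borel_measurable P" "W \<in> borel_measurable P"
    unfolding VW[abs_def] by (intro borel_measurable_sum borel_measurable_power am hm; assumption)+
  have rhs_meas: "rhs \<in> borel_measurable P" unfolding rhs_def by measurable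
  have rhs0: "0 \<le> rhs \<omega>" for \<omega>
  proof (cases "V \<omega> = 0")
    case False
    then have "V \<omega> > 0" using V0[of \<omega>] by linarith
    then have "1 \<le> W \<omega> / V \<omega>" using V_le_W[of \<omega>] by simp
    then have "0 \<le> ln (W \<omega> / V \<omega>)" by (rule ln_ge_zero)
    then show ?thesis using V0[of \<omega>] by (simp add: rhs_def)
  qed (simp add: rhs_def)
  have rhs_le: "rhs \<omega> \<le> 4 * (\<Sum>l\<in>L. K\<^sup>2)" for \<omega>
  proof (cases "V \<omega> = 0")
    case True
    then show ?thesis by (simp add: rhs_def)
  next
    case False
    then have V: "V \<omega> > 0" using V0[of \<omega>] by linarith
    then have "W \<omega> / V \<omega> > 0" using V_le_W[of \<omega>] by simp
    then have "ln (W \<omega> / V \<omega>) \<le> W \<omega> / V \<omega>" using ln_le_minus_one[of "W \<omega> / V \<omega>"] by linarith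
    then have "(ln (W \<omega> / V \<omega>) + 2.7) * V \<omega> \<le> (W \<omega> / V \<omega> + 3) * V \<omega>" using V by (intro mult_right_mono) auto
    also have "\<dots> = W \<omega> + 3 * V \<omega>" using V by (simp add: field_simps)
    also have "\<dots> \<le> 4 * (\<Sum>l\<in>L. K\<^sup>2)" using V_le_W[of \<omega>] W_le[of \<omega>] by linarith
    finally show ?thesis using False by (simp add: rhs_def)
  qed
  show int_rhs: "integrable P rhs"
    by (rule P.integrable_const_bound[OF AE_I2 rhs_meas]) (use rhs0 rhs_le in simp)
  have key: "rademacher_mean L (\<lambda>\<epsilon>. S \<epsilon> \<omega>) \<le> 2 * rhs \<omega>" for \<omega>
  proof (cases "V \<omega> = 0")
    case False
    then have V: "V \<omega> > 0" using V0[of \<omega>] by linarith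
    have "rademacher_mean L (\<lambda>\<epsilon>. S \<epsilon> \<omega>) \<le> 2 * V \<omega> * ln (4 * (W \<omega> / V \<omega>))"
      unfolding S_def sup_square_def x_def V_def W_def
      by (rule rademacher_onorm_second_moment[OF L(1) T onb]) (use V in \<open>auto simp: V_def\<close>)
    also have "ln (4 * (W \<omega> / V \<omega>)) = ln 4 + ln (W \<omega> / V \<omega>)"
      using V V_le_W[of \<omega>] by (intro ln_mult_pos) auto
    also have "ln 4 + ln (W \<omega> / V \<omega>) \<le> 2.7 + ln (W \<omega> / V \<omega>)"
    proof -
      have "ln (2 * 2 :: real) = ln 2 + ln 2" by (rule ln_mult_pos) auto
      then show ?thesis using ln_le_minus_one[of "2 :: real"] by simp
    qed
    finally show ?thesis using V by (simp add: rhs_def mult_ac add.commute)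
  next
    case True
    then have "a l (\<mu> l \<omega>) = 0" if "l \<in> L" for l
      using that L(1) unfolding VW by (simp add: sum_nonneg_eq_0_iff)
    then have "x l (\<mu> l \<omega>) d = 0" if "l \<in> L" "d \<in> ?D" for l d using xa[OF that, of "\<mu> l \<omega>"] that(1) by simp
    then have "S \<epsilon> \<omega> = 0" for \<epsilon> unfolding S_def sup_square_def using D by (simp cong: SUP_cong_simp)
    then show ?thesis using True by (simp add: rhs_def rademacher_mean_const[OF L(1)])
  qed
  have "(\<integral>\<omega>. lhs \<omega> \<partial>P) \<le> 4 * (\<integral>\<omega>. rademacher_mean L (\<lambda>\<epsilon>. S \<epsilon> \<omega>) \<partial>P)"
    using symm(3) unfolding lhs_S[abs_def] .
  also have "(\<integral>\<omega>. rademacher_mean L (\<lambda>\<epsilon>. S \<epsilon> \<omega>) \<partial>P) \<le> (\<integral>\<omega>. 2 * rhs \<omega> \<partial>P)"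
    using symm(2) int_rhs key by (intro integral_mono) auto
  finally show "(\<integral>\<omega>. lhs \<omega> \<partial>P) \<le> 8 * (\<integral>\<omega>. rhs \<omega> \<partial>P)" by simp
qed

section \<open>Products of absolutely continuous functions\<close>

text \<open>
  The increments are \<open>o(y - x)\<close>, so \<open>G\<close> has derivative zero everywhere.  This is how identities between
  absolutely continuous functions are obtained below from estimates of their increments, at points
  where the functions themselves need not be differentiable.
\<close>

lemma vanishing_increment_imp_constant:
  fixes G W :: "real \<Rightarrow> real"
  assumes W: "continuous_on {a..b} W" and "a \<le> b"
    and inc: "\<And>x y. a \<le> x \<Longrightarrow> x \<le> y \<Longrightarrow> y \<le> b \<Longrightarrow> \<bar>G y - G x\<bar> \<le> (y - x) * (W y - W x)"
    and x: "x \<in> {a..b}"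
  shows "G x = G a"
proof -
  have "(G has_field_derivative 0) (at x within {a..b})" if x: "x \<in> {a..b}" for x
    unfolding has_field_derivative_iff
  proof (rule Lim_null_comparison)
    show "\<forall>\<^sub>F y in at x within {a..b}. norm ((G y - G x) / (y - x)) \<le> \<bar>W y - W x\<bar>"
    proof (rule eventually_at_topological[THEN iffD2], intro exI[of _ UNIV] conjI ballI impI)
      fix y assume y: "y \<noteq> x" "y \<in> {a..b}"
      have "\<bar>G y - G x\<bar> \<le> \<bar>y - x\<bar> * \<bar>W y - W x\<bar>"
      proof (cases "x \<le> y")
        case True
        then have "\<bar>G y - G x\<bar> \<le> (y - x) * (W y - W x)" using inc x y by auto
        also have "\<dots> \<le> \<bar>y - x\<bar> * \<bar>W y - W x\<bar>" by (simp add: abs_mult[symmetric])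
        finally show ?thesis .
      next
        case False
        then have "\<bar>G x - G y\<bar> \<le> (x - y) * (W x - W y)" using inc x y by auto
        also have "\<dots> \<le> \<bar>x - y\<bar> * \<bar>W x - W y\<bar>" by (simp add: abs_mult[symmetric])
        finally show ?thesis by (simp add: abs_minus_commute)
      qed
      then show "norm ((G y - G x) / (y - x)) \<le> \<bar>W y - W x\<bar>"
        using y(1) by (simp add: pos_divide_le_eq mult.commute)
    qed auto
    have "(W \<longlongrightarrow> W x) (at x within {a..b})" using W x by (simp add: continuous_on_def)
    then have "((\<lambda>y. \<bar>W y - W x\<bar>) \<longlongrightarrow> \<bar>W x - W x\<bar>) (at x within {a..b})" by (intro tendsto_intros)
    then show "((\<lambda>y. \<bar>W y - W x\<bar>) \<longlongrightarrow> 0) (at x within {a..b})" by simp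
  qed
  then obtain c where "\<forall>x\<in>{a..b}. G x = c"
    using has_field_derivative_zero_constant[of "{a..b}" G] by auto
  then show ?thesis using x \<open>a \<le> b\<close> by auto
qed

lemma integral_increment:
  fixes f :: "real \<Rightarrow> real"
  assumes "f integrable_on {a..b}" "a \<le> x" "x \<le> y" "y \<le> b"
  shows "integral {a..y} f - integral {a..x} f = integral {x..y} f"
proof -
  have "f integrable_on {a..y}" using assms by (auto intro: integrable_on_subinterval)
  from Henstock_Kurzweil_Integration.integral_combine[OF assms(2,3) this] show ?thesis by simp
qed

lemma has_L1_deriv_on_absolutely_integrable:
  "has_L1_deriv_on f f' a b \<Longrightarrow> f' absolutely_integrable_on {a..b}"
  unfolding has_L1_deriv_on_def by blast

lemma has_L1_deriv_on_integrable: "has_L1_deriv_on f f' a b \<Longrightarrow> f' integrable_on {a..b}"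
  using has_L1_deriv_on_absolutely_integrable unfolding absolutely_integrable_on_def by blast

lemma has_L1_deriv_on_eq: "has_L1_deriv_on f f' a b \<Longrightarrow> x \<in> {a..b} \<Longrightarrow> f x = f a + integral {a..x} f'"
  unfolding has_L1_deriv_on_def by blast

lemma has_L1_deriv_on_increment:
  assumes "has_L1_deriv_on f f' a b" "a \<le> x" "x \<le> y" "y \<le> b"
  shows "f y - f x = integral {x..y} f'"
  using integral_increment[OF has_L1_deriv_on_integrable[OF assms(1)] assms(2-4)]
    has_L1_deriv_on_eq[OF assms(1), of x] has_L1_deriv_on_eq[OF assms(1), of y] assms(2-4) by simp

lemma has_L1_deriv_on_continuous:
  assumes "has_L1_deriv_on f f' a b"
  shows "continuous_on {a..b} f"
proof -
  have "continuous_on {a..b} (\<lambda>x. f a + integral {a..x} f')"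
    by (intro continuous_intros indefinite_integral_continuous_1 has_L1_deriv_on_integrable[OF assms])
  then show ?thesis by (rule continuous_on_eq) (rule has_L1_deriv_on_eq[OF assms, symmetric])
qed

lemma continuous_on_interval_bounded:
  fixes f :: "real \<Rightarrow> real"
  assumes "continuous_on {a..b} f"
  obtains B where "\<forall>x\<in>{a..b}. \<bar>f x\<bar> \<le> B"
proof -
  have "bounded (f ` {a..b})" by (intro compact_imp_bounded compact_continuous_image assms compact_Icc)
  then obtain B where "\<forall>y\<in>f ` {a..b}. \<bar>y\<bar> \<le> B" unfolding bounded_real ..
  then have "\<forall>x\<in>{a..b}. \<bar>f x\<bar> \<le> B" by blast
  then show ?thesis by (rule that)
qed

lemma absolutely_integrable_continuous_mult:
  fixes f g :: "real \<Rightarrow> real"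
  assumes "continuous_on {a..b} f" "g absolutely_integrable_on {a..b}"
  shows "(\<lambda>x. f x * g x) absolutely_integrable_on {a..b}"
proof (rule absolutely_integrable_bounded_measurable_product_real[OF _ _ _ assms(2)])
  show "f \<in> borel_measurable (lebesgue_on {a..b})"
    using assms(1) by (intro continuous_imp_measurable_on_sets_lebesgue) auto
  show "bounded (f ` {a..b})"
    by (intro compact_imp_bounded compact_continuous_image assms(1)) auto
qed simp

text \<open>
  The increment over \<open>[x, y]\<close> of the difference of both sides is the integral of
  \<open>(u y - u z) f' z + u' z (f x - f z)\<close>, which is at most \<open>2 K (y - x)\<close> times the integral of \<open>\<bar>f'\<bar>\<close>; here \<open>K\<close>
  is a Lipschitz constant of \<open>u\<close>.
\<close>

theorem has_L1_deriv_on_mult: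
  assumes u: "has_L1_deriv_on u u' a b" and f: "has_L1_deriv_on f f' a b"
    and K: "\<And>x. x \<in> {a..b} \<Longrightarrow> \<bar>u' x\<bar> \<le> K" and "a \<le> b"
  shows "has_L1_deriv_on (\<lambda>x. u x * f x) (\<lambda>x. u x * f' x + u' x * f x) a b"
proof -
  let ?h = "\<lambda>x. u x * f' x + u' x * f x"
  have cu: "continuous_on {a..b} u" and cf: "continuous_on {a..b} f"
    using u f by (auto intro: has_L1_deriv_on_continuous)
  have ai: "u' absolutely_integrable_on {a..b}" "f' absolutely_integrable_on {a..b}"
    using u f by (auto intro: has_L1_deriv_on_absolutely_integrable)
  have h1: "(\<lambda>x. u x * f' x) absolutely_integrable_on {a..b}"
    by (rule absolutely_integrable_continuous_mult[OF cu ai(2)])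
  have h2: "(\<lambda>x. u' x * f x) absolutely_integrable_on {a..b}"
    using absolutely_integrable_continuous_mult[OF cf ai(1)] by (simp add: mult.commute)
  have h: "?h absolutely_integrable_on {a..b}" using h1 h2 by (rule set_integral_add(1))
  have hi: "?h integrable_on {a..b}" using h by (simp add: absolutely_integrable_on_def)
  define W where "W x = 2 * K * integral {a..x} (\<lambda>x. \<bar>f' x\<bar>)" for x
  have absf: "(\<lambda>x. \<bar>f' x\<bar>) integrable_on {a..b}" using ai(2) by (simp add: absolutely_integrable_on_def)
  have "continuous_on {a..b} W"
    unfolding W_def by (intro continuous_intros indefinite_integral_continuous_1 absf)
  moreover define G where "G x = u x * f x - integral {a..x} ?h" for x
  have inc: "\<bar>G y - G x\<bar> \<le> (y - x) * (W y - W x)" if xy: "a \<le> x" "x \<le> y" "y \<le> b" for x y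
  proof -
    have sub: "{x..y} \<subseteq> {a..b}" using xy by auto
    have K0: "0 \<le> K" using K[of x] xy by (auto intro: order_trans[OF abs_ge_zero])
    have ii: "g integrable_on {x..y}" if "g absolutely_integrable_on {a..b}" for g :: "real \<Rightarrow> real"
      using absolutely_integrable_on_subinterval[OF that sub] by (simp add: absolutely_integrable_on_def)
    have absf': "(\<lambda>x. \<bar>f' x\<bar>) integrable_on {x..y}" by (rule integrable_on_subinterval[OF absf sub])
    define I where "I = integral {x..y} (\<lambda>x. \<bar>f' x\<bar>)"
    have du: "\<bar>u y - u z\<bar> \<le> K * (y - x)" if "z \<in> {x..y}" for z
    proof -
      have z: "a \<le> z" "z \<le> y" using that xy by auto
      have "\<bar>u y - u z\<bar> = norm (integral {z..y} u')"
        using has_L1_deriv_on_increment[OF u z xy(3)] by simp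
      also have "\<dots> \<le> integral {z..y} (\<lambda>_. K)"
        using z xy K absolutely_integrable_on_subinterval[OF ai(1), of z y]
        by (intro Henstock_Kurzweil_Integration.integral_norm_bound_integral) (auto simp: absolutely_integrable_on_def)
      also have "\<dots> \<le> K * (y - x)" using that K0 by (simp add: mult.commute mult_left_mono)
      finally show ?thesis .
    qed
    have df: "\<bar>f x - f z\<bar> \<le> I" if "z \<in> {x..y}" for z
    proof -
      have z: "x \<le> z" "z \<le> b" "z \<le> y" using that xy by auto
      have sz: "{x..z} \<subseteq> {x..y}" using z by auto
      have "\<bar>f x - f z\<bar> = norm (integral {x..z} f')"
        using has_L1_deriv_on_increment[OF f xy(1) z(1,2)] by (simp add: abs_minus_commute)
      also have "\<dots> \<le> integral {x..z} (\<lambda>x. \<bar>f' x\<bar>)"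
        by (intro Henstock_Kurzweil_Integration.integral_norm_bound_integral integrable_on_subinterval[OF ii[OF ai(2)] sz] integrable_on_subinterval[OF absf' sz]) simp
      also have "\<dots> \<le> I" unfolding I_def
        by (rule integral_subset_le[OF sz]) (auto intro: integrable_on_subinterval[OF absf' sz] absf')
      finally show ?thesis .
    qed
    have ii1: "(\<lambda>z. u y * f' z) integrable_on {x..y}" "(\<lambda>z. f x * u' z) integrable_on {x..y}"
      using ii[OF ai(1)] ii[OF ai(2)] by (auto intro: integrable_on_mult_right)
    have "u y * f y - u x * f x = u y * (f y - f x) + f x * (u y - u x)" by (simp add: algebra_simps)
    also have "\<dots> = u y * integral {x..y} f' + f x * integral {x..y} u'"
      using has_L1_deriv_on_increment[OF u xy] has_L1_deriv_on_increment[OF f xy] by simp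
    also have "\<dots> = integral {x..y} (\<lambda>z. u y * f' z + f x * u' z)"
      using ii1 by (simp add: Henstock_Kurzweil_Integration.integral_add)
    finally have "G y - G x = integral {x..y} (\<lambda>z. u y * f' z + f x * u' z) - integral {x..y} ?h"
      using integral_increment[OF hi xy] by (simp add: G_def)
    also have "\<dots> = integral {x..y} (\<lambda>z. (u y * f' z + f x * u' z) - ?h z)"
      by (rule Henstock_Kurzweil_Integration.integral_diff[symmetric])
        (intro integrable_add ii1, rule ii[OF h])
    finally have eq: "G y - G x = integral {x..y} (\<lambda>z. (u y * f' z + f x * u' z) - ?h z)" .
    have "norm (integral {x..y} (\<lambda>z. (u y * f' z + f x * u' z) - ?h z)) \<le> integral {x..y} (\<lambda>z. K * (y - x) * \<bar>f' z\<bar> + K * I)"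
    proof (rule Henstock_Kurzweil_Integration.integral_norm_bound_integral)
      show "(\<lambda>z. (u y * f' z + f x * u' z) - ?h z) integrable_on {x..y}"
        by (intro integrable_diff integrable_add ii1) (use ii[OF h1] ii[OF h2] in auto)
      show "(\<lambda>z. K * (y - x) * \<bar>f' z\<bar> + K * I) integrable_on {x..y}"
        using absf' by (intro integrable_add integrable_on_mult_right) auto
      fix z assume z: "z \<in> {x..y}"
      have "(u y * f' z + f x * u' z) - ?h z = (u y - u z) * f' z + u' z * (f x - f z)"
        by (simp add: algebra_simps)
      also have "\<bar>\<dots>\<bar> \<le> K * (y - x) * \<bar>f' z\<bar> + K * I"
        by (rule order_trans[OF abs_triangle_ineq add_mono]; unfold abs_mult)
          (use du[OF z] df[OF z] K[of z] z sub K0 in \<open>auto intro!: mult_right_mono mult_mono\<close>)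
      finally show "norm ((u y * f' z + f x * u' z) - ?h z) \<le> K * (y - x) * \<bar>f' z\<bar> + K * I" by simp
    qed
    also have "\<dots> = K * (y - x) * I + K * I * (y - x)"
      using xy by (subst Henstock_Kurzweil_Integration.integral_add) (auto intro: integrable_on_mult_right absf' simp: I_def)
    also have "\<dots> = (y - x) * (W y - W x)"
    proof -
      have "W y - W x = 2 * K * I"
        using integral_increment[OF absf xy] unfolding W_def I_def by (simp flip: right_diff_distrib)
      then show ?thesis by simp
    qed
    finally show ?thesis unfolding eq by simp
  qed
  ultimately have "G x = G a" if "x \<in> {a..b}" for x
    using vanishing_increment_imp_constant[OF _ \<open>a \<le> b\<close> inc that] by blast
  then have eq: "x \<in> {a..b} \<Longrightarrow> G x = G a" for x .
  show ?thesis unfolding has_L1_deriv_on_def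
  proof (intro conjI ballI h)
    fix x assume "x \<in> {a..b}"
    from eq[OF this] show "u x * f x = u a * f a + integral {a..x} ?h" by (simp add: G_def)
  qed
qed

text \<open>
  By the mean value theorem the increment of \<open>exp (t x)\<close> is \<open>exp (t p)\<close> times that of \<open>t\<close> for some
  intermediate \<open>p\<close>, so the two sides differ over \<open>[x, y]\<close> by at most a constant times \<open>(y - x)\<^sup>2\<close>.
\<close>

theorem has_L1_deriv_on_exp:
  assumes t: "has_L1_deriv_on t t' a b" and K: "\<And>x. x \<in> {a..b} \<Longrightarrow> \<bar>t' x\<bar> \<le> K" and "a \<le> b"
  shows "has_L1_deriv_on (\<lambda>x. exp (t x)) (\<lambda>x. exp (t x) * t' x) a b"
proof -
  let ?h = "\<lambda>x. exp (t x) * t' x"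
  have ct: "continuous_on {a..b} t" using t by (rule has_L1_deriv_on_continuous)
  have ai: "t' absolutely_integrable_on {a..b}" using t by (rule has_L1_deriv_on_absolutely_integrable)
  have h: "?h absolutely_integrable_on {a..b}"
    by (intro absolutely_integrable_continuous_mult continuous_intros ct ai)
  have hi: "?h integrable_on {a..b}" using h by (simp add: absolutely_integrable_on_def)
  obtain T where T': "\<forall>x\<in>{a..b}. \<bar>t x\<bar> \<le> T" using continuous_on_interval_bounded[OF ct] .
  have T: "t x \<le> T" if "x \<in> {a..b}" for x by (rule abs_le_D1) (use T' that in blast)
  have K0: "0 \<le> K" using K[of a] \<open>a \<le> b\<close> by (auto intro: order_trans[OF abs_ge_zero])
  define E where "E = exp T * K"
  have E0: "0 \<le> E" using K0 by (simp add: E_def)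
  define W where "W x = K * E * x" for x
  define G where "G x = exp (t x) - integral {a..x} ?h" for x
  have inc: "\<bar>G y - G x\<bar> \<le> (y - x) * (W y - W x)" if xy: "a \<le> x" "x \<le> y" "y \<le> b" for x y
  proof -
    have sub: "{x..y} \<subseteq> {a..b}" using xy by auto
    have ii: "t' integrable_on {x..y}" "?h integrable_on {x..y}"
      using absolutely_integrable_on_subinterval[OF ai sub] absolutely_integrable_on_subinterval[OF h sub]
      by (simp_all add: absolutely_integrable_on_def)
    have dt: "\<bar>t q - t p\<bar> \<le> K * (y - x)" if pq: "x \<le> p" "p \<le> q" "q \<le> y" for p q
    proof -
      have "\<bar>t q - t p\<bar> = norm (integral {p..q} t')"
        using has_L1_deriv_on_increment[OF t, of p q] pq xy by simp
      also have "\<dots> \<le> integral {p..q} (\<lambda>_. K)"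
        using pq xy K absolutely_integrable_on_subinterval[OF ai, of p q]
        by (intro Henstock_Kurzweil_Integration.integral_norm_bound_integral) (auto simp: absolutely_integrable_on_def)
      also have "\<dots> \<le> K * (y - x)" using pq K0 by (simp add: mult.commute mult_left_mono)
      finally show ?thesis .
    qed
    have dexp: "\<bar>exp (t p) - exp (t q)\<bar> \<le> E * (y - x)" if "p \<in> {x..y}" "q \<in> {x..y}" for p q
    proof -
      have "\<bar>t p - t q\<bar> \<le> K * (y - x)"
        using dt[of p q] dt[of q p] that by (cases "p \<le> q") (auto simp: abs_minus_commute)
      moreover have "\<bar>exp (t p) - exp (t q)\<bar> \<le> exp T * \<bar>t p - t q\<bar>"
      proof -
        have e: "exp c - exp d \<le> exp T * (c - d)" if "d \<le> c" "c \<le> T" for c d :: real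
        proof -
          have "1 + (d - c) \<le> exp (d - c)" by (rule exp_ge_add_one_self)
          then have "exp c * (1 + (d - c)) \<le> exp c * exp (d - c)" by (intro mult_left_mono) auto
          then have "exp c - exp d \<le> exp c * (c - d)" by (simp add: exp_diff algebra_simps)
          also have "\<dots> \<le> exp T * (c - d)" using that by (intro mult_right_mono) auto
          finally show ?thesis .
        qed
        have "t p \<le> T" "t q \<le> T" using T that sub by auto
        then show ?thesis using e[of "t p" "t q"] e[of "t q" "t p"]
          by (cases "t p \<le> t q") (auto simp: abs_if)
      qed
      ultimately have "\<bar>exp (t p) - exp (t q)\<bar> \<le> exp T * (K * (y - x))"
        by (meson exp_ge_zero mult_left_mono order_trans)
      then show ?thesis by (simp add: E_def mult.assoc)
    qed
    \<comment> \<open>mean value: the difference quotient of the exponential is attained on the range of \<open>t\<close>\<close>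
    obtain \<zeta> where \<zeta>: "exp (t y) - exp (t x) = \<zeta> * (t y - t x)" and \<zeta>b: "\<And>z. z \<in> {x..y} \<Longrightarrow> \<bar>\<zeta> - exp (t z)\<bar> \<le> E * (y - x)"
    proof -
      obtain w where w: "w \<in> closed_segment (t x) (t y)" and eq: "exp (t y) - exp (t x) = exp w * (t y - t x)"
      proof (cases "t x = t y")
        case True
        then show ?thesis using that[of "t x"] by simp
      next
        case False
        then consider "t x < t y" | "t y < t x" by linarith
        then show ?thesis
        proof cases
          case 1
          from MVT2[OF 1, of exp exp] obtain w where "t x < w" "w < t y" "exp (t y) - exp (t x) = (t y - t x) * exp w"
            by (auto intro: DERIV_exp)
          then show ?thesis using that[of w] 1 by (simp add: closed_segment_eq_real_ivl mult.commute)
        next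
          case 2
          from MVT2[OF 2, of exp exp] obtain w where "t y < w" "w < t x" "exp (t x) - exp (t y) = (t x - t y) * exp w"
            by (auto intro: DERIV_exp)
          then show ?thesis using that[of w] 2 by (simp add: closed_segment_eq_real_ivl algebra_simps)
        qed
      qed
      have "closed_segment (t x) (t y) \<subseteq> t ` {x..y}"
      proof -
        have "connected (t ` {x..y})" by (intro connected_continuous_image continuous_on_subset[OF ct sub]) simp
        then have "is_interval (t ` {x..y})" by (simp add: is_interval_connected_1)
        moreover have "t x \<in> t ` {x..y}" "t y \<in> t ` {x..y}" using xy by auto
        ultimately show ?thesis by (meson closed_segment_subset is_interval_convex)
      qed
      then obtain p where p: "p \<in> {x..y}" "w = t p" using w by auto
      show ?thesis
        by (rule that[of "exp w"]) (use eq p dexp in auto)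
    qed
    have "G y - G x = \<zeta> * (t y - t x) - integral {x..y} ?h"
      using integral_increment[OF hi xy] \<zeta> by (simp add: G_def)
    also have "\<dots> = integral {x..y} (\<lambda>z. \<zeta> * t' z) - integral {x..y} ?h"
      using has_L1_deriv_on_increment[OF t xy] by simp
    also have "\<dots> = integral {x..y} (\<lambda>z. \<zeta> * t' z - ?h z)"
      by (rule Henstock_Kurzweil_Integration.integral_diff[symmetric]) (use ii in \<open>auto intro: integrable_on_mult_right\<close>)
    finally have eq: "G y - G x = integral {x..y} (\<lambda>z. \<zeta> * t' z - ?h z)" .
    have "norm (integral {x..y} (\<lambda>z. \<zeta> * t' z - ?h z)) \<le> integral {x..y} (\<lambda>z. E * (y - x) * K)"
    proof (rule Henstock_Kurzweil_Integration.integral_norm_bound_integral)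
      show "(\<lambda>z. \<zeta> * t' z - ?h z) integrable_on {x..y}" using ii by (intro integrable_diff integrable_on_mult_right) auto
      fix z assume z: "z \<in> {x..y}"
      have "\<zeta> * t' z - ?h z = (\<zeta> - exp (t z)) * t' z" by (simp add: algebra_simps)
      also have "\<bar>\<dots>\<bar> \<le> E * (y - x) * K"
        unfolding abs_mult using \<zeta>b[OF z] K[of z] z sub E0 xy by (intro mult_mono) auto
      finally show "norm (\<zeta> * t' z - ?h z) \<le> E * (y - x) * K" by simp
    qed auto
    also have "\<dots> = (y - x) * (W y - W x)" using xy by (simp add: W_def algebra_simps)
    finally show ?thesis unfolding eq by simp
  qed
  have "continuous_on {a..b} W" unfolding W_def by (intro continuous_intros)
  then have "G x = G a" if "x \<in> {a..b}" for x
    using vanishing_increment_imp_constant[OF _ \<open>a \<le> b\<close> inc that] by blast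
  then have eq: "x \<in> {a..b} \<Longrightarrow> G x = G a" for x .
  show ?thesis unfolding has_L1_deriv_on_def
  proof (intro conjI ballI h)
    fix x assume "x \<in> {a..b}"
    from eq[OF this] show "exp (t x) = exp (t a) + integral {a..x} ?h" by (simp add: G_def)
  qed
qed

section \<open>The transport operator as an integral operator\<close>

text \<open>
  The Green function of \<open>\<mu> \<partial>\<psi> + \<psi> = q\<close> with the inflow condition, \<open>a\<close> and \<open>b\<close> being optical depths
  of the observer and the source.
\<close>

definition slab_kernel :: "real \<Rightarrow> real \<Rightarrow> real \<Rightarrow> real" where
  "slab_kernel \<mu> a b = (if 0 < \<mu> \<and> b \<le> a \<or> \<mu> < 0 \<and> a \<le> b then exp (- \<bar>a - b\<bar> / \<bar>\<mu>\<bar>) / \<bar>\<mu>\<bar> else 0)"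

locale transport_medium =
  fixes xL xR :: real and \<sigma>S \<sigma>T :: "real \<Rightarrow> real"
  assumes xLR: "xL < xR"
    and \<sigma>S_measurable: "\<sigma>S \<in> borel_measurable (lebesgue_on {xL..xR})"
    and \<sigma>T_measurable: "\<sigma>T \<in> borel_measurable (lebesgue_on {xL..xR})"
    and \<sigma>S_bounds: "\<exists>c C. 0 < c \<and> (\<forall>x\<in>{xL..xR}. c \<le> \<sigma>S x \<and> \<sigma>S x \<le> C)"
    and \<sigma>T_bounds: "\<exists>c C. 0 < c \<and> (\<forall>x\<in>{xL..xR}. c \<le> \<sigma>T x \<and> \<sigma>T x \<le> C)"
begin

abbreviation "H \<equiv> transport_measure xL xR \<sigma>T"
abbreviation "\<sigma>r \<equiv> reduced_cross_section xL xR \<sigma>S \<sigma>T"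

definition albedo :: "real \<Rightarrow> real" where "albedo y = \<sigma>r y / \<sigma>T y"
text \<open>
  The optical depth; as a coordinate it turns \<open>\<mu> \<partial>\<^sub>x + \<sigma>\<^sub>T\<close> into a multiple of \<open>\<mu> \<partial> + 1\<close>.
\<close>

definition depth :: "real \<Rightarrow> real" where "depth x = integral {xL..x} \<sigma>T"

definition sweep_integrand :: "real \<Rightarrow> (real \<Rightarrow> real) \<Rightarrow> real \<Rightarrow> real" where
  "sweep_integrand \<mu> \<phi> y = exp (depth y / \<mu>) * (\<sigma>r y * \<phi> y / \<mu>)"

text \<open>
  The solution obtained with the integrating factor \<open>exp (depth / \<mu>)\<close>.  For \<open>\<mu> < 0\<close> the constant is
  chosen such that the solution vanishes at \<open>xR\<close>.
\<close>

definition sweep :: "real \<Rightarrow> (real \<Rightarrow> real) \<Rightarrow> real \<Rightarrow> real" where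
  "sweep \<mu> \<phi> x = exp (- depth x / \<mu>) * ((if \<mu> > 0 then 0 else - integral {xL..xR} (sweep_integrand \<mu> \<phi>))
     + integral {xL..x} (sweep_integrand \<mu> \<phi>))"

lemma \<sigma>T_upper: obtains C where "0 < C" "\<forall>x\<in>{xL..xR}. \<bar>\<sigma>T x\<bar> \<le> C"
proof -
  obtain c C where c: "0 < c" "\<And>x. x \<in> {xL..xR} \<Longrightarrow> c \<le> \<sigma>T x \<and> \<sigma>T x \<le> C" using \<sigma>T_bounds by blast
  have "\<bar>\<sigma>T x\<bar> \<le> C" if "x \<in> {xL..xR}" for x using c(1) c(2)[OF that] by auto
  moreover have "0 < C" using c(1) c(2)[of xL] xLR by auto
  ultimately show ?thesis using that by blast
qed

lemma \<sigma>T_pos: "x \<in> {xL..xR} \<Longrightarrow> 0 < \<sigma>T x"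
  using \<sigma>T_bounds by force

lemma \<sigma>T_absolutely_integrable: "\<sigma>T absolutely_integrable_on {xL..xR}"
proof -
  obtain C where "\<forall>x\<in>{xL..xR}. \<bar>\<sigma>T x\<bar> \<le> C" by (rule \<sigma>T_upper)
  then show ?thesis
    by (intro measurable_bounded_by_integrable_imp_absolutely_integrable[OF \<sigma>T_measurable, of "\<lambda>_. C"]) auto
qed

lemma depth_deriv: "has_L1_deriv_on depth \<sigma>T xL xR"
  unfolding has_L1_deriv_on_def depth_def using \<sigma>T_absolutely_integrable by simp

lemma depth_continuous: "continuous_on {xL..xR} depth"
  by (rule has_L1_deriv_on_continuous[OF depth_deriv])

lemma depth_strict_mono:
  assumes "xL \<le> x" "x < y" "y \<le> xR"
  shows "depth x < depth y"
proof -
  obtain c where c: "0 < c" "\<And>x. x \<in> {xL..xR} \<Longrightarrow> c \<le> \<sigma>T x" using \<sigma>T_bounds by blast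
  have sub: "{x..y} \<subseteq> {xL..xR}" using assms by auto
  have "integral {x..y} (\<lambda>_. c) \<le> integral {x..y} \<sigma>T"
    by (rule integral_le) (use c(2) sub integrable_on_subinterval[OF has_L1_deriv_on_integrable[OF depth_deriv] sub] in auto)
  moreover have "integral {x..y} (\<lambda>_. c) > 0" using assms c(1) by simp
  moreover have "depth y - depth x = integral {x..y} \<sigma>T"
    by (rule has_L1_deriv_on_increment[OF depth_deriv]) (use assms in auto)
  ultimately show ?thesis by linarith
qed

lemma depth_le_iff: "x \<in> {xL..xR} \<Longrightarrow> y \<in> {xL..xR} \<Longrightarrow> depth x \<le> depth y \<longleftrightarrow> x \<le> y"
  using depth_strict_mono[of x y] depth_strict_mono[of y x] by force

lemma H_simps: "space H = {xL..xR}" "sets H = sets (lebesgue_on {xL..xR})"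
  by (simp_all add: transport_measure_def)

lemma H_measurable: "f \<in> borel_measurable H \<longleftrightarrow> f \<in> borel_measurable (lebesgue_on {xL..xR})"
  by (rule arg_cong[where f = "\<lambda>A. f \<in> A"], rule measurable_cong_sets) (simp_all add: H_simps)

lemma H_integrable:
  assumes "f \<in> borel_measurable H"
  shows "integrable H f \<longleftrightarrow> integrable (lebesgue_on {xL..xR}) (\<lambda>x. \<sigma>T x * f x)"
proof -
  have "AE x in lebesgue_on {xL..xR}. 0 \<le> \<sigma>T x" using \<sigma>T_pos by (intro AE_I2) (auto intro: less_imp_le)
  then show ?thesis unfolding transport_measure_def
    using assms \<sigma>T_measurable by (subst integrable_density) (auto simp: H_measurable)
qed

lemma H_integral:
  assumes "f \<in> borel_measurable H"
  shows "integral\<^sup>L H f = integral\<^sup>L (lebesgue_on {xL..xR}) (\<lambda>x. \<sigma>T x * f x)"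
proof -
  have "AE x in lebesgue_on {xL..xR}. 0 \<le> \<sigma>T x" using \<sigma>T_pos by (intro AE_I2) (auto intro: less_imp_le)
  then show ?thesis unfolding transport_measure_def
    using assms \<sigma>T_measurable by (subst integral_density) (auto simp: H_measurable)
qed

lemma integrable_lebesgue_on_iff: "integrable (lebesgue_on {a..b}) f \<longleftrightarrow> f absolutely_integrable_on {a..b::real}" for f :: "real \<Rightarrow> real"
  unfolding set_integrable_def by (subst integrable_restrict_space) auto

lemma finite_measure_H: "finite_measure H"
proof -
  have "integrable H (\<lambda>_. 1 :: real)"
    using \<sigma>T_absolutely_integrable by (subst H_integrable) (auto simp: integrable_lebesgue_on_iff)
  then show ?thesis
    by (intro finite_measureI) (auto simp: integrable_iff_bounded)
qed

lemma albedo_measurable: "albedo \<in> borel_measurable H"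
  unfolding H_measurable albedo_def[abs_def] reduced_cross_section_def[abs_def]
  using \<sigma>S_measurable \<sigma>T_measurable by (intro borel_measurable_divide borel_measurable_const)

lemma albedo_bounded: obtains R where "0 < R" "\<forall>x\<in>{xL..xR}. \<bar>albedo x\<bar> \<le> R"
proof -
  obtain c C where c: "0 < c" "\<And>x. x \<in> {xL..xR} \<Longrightarrow> c \<le> \<sigma>T x" using \<sigma>T_bounds by blast
  obtain d D where d: "0 < d" "\<And>x. x \<in> {xL..xR} \<Longrightarrow> d \<le> \<sigma>S x \<and> \<sigma>S x \<le> D" using \<sigma>S_bounds by blast
  let ?s = "\<bar>scattering_ratio xL xR \<sigma>S \<sigma>T\<bar>"
  have D0: "0 < D" using d(1) d(2)[of xL] xLR by auto
  have "\<bar>albedo x\<bar> \<le> D / ?s / c" if "x \<in> {xL..xR}" for x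
  proof -
    have "\<bar>albedo x\<bar> = \<bar>\<sigma>S x\<bar> / ?s / \<bar>\<sigma>T x\<bar>" by (simp only: albedo_def reduced_cross_section_def abs_divide)
    also have "\<dots> \<le> D / ?s / c"
      using c(1) c(2)[OF that] d(1) d(2)[OF that] by (intro frac_le divide_right_mono) auto
    finally show ?thesis .
  qed
  then have "\<bar>albedo x\<bar> \<le> D / ?s / c + 1" if "x \<in> {xL..xR}" for x using that by force
  moreover have "0 < D / ?s / c + 1" using D0 c(1) by (intro add_nonneg_pos) auto
  ultimately show ?thesis using that by blast
qed

lemma \<sigma>r_eq: "x \<in> {xL..xR} \<Longrightarrow> \<sigma>r x = albedo x * \<sigma>T x"
  using \<sigma>T_pos[of x] by (simp add: albedo_def)

lemma source_absolutely_integrable: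
  assumes "\<phi> \<in> L2 H"
  shows "(\<lambda>x. \<sigma>r x * \<phi> x) absolutely_integrable_on {xL..xR}"
proof -
  interpret finite_measure H by (rule finite_measure_H)
  obtain R where R: "\<forall>x\<in>{xL..xR}. \<bar>albedo x\<bar> \<le> R" by (rule albedo_bounded)
  have "integrable H \<phi>" by (rule integrable_L2[OF assms])
  then have "(\<lambda>x. \<sigma>T x * \<phi> x) absolutely_integrable_on {xL..xR}"
    using H_integrable[OF L2_measurable[OF assms]] by (simp add: integrable_lebesgue_on_iff)
  then have "(\<lambda>x. albedo x * (\<sigma>T x * \<phi> x)) absolutely_integrable_on {xL..xR}"
    by (rule absolutely_integrable_bounded_measurable_product_real[rotated -1])
      (use albedo_measurable R in \<open>auto simp: H_measurable bounded_iff\<close>)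
  then show ?thesis
    by (rule absolutely_integrable_spike[OF _ negligible_empty]) (auto simp: \<sigma>r_eq)
qed

lemma sweep_integrand_absolutely_integrable:
  assumes "\<phi> \<in> L2 H"
  shows "sweep_integrand \<mu> \<phi> absolutely_integrable_on {xL..xR}"
proof -
  have "(\<lambda>y. (exp (depth y / \<mu>) / \<mu>) * (\<sigma>r y * \<phi> y)) absolutely_integrable_on {xL..xR}"
    unfolding divide_inverse
    by (intro absolutely_integrable_continuous_mult source_absolutely_integrable assms continuous_intros depth_continuous)
  then show ?thesis by (simp add: sweep_integrand_def[abs_def] mult_ac)
qed

lemma depth_div_deriv: "has_L1_deriv_on (\<lambda>x. depth x * r) (\<lambda>x. \<sigma>T x * r) xL xR"
  unfolding has_L1_deriv_on_def
proof (intro conjI ballI)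
  show "(\<lambda>x. \<sigma>T x * r) absolutely_integrable_on {xL..xR}"
    using \<sigma>T_absolutely_integrable by (rule set_integrable_mult_left)
  fix x assume "x \<in> {xL..xR}"
  show "depth x * r = depth xL * r + integral {xL..x} (\<lambda>x. \<sigma>T x * r)"
    by (simp add: depth_def)
qed

lemma exp_depth_deriv: "has_L1_deriv_on (\<lambda>x. exp (depth x * r)) (\<lambda>x. exp (depth x * r) * (\<sigma>T x * r)) xL xR"
proof -
  obtain C where C: "0 < C" "\<forall>x\<in>{xL..xR}. \<bar>\<sigma>T x\<bar> \<le> C" by (rule \<sigma>T_upper)
  show ?thesis
    by (rule has_L1_deriv_on_exp[OF depth_div_deriv, where K = "C * \<bar>r\<bar>"])
      (use C xLR in \<open>auto simp: abs_mult intro!: mult_right_mono\<close>)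
qed

lemma exp_depth_deriv_bounded: obtains K where "\<And>x. x \<in> {xL..xR} \<Longrightarrow> \<bar>exp (depth x * r) * (\<sigma>T x * r)\<bar> \<le> K"
proof -
  obtain C where C: "0 < C" "\<forall>x\<in>{xL..xR}. \<bar>\<sigma>T x\<bar> \<le> C" by (rule \<sigma>T_upper)
  have "continuous_on {xL..xR} (\<lambda>x. exp (depth x * r))" by (intro continuous_intros depth_continuous)
  then obtain T where T: "\<forall>x\<in>{xL..xR}. \<bar>exp (depth x * r)\<bar> \<le> T"
    by (rule continuous_on_interval_bounded)
  have "\<bar>exp (depth x * r) * (\<sigma>T x * r)\<bar> \<le> T * (C * \<bar>r\<bar>)" if "x \<in> {xL..xR}" for x
    unfolding abs_mult using bspec[OF T that] bspec[OF C(2) that] C(1) order_trans[OF abs_ge_zero bspec[OF T that]]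
    by (intro mult_mono mult_right_mono) auto
  then show ?thesis using that by blast
qed

text \<open>
  Uniqueness: the product of \<open>\<psi>\<close> and the integrating factor has the derivative \<open>sweep_integrand \<mu> \<phi>\<close>
  almost everywhere, and the boundary condition fixes its initial value.
\<close>

lemma transport_solution_imp_sweep:
  assumes sol: "transport_solution xL xR \<sigma>T \<sigma>r \<mu> \<phi> \<psi>" and "\<mu> \<noteq> 0" and \<phi>: "\<phi> \<in> L2 H" and x: "x \<in> {xL..xR}"
  shows "\<psi> x = sweep \<mu> \<phi> x"
proof -
  obtain \<psi>' where \<psi>': "has_L1_deriv_on \<psi> \<psi>' xL xR"
    and ae: "AE x in lebesgue_on {xL..xR}. \<mu> * \<psi>' x + \<sigma>T x * \<psi> x = \<sigma>r x * \<phi> x"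
    and bc: "\<mu> > 0 \<longrightarrow> \<psi> xL = 0" "\<mu> < 0 \<longrightarrow> \<psi> xR = 0"
    using sol by (auto simp: transport_solution_def)
  let ?r = "1 / \<mu>"
  let ?u = "\<lambda>x. exp (depth x * ?r)"
  obtain K where K: "\<And>x. x \<in> {xL..xR} \<Longrightarrow> \<bar>?u x * (\<sigma>T x * ?r)\<bar> \<le> K" by (rule exp_depth_deriv_bounded[of ?r]) blast
  have prod: "has_L1_deriv_on (\<lambda>x. ?u x * \<psi> x) (\<lambda>x. ?u x * \<psi>' x + (?u x * (\<sigma>T x * ?r)) * \<psi> x) xL xR"
    using has_L1_deriv_on_mult[OF exp_depth_deriv \<psi>' K] xLR by simp
  have "AE x in lebesgue. x \<in> {xL..xR} \<longrightarrow> \<mu> * \<psi>' x + \<sigma>T x * \<psi> x = \<sigma>r x * \<phi> x"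
    using ae by (subst (asm) AE_restrict_space_iff) auto
  then obtain N where N: "{x. \<not> (x \<in> {xL..xR} \<longrightarrow> \<mu> * \<psi>' x + \<sigma>T x * \<psi> x = \<sigma>r x * \<phi> x)} \<subseteq> N" "N \<in> null_sets lebesgue"
    by (auto elim!: AE_E simp: null_sets_def)
  have eq: "integral {xL..z} (\<lambda>x. ?u x * \<psi>' x + (?u x * (\<sigma>T x * ?r)) * \<psi> x) = integral {xL..z} (sweep_integrand \<mu> \<phi>)"
    if z: "z \<in> {xL..xR}" for z
  proof (rule integral_spike)
    show "negligible N" using N(2) by (simp add: negligible_iff_null_sets)
    fix y assume y: "y \<in> {xL..z} - N"
    then have "\<mu> * \<psi>' y + \<sigma>T y * \<psi> y = \<sigma>r y * \<phi> y" using N(1) z by auto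
    then have "\<sigma>r y * \<phi> y / \<mu> = \<psi>' y + \<sigma>T y * ?r * \<psi> y" using \<open>\<mu> \<noteq> 0\<close> by (simp add: field_simps)
    then show "sweep_integrand \<mu> \<phi> y = ?u y * \<psi>' y + (?u y * (\<sigma>T y * ?r)) * \<psi> y"
      by (simp add: sweep_integrand_def algebra_simps)
  qed
  have d0: "depth xL = 0" by (simp add: depth_def)
  have u\<psi>: "?u z * \<psi> z = \<psi> xL + integral {xL..z} (sweep_integrand \<mu> \<phi>)" if "z \<in> {xL..xR}" for z
    using has_L1_deriv_on_eq[OF prod that] eq[OF that] by (simp add: d0)
  have inv: "exp (- depth z / \<mu>) * ?u z = 1" for z by (simp add: exp_minus field_simps flip: exp_add)
  have "\<psi> xL = (if \<mu> > 0 then 0 else - integral {xL..xR} (sweep_integrand \<mu> \<phi>))"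
    using bc u\<psi>[of xR] xLR \<open>\<mu> \<noteq> 0\<close> by (auto simp: not_less)
  then have "exp (- depth x / \<mu>) * (?u x * \<psi> x) = sweep \<mu> \<phi> x" by (simp only: u\<psi>[OF x] sweep_def)
  then show ?thesis using inv[of x] by (simp add: mult.assoc[symmetric])
qed

text \<open>
  Existence: the product rule for \<open>exp (- depth / \<mu>)\<close> and the indefinite integral of the source.
\<close>

lemma sweep_transport_solution:
  assumes "\<mu> \<noteq> 0" and \<phi>: "\<phi> \<in> L2 H" and eq: "\<And>x. x \<in> {xL..xR} \<Longrightarrow> \<psi> x = sweep \<mu> \<phi> x"
  shows "transport_solution xL xR \<sigma>T \<sigma>r \<mu> \<phi> \<psi>"
proof -
  let ?r = "- 1 / \<mu>"
  let ?g = "sweep_integrand \<mu> \<phi>"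
  let ?v = "\<lambda>x. exp (depth x * ?r)"
  define C where "C = (if \<mu> > 0 then 0 else - integral {xL..xR} ?g)"
  define F where "F x = C + integral {xL..x} ?g" for x
  have F: "has_L1_deriv_on F ?g xL xR"
    unfolding has_L1_deriv_on_def F_def using sweep_integrand_absolutely_integrable[OF \<phi>] by simp
  obtain K where K: "\<And>x. x \<in> {xL..xR} \<Longrightarrow> \<bar>?v x * (\<sigma>T x * ?r)\<bar> \<le> K" by (rule exp_depth_deriv_bounded[of ?r]) blast
  let ?\<psi>' = "\<lambda>x. ?v x * ?g x + (?v x * (\<sigma>T x * ?r)) * F x"
  have prod: "has_L1_deriv_on (\<lambda>x. ?v x * F x) ?\<psi>' xL xR"
    using has_L1_deriv_on_mult[OF exp_depth_deriv F K] xLR by simp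
  have \<psi>: "\<psi> x = ?v x * F x" if "x \<in> {xL..xR}" for x
    using eq[OF that] by (simp add: sweep_def F_def C_def)
  have "has_L1_deriv_on \<psi> ?\<psi>' xL xR"
    unfolding has_L1_deriv_on_def
  proof (intro conjI ballI has_L1_deriv_on_absolutely_integrable[OF prod])
    fix x assume x: "x \<in> {xL..xR}"
    have "\<psi> xL = ?v xL * F xL" by (rule \<psi>) (use xLR in simp)
    then show "\<psi> x = \<psi> xL + integral {xL..x} ?\<psi>'"
      using has_L1_deriv_on_eq[OF prod x] \<psi>[OF x] by simp
  qed
  moreover have "\<mu> * ?\<psi>' x + \<sigma>T x * \<psi> x = \<sigma>r x * \<phi> x" if "x \<in> {xL..xR}" for x
  proof -
    have "?v x * exp (depth x / \<mu>) = 1" by (simp flip: exp_add)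
    then have "\<mu> * (?v x * ?g x) = \<sigma>r x * \<phi> x"
      using \<open>\<mu> \<noteq> 0\<close> by (simp add: sweep_integrand_def flip: mult.assoc)
    moreover have "\<mu> * ((?v x * (\<sigma>T x * ?r)) * F x) = - (\<sigma>T x * \<psi> x)"
      using \<open>\<mu> \<noteq> 0\<close> by (simp add: \<psi>[OF that])
    moreover have gen: "m * (A + B) + C = D" if "m * A = D" "m * B = - C" for m A B C D :: real
      using that by (simp add: distrib_left)
    ultimately show ?thesis by (intro gen)
  qed
  then have "AE x in lebesgue_on {xL..xR}. \<mu> * ?\<psi>' x + \<sigma>T x * \<psi> x = \<sigma>r x * \<phi> x" by (intro AE_I2) simp
  moreover have "\<mu> > 0 \<longrightarrow> \<psi> xL = 0" "\<mu> < 0 \<longrightarrow> \<psi> xR = 0"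
    using \<psi>[of xL] \<psi>[of xR] xLR by (auto simp: F_def C_def)
  ultimately show ?thesis unfolding transport_solution_def by blast
qed

lemma transport_op_eq_sweep:
  assumes "\<mu> \<noteq> 0" "\<phi> \<in> L2 H"
  shows "transport_op xL xR \<sigma>S \<sigma>T \<mu> \<phi> = (\<lambda>x. if x \<in> {xL..xR} then sweep \<mu> \<phi> x else 0)"
  unfolding transport_op_def
proof (rule the_equality)
  show "transport_solution xL xR \<sigma>T \<sigma>r \<mu> \<phi> (\<lambda>x. if x \<in> {xL..xR} then sweep \<mu> \<phi> x else 0) \<and>
    (\<forall>x. x \<notin> {xL..xR} \<longrightarrow> (if x \<in> {xL..xR} then sweep \<mu> \<phi> x else 0) = 0)"
    using sweep_transport_solution[OF assms] by simp
  fix \<psi> assume "transport_solution xL xR \<sigma>T \<sigma>r \<mu> \<phi> \<psi> \<and> (\<forall>x. x \<notin> {xL..xR} \<longrightarrow> \<psi> x = 0)"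
  then show "\<psi> = (\<lambda>x. if x \<in> {xL..xR} then sweep \<mu> \<phi> x else 0)"
    using transport_solution_imp_sweep[OF _ assms] by auto
qed

lemma depth_measurable: "depth \<in> borel_measurable H"
  unfolding H_measurable by (intro continuous_imp_measurable_on_sets_lebesgue depth_continuous) simp

lemma slab_kernel_measurable [measurable]:
  "(\<lambda>(\<mu>, a, b). slab_kernel \<mu> a b) \<in> borel_measurable (borel \<Otimes>\<^sub>M borel \<Otimes>\<^sub>M borel)"
  unfolding slab_kernel_def[abs_def] by measurable

text \<open>
  The domain of integration in \<open>sweep\<close> is encoded by the support of the kernel, with \<open>x \<le> y\<close> expressed
  through the strictly increasing depth, and \<open>\<sigma>r = albedo \<cdot> \<sigma>T\<close> absorbs the weight of the measure.
\<close>

lemma transport_op_kernel: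
  assumes \<mu>: "\<mu> \<noteq> 0" and \<phi>: "\<phi> \<in> L2 H" and x: "x \<in> {xL..xR}"
  shows "transport_op xL xR \<sigma>S \<sigma>T \<mu> \<phi> x = (\<integral>y. slab_kernel \<mu> (depth x) (depth y) * albedo y * \<phi> y \<partial>H)"
proof -
  let ?k = "\<lambda>y. slab_kernel \<mu> (depth x) (depth y) * albedo y * \<phi> y"
  let ?g = "sweep_integrand \<mu> \<phi>"
  let ?J = "if \<mu> > 0 then {xL..x} else {x..xR}"
  let ?c = "(if \<mu> > 0 then 1 else - 1) * exp (- depth x / \<mu>)"
  note [measurable] = depth_measurable albedo_measurable L2_measurable[OF \<phi>]
  have km: "?k \<in> borel_measurable H" by measurable
  have ptw: "\<sigma>T y * ?k y = (if y \<in> ?J then ?c * ?g y else 0)" if y: "y \<in> {xL..xR}" for y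
  proof -
    have "depth y \<le> depth x \<longleftrightarrow> y \<le> x" "depth x \<le> depth y \<longleftrightarrow> x \<le> y" using depth_le_iff x y by auto
    moreover have "\<sigma>T y * albedo y = \<sigma>r y" using \<sigma>r_eq[OF y] by simp
    moreover have "exp (- (depth x - depth y) / \<mu>) = exp (- depth x / \<mu>) * exp (depth y / \<mu>)"
      by (simp add: diff_divide_distrib flip: exp_add)
    moreover have "exp (- ((depth x - depth y) / \<mu>)) = exp (- depth x / \<mu>) * exp (depth y / \<mu>)"
      by (simp add: diff_divide_distrib flip: exp_add)
    ultimately show ?thesis
      using \<mu> x y by (auto simp: slab_kernel_def sweep_integrand_def field_simps)
  qed
  have gi: "?g integrable_on {xL..xR}"
    using sweep_integrand_absolutely_integrable[OF \<phi>] by (simp add: absolutely_integrable_on_def)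
  have J: "?J \<subseteq> {xL..xR}" using x by auto
  have sub: "?g absolutely_integrable_on {c..d}" if "{c..d} \<subseteq> {xL..xR}" for c d
    by (rule absolutely_integrable_on_subinterval[OF sweep_integrand_absolutely_integrable[OF \<phi>] that])
  have "?g absolutely_integrable_on ?J"
    using sub[of xL x] sub[of x xR] x by (cases "\<mu> > 0") auto
  then have "(\<lambda>y. ?c * ?g y) absolutely_integrable_on ?J" by (rule set_integrable_mult_right)
  then have "(\<lambda>y. if y \<in> ?J then ?c * ?g y else 0) absolutely_integrable_on {xL..xR}"
    unfolding absolutely_integrable_restrict_UNIV[symmetric, of ?J]
    by (rule absolutely_integrable_on_subinterval) simp
  then have int: "integrable (lebesgue_on {xL..xR}) (\<lambda>y. \<sigma>T y * ?k y)"
    using ptw by (subst Bochner_Integration.integrable_cong[OF refl]) (auto simp: integrable_lebesgue_on_iff)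
  have "(\<integral>y. ?k y \<partial>H) = integral {xL..xR} (\<lambda>y. \<sigma>T y * ?k y)"
    unfolding H_integral[OF km] by (rule lebesgue_integral_eq_integral[OF int]) simp
  also have "\<dots> = integral {xL..xR} (\<lambda>y. if y \<in> ?J then ?c * ?g y else 0)"
    by (rule Henstock_Kurzweil_Integration.integral_cong) (rule ptw)
  also have "\<dots> = integral ?J (\<lambda>y. ?c * ?g y)" 
    by (simp only: Henstock_Kurzweil_Integration.integral_def integrable_on_def has_integral_restrict[OF J])
  also have "\<dots> = ?c * integral ?J ?g" by simp
  also have "\<dots> = sweep \<mu> \<phi> x"
    using integral_increment[OF gi, of x xR] x \<mu> by (auto simp: sweep_def algebra_simps)
  finally show ?thesis using x by (simp add: transport_op_eq_sweep[OF \<mu> \<phi>])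
qed

end

section \<open>The slab kernel as a function of the ordinate\<close>

lemma slab_kernel_bound: "0 < \<delta> \<Longrightarrow> \<delta> \<le> \<bar>\<mu>\<bar> \<Longrightarrow> \<bar>slab_kernel \<mu> a b\<bar> \<le> 1 / \<delta>"
proof -
  assume "0 < \<delta>" "\<delta> \<le> \<bar>\<mu>\<bar>"
  then have "\<bar>exp (- \<bar>a - b\<bar> / \<bar>\<mu>\<bar>) / \<bar>\<mu>\<bar>\<bar> \<le> 1 / \<delta>"
    unfolding abs_divide abs_exp_cancel abs_idempotent by (intro frac_le) auto
  then show ?thesis using \<open>0 < \<delta>\<close> by (simp only: slab_kernel_def split: if_split) simp
qed

text \<open>
  With \<open>z = 1 / \<bar>\<mu>\<bar>\<close> and \<open>D\<close> the distance in depth this function is the slab kernel.  The bound does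
  not depend on \<open>D\<close>, because \<open>v exp (- v) \<le> 1\<close>.
\<close>

lemma exp_times_lipschitz:
  fixes D z w :: real
  assumes "0 \<le> D" "0 \<le> z" "0 \<le> w"
  shows "\<bar>z * exp (- D * z) - w * exp (- D * w)\<bar> \<le> \<bar>z - w\<bar>"
proof -
  have main: "\<bar>z * exp (- D * z) - w * exp (- D * w)\<bar> \<le> w - z" if "0 \<le> z" "z \<le> w" for z w
  proof -
    have e: "exp (- D * w) \<le> exp (- D * z)" "exp (- D * z) \<le> 1" using that assms(1) by (auto intro: mult_left_mono)
    have "w * exp (- D * w) - z * exp (- D * z) \<le> w * exp (- D * z) - z * exp (- D * z)"
      using e(1) that by (intro diff_right_mono mult_left_mono) auto
    also have "\<dots> = (w - z) * exp (- D * z)" by (simp add: left_diff_distrib)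
    also have "\<dots> \<le> w - z" using e(2) that by (simp add: mult_left_le)
    finally have 1: "w * exp (- D * w) - z * exp (- D * z) \<le> w - z" .
    have "z * exp (- D * z) - w * exp (- D * w) \<le> z * exp (- D * z) - z * exp (- D * w)"
      using that by (intro diff_left_mono mult_right_mono) auto
    also have "\<dots> = z * exp (- D * z) * (1 - exp (- D * (w - z)))"
      by (simp add: right_diff_distrib mult.assoc flip: exp_add)
    also have "\<dots> \<le> z * exp (- D * z) * (D * (w - z))"
    proof (rule mult_left_mono)
      show "1 - exp (- D * (w - z)) \<le> D * (w - z)" using exp_ge_add_one_self[of "- D * (w - z)"] by simp
    qed (use that in auto)
    also have "\<dots> = (D * z * exp (- (D * z))) * (w - z)" by (simp add: mult_ac)
    also have "\<dots> \<le> 1 * (w - z)"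
    proof (rule mult_right_mono)
      have "D * z \<le> exp (D * z)" using exp_ge_add_one_self[of "D * z"] by linarith
      then show "D * z * exp (- (D * z)) \<le> 1" by (simp add: exp_minus pos_divide_le_eq divide_inverse[symmetric])
    qed (use that in auto)
    finally show ?thesis using 1 by (simp add: abs_le_iff)
  qed
  show ?thesis using main[OF assms(2), of w] main[OF assms(3), of z] by (cases "z \<le> w") (auto simp: abs_minus_commute)
qed

lemma slab_kernel_lipschitz:
  assumes "0 < \<delta>" "\<mu> \<le> - \<delta>" "\<mu>' \<le> - \<delta>"
  shows "\<bar>slab_kernel \<mu> a b - slab_kernel \<mu>' a b\<bar> \<le> \<bar>\<mu> - \<mu>'\<bar> / \<delta>\<^sup>2"
    and "\<bar>slab_kernel (- \<mu>) a b - slab_kernel (- \<mu>') a b\<bar> \<le> \<bar>\<mu> - \<mu>'\<bar> / \<delta>\<^sup>2"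
proof -
  have neg: "\<mu> < 0" "\<mu>' < 0" using assms by auto
  have "\<bar>inverse \<bar>\<mu>\<bar> * exp (- \<bar>a - b\<bar> * inverse \<bar>\<mu>\<bar>) - inverse \<bar>\<mu>'\<bar> * exp (- \<bar>a - b\<bar> * inverse \<bar>\<mu>'\<bar>)\<bar>
    \<le> \<bar>inverse \<bar>\<mu>\<bar> - inverse \<bar>\<mu>'\<bar>\<bar>"
    by (rule exp_times_lipschitz) auto
  also have "\<dots> = \<bar>\<mu> - \<mu>'\<bar> / (\<bar>\<mu>\<bar> * \<bar>\<mu>'\<bar>)"
  proof -
    have "inverse \<bar>\<mu>\<bar> - inverse \<bar>\<mu>'\<bar> = (\<mu> - \<mu>') / (\<bar>\<mu>\<bar> * \<bar>\<mu>'\<bar>)" using neg by (simp add: field_simps)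
    then show ?thesis by (simp add: abs_mult)
  qed
  also have "\<dots> \<le> \<bar>\<mu> - \<mu>'\<bar> / (\<delta> * \<delta>)" using assms by (intro divide_left_mono mult_mono mult_pos_pos) auto
  finally have *: "\<bar>exp (- \<bar>a - b\<bar> / \<bar>\<mu>\<bar>) / \<bar>\<mu>\<bar> - exp (- \<bar>a - b\<bar> / \<bar>\<mu>'\<bar>) / \<bar>\<mu>'\<bar>\<bar> \<le> \<bar>\<mu> - \<mu>'\<bar> / \<delta>\<^sup>2"
    by (simp add: divide_inverse power2_eq_square mult.commute)
  define e where "e c = exp (- \<bar>a - b\<bar> / \<bar>c\<bar>) / \<bar>c\<bar>" for c :: real
  have k: "slab_kernel c a b = (if a \<le> b then e c else 0)" "slab_kernel (- c) a b = (if b \<le> a then e c else 0)" if "c < 0" for c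
    using that by (simp_all add: slab_kernel_def e_def)
  have "\<bar>e \<mu> - e \<mu>'\<bar> \<le> \<bar>\<mu> - \<mu>'\<bar> / \<delta>\<^sup>2" using * by (simp only: e_def)
  then show "\<bar>slab_kernel \<mu> a b - slab_kernel \<mu>' a b\<bar> \<le> \<bar>\<mu> - \<mu>'\<bar> / \<delta>\<^sup>2"
    "\<bar>slab_kernel (- \<mu>) a b - slab_kernel (- \<mu>') a b\<bar> \<le> \<bar>\<mu> - \<mu>'\<bar> / \<delta>\<^sup>2"
    by (simp_all add: k[OF neg(1)] k[OF neg(2)])
qed

section \<open>The fluctuation of one symmetric pair of ordinates\<close>

lemma set_integral_uminus_image:
  fixes g :: "real \<Rightarrow> real"
  shows "(LBINT \<nu>:uminus ` I. g \<nu>) = (LBINT \<nu>:I. g (- \<nu>))"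
proof -
  have "(LBINT \<nu>:uminus ` I. g \<nu>) = \<bar>- 1\<bar> *\<^sub>R (\<integral>\<nu>. indicator (uminus ` I) (0 + - 1 * \<nu>) *\<^sub>R g (0 + - 1 * \<nu>) \<partial>lborel)"
    unfolding set_lebesgue_integral_def by (rule lborel_integral_real_affine) simp
  moreover have "indicator (uminus ` I) (- \<nu>) = (indicator I \<nu> :: real)" for \<nu>
    by (auto simp: indicator_def)
  ultimately show ?thesis by (simp add: set_lebesgue_integral_def)
qed

lemma uminus_image_borel:
  fixes I :: "real set"
  assumes "I \<in> sets borel"
  shows "uminus ` I \<in> sets borel"
proof -
  have "uminus ` I = uminus -` I \<inter> space borel" by force
  also have "\<dots> \<in> sets borel" by (rule measurable_sets[OF _ assms]) simp
  finally show ?thesis .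
qed

lemma measure_uminus_image:
  fixes I :: "real set"
  assumes "I \<in> sets borel"
  shows "measure lborel (uminus ` I) = measure lborel I"
  using set_integral_uminus_image[of I "\<lambda>_. 1"] assms uminus_image_borel[OF assms]
  by (simp add: set_lebesgue_integral_def)

lemma set_integral_restrict_space:
  fixes g :: "real \<Rightarrow> real"
  assumes "J \<in> sets borel"
  shows "(LBINT \<nu>:J. g \<nu>) = (\<integral>\<nu>. g \<nu> \<partial>restrict_space lborel J)"
  using assms by (simp add: set_lebesgue_integral_def integral_restrict_space)

definition slab_kernel_integral :: "real set \<Rightarrow> real \<Rightarrow> real \<Rightarrow> real" where
  "slab_kernel_integral J a b = (LBINT \<nu>:J. slab_kernel \<nu> a b)"

text \<open>
  The subinterval with index \<open>l\<close> of the negative half, together with its mirror image.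
\<close>

locale ordinate_cell = transport_medium +
  fixes \<delta> :: real and m :: nat and S :: "nat \<Rightarrow> real set" and l :: nat
  assumes \<delta>: "0 < \<delta>" "\<delta> < 1"
    and cell_borel: "S l \<in> sets borel"
    and cell_subset: "S l \<subseteq> {-1..<-\<delta>}"
    and mirror_cell: "S (2 * m + 1 - l) = uminus ` S l"
begin

abbreviation "I \<equiv> S l"
abbreviation "cell_scale \<equiv> real (2 * m) / measure lborel (ordinate_domain \<delta>)"
abbreviation "len \<equiv> measure lborel I"

text \<open>
  The kernel, up to the factor \<open>albedo\<close>, of the fluctuation of the \<open>l\<close>-th pair when the ordinate in
  the negative half is \<open>t\<close>.
\<close>

definition cell_kernel :: "real \<Rightarrow> real \<Rightarrow> real \<Rightarrow> real" where
  "cell_kernel t a b = 1/2 * (cell_scale * len * slab_kernel t a b - cell_scale * slab_kernel_integral I a b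
     + cell_scale * len * slab_kernel (- t) a b - cell_scale * slab_kernel_integral (uminus ` I) a b)"

lemma cell_finite: "emeasure lborel I < \<infinity>"
proof -
  have "emeasure lborel I \<le> emeasure lborel {-1..-\<delta>}" by (rule emeasure_mono) (use cell_subset in auto)
  also have "\<dots> < \<infinity>" by (simp add: emeasure_lborel_Icc_eq)
  finally show ?thesis .
qed

lemma mirror_finite: "emeasure lborel (uminus ` I) < \<infinity>"
proof -
  have "emeasure lborel (uminus ` I) \<le> emeasure lborel {\<delta>..1}" by (rule emeasure_mono) (use cell_subset in force)+
  also have "\<dots> < \<infinity>" by (simp add: emeasure_lborel_Icc_eq)
  finally show ?thesis .
qed

lemma restrict_lborel_finite:
  assumes "J \<in> sets borel" "emeasure lborel J < \<infinity>"
  shows "finite_measure (restrict_space lborel J)"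
  using assms by (intro finite_measureI) (simp add: emeasure_restrict_space space_restrict_space)

lemma slab_kernel_pair_measurable:
  assumes "f \<in> borel_measurable N" "g \<in> borel_measurable N" "h \<in> borel_measurable N"
  shows "(\<lambda>p. slab_kernel (f p) (g p) (h p)) \<in> borel_measurable N"
  using measurable_compose[OF measurable_Pair[OF assms(1) measurable_Pair[OF assms(2,3)]] slab_kernel_measurable] by simp

lemma slab_kernel_integral_measurable:
  assumes J: "J \<in> sets borel" and g: "g \<in> borel_measurable N" and h: "h \<in> borel_measurable N"
  shows "(\<lambda>p. slab_kernel_integral J (g p) (h p)) \<in> borel_measurable N"
  unfolding slab_kernel_integral_def set_lebesgue_integral_def
proof (rule lborel.borel_measurable_lebesgue_integral)
  have "(\<lambda>q. slab_kernel (snd q) (g (fst q)) (h (fst q))) \<in> borel_measurable (N \<Otimes>\<^sub>M lborel)"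
    by (intro slab_kernel_pair_measurable measurable_compose[OF measurable_fst g] measurable_compose[OF measurable_fst h]) measurable
  then show "(\<lambda>(p, \<nu>). indicator J \<nu> *\<^sub>R slab_kernel \<nu> (g p) (h p)) \<in> borel_measurable (N \<Otimes>\<^sub>M lborel)"
    using J unfolding case_prod_unfold by measurable
qed

lemma slab_kernel_integrable:
  assumes J: "J \<in> sets borel" "emeasure lborel J < \<infinity>" "\<And>\<nu>. \<nu> \<in> J \<Longrightarrow> \<delta> \<le> \<bar>\<nu>\<bar>"
  shows "integrable (restrict_space lborel J) (\<lambda>\<nu>. slab_kernel \<nu> a b)"
proof -
  interpret N: finite_measure "restrict_space lborel J" by (rule restrict_lborel_finite[OF J(1,2)])
  show ?thesis
  proof (rule N.integrable_const_bound[of _ "1 / \<delta>"])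
    show "AE \<nu> in restrict_space lborel J. norm (slab_kernel \<nu> a b) \<le> 1 / \<delta>"
      by (rule AE_I2) (use J(3) \<delta>(1) in \<open>auto simp: space_restrict_space intro!: slab_kernel_bound\<close>)
    show "(\<lambda>\<nu>. slab_kernel \<nu> a b) \<in> borel_measurable (restrict_space lborel J)"
      by (intro slab_kernel_pair_measurable measurable_restrict_space1) auto
  qed
qed

lemma slab_kernel_integral_bound:
  assumes J: "J \<in> sets borel" "emeasure lborel J < \<infinity>" "\<And>\<nu>. \<nu> \<in> J \<Longrightarrow> \<delta> \<le> \<bar>\<nu>\<bar>"
  shows "\<bar>slab_kernel_integral J a b\<bar> \<le> measure lborel J / \<delta>"
proof -
  interpret N: finite_measure "restrict_space lborel J" by (rule restrict_lborel_finite[OF J(1,2)])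
  have "norm (\<integral>\<nu>. slab_kernel \<nu> a b \<partial>restrict_space lborel J) \<le> (\<integral>\<nu>. 1 / \<delta> \<partial>restrict_space lborel J)"
    by (rule Bochner_Integration.integral_norm_bound_integral[OF slab_kernel_integrable[OF J]])
      (use J(3) \<delta>(1) in \<open>auto simp: space_restrict_space intro!: slab_kernel_bound\<close>)
  then show ?thesis using J(1)
    by (simp add: slab_kernel_integral_def set_integral_restrict_space measure_restrict_space space_restrict_space)
qed

lemma cell_distance: "\<nu> \<in> I \<Longrightarrow> \<delta> \<le> \<bar>\<nu>\<bar>" "\<nu> \<in> uminus ` I \<Longrightarrow> \<delta> \<le> \<bar>\<nu>\<bar>"
  using cell_subset by force+

lemmas cell_facts = cell_borel cell_finite cell_distance(1)
lemmas mirror_facts = uminus_image_borel[OF cell_borel] mirror_finite cell_distance(2)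

lemma cell_kernel_bound:
  assumes "\<delta> \<le> \<bar>t\<bar>"
  shows "\<bar>cell_kernel t a b\<bar> \<le> 2 * \<bar>cell_scale\<bar> * len / \<delta>"
proof -
  have k: "\<bar>cell_scale * len * slab_kernel t a b\<bar> \<le> \<bar>cell_scale\<bar> * len / \<delta>" "\<bar>cell_scale * len * slab_kernel (- t) a b\<bar> \<le> \<bar>cell_scale\<bar> * len / \<delta>"
    using mult_left_mono[OF slab_kernel_bound[OF \<delta>(1), of t a b], of "\<bar>cell_scale\<bar> * len"]
      mult_left_mono[OF slab_kernel_bound[OF \<delta>(1), of "- t" a b], of "\<bar>cell_scale\<bar> * len"] assms
    by (simp_all add: abs_mult)
  have i: "\<bar>cell_scale * slab_kernel_integral J a b\<bar> \<le> \<bar>cell_scale\<bar> * len / \<delta>" if "\<bar>slab_kernel_integral J a b\<bar> \<le> len / \<delta>" for J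
    using mult_left_mono[OF that, of "\<bar>cell_scale\<bar>"] by (simp add: abs_mult)
  have j: "\<bar>slab_kernel_integral I a b\<bar> \<le> len / \<delta>" "\<bar>slab_kernel_integral (uminus ` I) a b\<bar> \<le> len / \<delta>"
    using slab_kernel_integral_bound[OF cell_facts] slab_kernel_integral_bound[OF mirror_facts]
    by (simp_all add: measure_uminus_image[OF cell_borel])
  have "\<bar>p - q + r - u\<bar> \<le> 4 * B" if "\<bar>p\<bar> \<le> B" "\<bar>q\<bar> \<le> B" "\<bar>r\<bar> \<le> B" "\<bar>u\<bar> \<le> B" for p q r u B :: real
    using that by linarith
  from this[OF k(1) i[OF j(1)] k(2) i[OF j(2)]]
  show ?thesis unfolding cell_kernel_def abs_mult[of "1/2"] by simp
qed

lemma cell_kernel_lipschitz: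
  assumes "t \<le> - \<delta>" "t' \<le> - \<delta>"
  shows "\<bar>cell_kernel t a b - cell_kernel t' a b\<bar> \<le> \<bar>cell_scale\<bar> * len / \<delta>\<^sup>2 * \<bar>t - t'\<bar>"
proof -
  define p q where "p = slab_kernel t a b - slab_kernel t' a b" and "q = slab_kernel (- t) a b - slab_kernel (- t') a b"
  have pq: "\<bar>p\<bar> \<le> \<bar>t - t'\<bar> / \<delta>\<^sup>2" "\<bar>q\<bar> \<le> \<bar>t - t'\<bar> / \<delta>\<^sup>2"
    unfolding p_def q_def by (rule slab_kernel_lipschitz[OF \<delta>(1) assms])+
  have "cell_kernel t a b - cell_kernel t' a b = cell_scale * len * (1/2 * (p + q))"
    by (simp add: cell_kernel_def p_def q_def algebra_simps)
  also have "\<bar>\<dots>\<bar> = \<bar>cell_scale\<bar> * len * \<bar>1/2 * (p + q)\<bar>" by (simp only: abs_mult abs_of_nonneg[OF measure_nonneg])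
  also have "\<dots> \<le> \<bar>cell_scale\<bar> * len * (\<bar>t - t'\<bar> / \<delta>\<^sup>2)"
  proof (intro mult_left_mono mult_nonneg_nonneg)
    have "\<bar>1/2 * (p + q)\<bar> \<le> u" if "\<bar>p\<bar> \<le> u" "\<bar>q\<bar> \<le> u" for u
      using that by (simp add: abs_le_iff)
    then show "\<bar>1/2 * (p + q)\<bar> \<le> \<bar>t - t'\<bar> / \<delta>\<^sup>2" using pq by blast
  qed auto
  finally show ?thesis by (simp add: mult_ac)
qed

text \<open>
  The ordinate \<open>- t\<close> is uniform in the mirror image, over which the second average is taken.
\<close>

lemma cell_kernel_mean_zero: "(LBINT t:I. cell_kernel t a b) = 0"
proof -
  interpret N: finite_measure "restrict_space lborel I" by (rule restrict_lborel_finite[OF cell_facts(1,2)])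
  have i1: "integrable (restrict_space lborel I) (\<lambda>t. slab_kernel t a b)" by (rule slab_kernel_integrable[OF cell_facts])
  have i2: "integrable (restrict_space lborel I) (\<lambda>t. slab_kernel (- t) a b)"
  proof (rule N.integrable_const_bound[of _ "1 / \<delta>"])
    show "AE \<nu> in restrict_space lborel I. norm (slab_kernel (- \<nu>) a b) \<le> 1 / \<delta>"
      by (rule AE_I2) (use cell_distance(1) \<delta>(1) in \<open>auto simp: space_restrict_space intro!: slab_kernel_bound\<close>)
    show "(\<lambda>\<nu>. slab_kernel (- \<nu>) a b) \<in> borel_measurable (restrict_space lborel I)"
      by (intro slab_kernel_pair_measurable measurable_restrict_space1) auto
  qed
  have c1: "(\<integral>t. slab_kernel t a b \<partial>restrict_space lborel I) = slab_kernel_integral I a b"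
    by (simp add: slab_kernel_integral_def set_integral_restrict_space[OF cell_borel])
  have c2: "(\<integral>t. slab_kernel (- t) a b \<partial>restrict_space lborel I) = slab_kernel_integral (uminus ` I) a b"
    by (simp add: slab_kernel_integral_def set_integral_uminus_image set_integral_restrict_space[OF cell_borel])
  have "measure (restrict_space lborel I) (space (restrict_space lborel I)) = len"
    using cell_borel by (simp add: measure_restrict_space space_restrict_space)
  then show ?thesis
    unfolding set_integral_restrict_space[OF cell_borel] cell_kernel_def
    using i1 i2 by (simp add: c1 c2 algebra_simps)
qed

lemma weighted_integrable:
  assumes \<phi>: "\<phi> \<in> L2 H" and g: "g \<in> borel_measurable H" and B: "\<And>y. y \<in> {xL..xR} \<Longrightarrow> \<bar>g y\<bar> \<le> B"
  shows "integrable H (\<lambda>y. g y * (albedo y * \<phi> y))"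
proof -
  interpret finite_measure H by (rule finite_measure_H)
  obtain R where R: "0 < R" "\<forall>x\<in>{xL..xR}. \<bar>albedo x\<bar> \<le> R" by (rule albedo_bounded)
  show ?thesis
  proof (rule Bochner_Integration.integrable_bound)
    show "integrable H (\<lambda>y. B * R * \<phi> y)" using integrable_L2[OF \<phi>] by simp
    show "(\<lambda>y. g y * (albedo y * \<phi> y)) \<in> borel_measurable H"
      by (intro borel_measurable_times g albedo_measurable L2_measurable[OF \<phi>])
    show "AE y in H. norm (g y * (albedo y * \<phi> y)) \<le> norm (B * R * \<phi> y)"
    proof (rule AE_I2)
      fix y assume "y \<in> space H"
      then have y: "y \<in> {xL..xR}" by (simp add: H_simps)
      have "\<bar>g y\<bar> * \<bar>albedo y\<bar> \<le> B * R"
        using B[OF y] R(2) y by (intro mult_mono) (auto intro: order_trans[OF abs_ge_zero])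
      then have "\<bar>g y\<bar> * \<bar>albedo y\<bar> * \<bar>\<phi> y\<bar> \<le> \<bar>B * R\<bar> * \<bar>\<phi> y\<bar>" by (intro mult_right_mono) auto
      then show "norm (g y * (albedo y * \<phi> y)) \<le> norm (B * R * \<phi> y)" by (simp add: abs_mult mult.assoc)
    qed
  qed
qed

lemma albedo_integrable: "\<phi> \<in> L2 H \<Longrightarrow> integrable H (\<lambda>y. albedo y * \<phi> y)"
  using weighted_integrable[of \<phi> "\<lambda>_. 1" 1] by simp

lemma averaged_transport_kernel:
  assumes J: "J \<in> sets borel" "emeasure lborel J < \<infinity>" "\<And>\<nu>. \<nu> \<in> J \<Longrightarrow> \<delta> \<le> \<bar>\<nu>\<bar>"
    and \<phi>: "\<phi> \<in> L2 H" and x: "x \<in> {xL..xR}"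
  shows "(LBINT \<nu>:J. transport_op xL xR \<sigma>S \<sigma>T \<nu> \<phi> x) = (\<integral>y. slab_kernel_integral J (depth x) (depth y) * (albedo y * \<phi> y) \<partial>H)"
proof -
  let ?N = "restrict_space lborel J"
  have fin: "finite_measure ?N" by (rule restrict_lborel_finite[OF J(1,2)])
  have "(LBINT \<nu>:J. transport_op xL xR \<sigma>S \<sigma>T \<nu> \<phi> x) = (\<integral>\<nu>. (\<integral>y. slab_kernel \<nu> (depth x) (depth y) * (albedo y * \<phi> y) \<partial>H) \<partial>?N)"
    unfolding set_integral_restrict_space[OF J(1)]
  proof (rule Bochner_Integration.integral_cong[OF refl])
    fix \<nu> assume "\<nu> \<in> space ?N"
    then have "\<nu> \<noteq> 0" using J(3)[of \<nu>] \<delta>(1) by (auto simp: space_restrict_space)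
    then show "transport_op xL xR \<sigma>S \<sigma>T \<nu> \<phi> x = (\<integral>y. slab_kernel \<nu> (depth x) (depth y) * (albedo y * \<phi> y) \<partial>H)"
      by (simp add: transport_op_kernel[OF _ \<phi> x] mult.assoc)
  qed
  also have "\<dots> = (\<integral>y. (\<integral>\<nu>. slab_kernel \<nu> (depth x) (depth y) \<partial>?N) * (albedo y * \<phi> y) \<partial>H)"
  proof (rule bounded_kernel_Fubini(2)[OF fin finite_measure_H _ _ albedo_integrable[OF \<phi>], where C = "1 / \<delta>"])
    have "(\<lambda>p. slab_kernel (fst p) (depth x) (depth (snd p))) \<in> borel_measurable (?N \<Otimes>\<^sub>M H)"
      by (intro slab_kernel_pair_measurable measurable_compose[OF measurable_fst measurable_restrict_space1]
          measurable_compose[OF measurable_snd depth_measurable]) auto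
    then show "(\<lambda>(\<nu>, y). slab_kernel \<nu> (depth x) (depth y)) \<in> borel_measurable (?N \<Otimes>\<^sub>M H)"
      by (simp add: case_prod_unfold)
    show "\<bar>slab_kernel \<nu> (depth x) (depth y)\<bar> \<le> 1 / \<delta>" if "\<nu> \<in> space ?N" for \<nu> y
      using that J(3) \<delta>(1) by (intro slab_kernel_bound) (auto simp: space_restrict_space)
  qed
  also have "\<dots> = (\<integral>y. slab_kernel_integral J (depth x) (depth y) * (albedo y * \<phi> y) \<partial>H)"
    by (simp add: slab_kernel_integral_def set_integral_restrict_space[OF J(1)])
  finally show ?thesis .
qed

lemma depth_slab_measurable: "(\<lambda>y. slab_kernel t (depth x) (depth y)) \<in> borel_measurable H"
  by (intro slab_kernel_pair_measurable depth_measurable) auto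

lemma cell_kernel_measurable:
  assumes "f \<in> borel_measurable N" "g \<in> borel_measurable N" "h \<in> borel_measurable N"
  shows "(\<lambda>p. cell_kernel (f p) (g p) (h p)) \<in> borel_measurable N"
  unfolding cell_kernel_def
  by (intro borel_measurable_times borel_measurable_add borel_measurable_diff borel_measurable_const
      slab_kernel_pair_measurable slab_kernel_integral_measurable assms borel_measurable_uminus cell_facts(1) mirror_facts(1))

lemma delta_op_at_kernel:
  assumes t: "\<mu> l = t" "\<mu> (2 * m + 1 - l) = - t" "\<delta> \<le> \<bar>t\<bar>" and \<phi>: "\<phi> \<in> L2 H" and x: "x \<in> {xL..xR}"
  shows "delta_op_at (transport_op xL xR \<sigma>S \<sigma>T) \<delta> m S \<mu> l \<phi> x
    = (\<integral>y. cell_kernel t (depth x) (depth y) * (albedo y * \<phi> y) \<partial>H)"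
proof -
  let ?w = "\<lambda>y. albedo y * \<phi> y"
  have t0: "t \<noteq> 0" and t0': "- t \<noteq> 0" using t(3) \<delta>(1) by auto
  have i: "integrable H (\<lambda>y. slab_kernel s (depth x) (depth y) * ?w y)" if "\<delta> \<le> \<bar>s\<bar>" for s
    by (rule weighted_integrable[OF \<phi> depth_slab_measurable]) (rule slab_kernel_bound[OF \<delta>(1) that])
  have j: "integrable H (\<lambda>y. slab_kernel_integral J (depth x) (depth y) * ?w y)"
    if "J \<in> sets borel" "emeasure lborel J < \<infinity>" "\<And>\<nu>. \<nu> \<in> J \<Longrightarrow> \<delta> \<le> \<bar>\<nu>\<bar>" for J
    by (rule weighted_integrable[OF \<phi>])
      (rule slab_kernel_integral_measurable[OF that(1) _ depth_measurable], simp, rule slab_kernel_integral_bound[OF that])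
  have A: "transport_op xL xR \<sigma>S \<sigma>T s \<phi> x = (\<integral>y. slab_kernel s (depth x) (depth y) * ?w y \<partial>H)" if "s \<noteq> 0" for s
    by (simp add: transport_op_kernel[OF that \<phi> x] mult.assoc)
  let ?A1 = "\<integral>y. slab_kernel t (depth x) (depth y) * ?w y \<partial>H"
  let ?A2 = "\<integral>y. slab_kernel (- t) (depth x) (depth y) * ?w y \<partial>H"
  let ?B1 = "\<integral>y. slab_kernel_integral I (depth x) (depth y) * ?w y \<partial>H"
  let ?B2 = "\<integral>y. slab_kernel_integral (uminus ` I) (depth x) (depth y) * ?w y \<partial>H"
  have av: "(LBINT \<nu>:I. transport_op xL xR \<sigma>S \<sigma>T \<nu> \<phi> x) = ?B1"
    "(LBINT \<nu>:uminus ` I. transport_op xL xR \<sigma>S \<sigma>T \<nu> \<phi> x) = ?B2"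
    using averaged_transport_kernel[OF cell_facts \<phi> x] averaged_transport_kernel[OF mirror_facts \<phi> x] by blast+
  have "delta_op_at (transport_op xL xR \<sigma>S \<sigma>T) \<delta> m S \<mu> l \<phi> x
    = 1/2 * (cell_scale * len * ?A1 - cell_scale * ?B1 + cell_scale * len * ?A2 - cell_scale * ?B2)"
    unfolding delta_op_at_def sampled_op_def averaged_op_def ordinate_weight_def t(1,2) mirror_cell
      measure_uminus_image[OF cell_borel] A[OF t0] A[OF t0'] av by simp
  also have "\<dots> = (\<integral>y. 1/2 * (cell_scale * len * (slab_kernel t (depth x) (depth y) * ?w y) - cell_scale * (slab_kernel_integral I (depth x) (depth y) * ?w y)
     + cell_scale * len * (slab_kernel (- t) (depth x) (depth y) * ?w y) - cell_scale * (slab_kernel_integral (uminus ` I) (depth x) (depth y) * ?w y)) \<partial>H)"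
    using i[of t] i[of "- t"] j[OF cell_facts] j[OF mirror_facts] t(3)
    by (simp only: abs_minus_cancel integral_mult_right_zero Bochner_Integration.integral_add Bochner_Integration.integral_diff
        Bochner_Integration.integrable_add Bochner_Integration.integrable_diff integrable_mult_right simp_thms)
  also have "\<dots> = (\<integral>y. cell_kernel t (depth x) (depth y) * ?w y \<partial>H)"
    by (intro Bochner_Integration.integral_cong refl) (simp add: cell_kernel_def algebra_simps)
  finally show ?thesis .
qed

lemma cell_kernel_apply_mean_zero:
  assumes \<phi>: "\<phi> \<in> L2 H" and \<psi>: "\<psi> \<in> L2 H"
  shows "(LBINT t:I. (\<integral>x. (\<integral>y. cell_kernel t (depth x) (depth y) * (albedo y * \<phi> y) \<partial>H) * \<psi> x \<partial>H)) = 0"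
proof -
  interpret finite_measure H by (rule finite_measure_H)
  let ?N = "restrict_space lborel I"
  let ?w = "\<lambda>y. albedo y * \<phi> y"
  let ?G = "\<lambda>t x. \<integral>y. cell_kernel t (depth x) (depth y) * ?w y \<partial>H"
  let ?C = "2 * \<bar>cell_scale\<bar> * len / \<delta>"
  have fin: "finite_measure ?N" by (rule restrict_lborel_finite[OF cell_facts(1,2)])
  have idN: "(\<lambda>t. t) \<in> borel_measurable ?N" by (intro measurable_restrict_space1) simp
  have b: "\<bar>cell_kernel t a c\<bar> \<le> ?C" if "t \<in> space ?N" for t a c
    using that cell_distance(1) by (intro cell_kernel_bound) (auto simp: space_restrict_space)
  have km: "(\<lambda>y. cell_kernel t (depth x) (depth y)) \<in> borel_measurable H" for t x
    by (intro cell_kernel_measurable depth_measurable borel_measurable_const)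
  have G0: "(\<integral>t. ?G t x \<partial>?N) = 0" for x
  proof -
    have "(\<integral>t. ?G t x \<partial>?N) = (\<integral>y. (\<integral>t. cell_kernel t (depth x) (depth y) \<partial>?N) * ?w y \<partial>H)"
    proof (rule bounded_kernel_Fubini(2)[OF fin finite_measure_H _ _ albedo_integrable[OF \<phi>]])
      have "(\<lambda>p. cell_kernel (fst p) (depth x) (depth (snd p))) \<in> borel_measurable (?N \<Otimes>\<^sub>M H)"
        by (intro cell_kernel_measurable measurable_compose[OF measurable_fst idN] measurable_compose[OF measurable_snd depth_measurable] borel_measurable_const)
      then show "(\<lambda>(t, y). cell_kernel t (depth x) (depth y)) \<in> borel_measurable (?N \<Otimes>\<^sub>M H)" by (simp add: case_prod_unfold)
    qed (rule b)
    then show ?thesis using cell_kernel_mean_zero by (simp add: set_integral_restrict_space[OF cell_borel])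
  qed
  have "(\<integral>t. (\<integral>x. ?G t x * \<psi> x \<partial>H) \<partial>?N) = (\<integral>x. (\<integral>t. ?G t x \<partial>?N) * \<psi> x \<partial>H)"
  proof (rule bounded_kernel_Fubini(2)[OF fin finite_measure_H _ _ integrable_L2[OF \<psi>]])
    have "(\<lambda>p. \<integral>y. cell_kernel (fst p) (depth (snd p)) (depth y) * ?w y \<partial>H) \<in> borel_measurable (?N \<Otimes>\<^sub>M H)"
    proof (rule borel_measurable_lebesgue_integral)
      have "(\<lambda>q. cell_kernel (fst (fst q)) (depth (snd (fst q))) (depth (snd q))) \<in> borel_measurable ((?N \<Otimes>\<^sub>M H) \<Otimes>\<^sub>M H)"
        by (intro cell_kernel_measurable measurable_compose[OF measurable_fst measurable_compose[OF measurable_fst idN]]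
            measurable_compose[OF measurable_fst measurable_compose[OF measurable_snd depth_measurable]]
            measurable_compose[OF measurable_snd depth_measurable])
      moreover have "(\<lambda>q. ?w (snd q)) \<in> borel_measurable ((?N \<Otimes>\<^sub>M H) \<Otimes>\<^sub>M H)"
        by (intro borel_measurable_times measurable_compose[OF measurable_snd albedo_measurable] measurable_compose[OF measurable_snd L2_measurable[OF \<phi>]])
      ultimately show "(\<lambda>(p, y). cell_kernel (fst p) (depth (snd p)) (depth y) * ?w y) \<in> borel_measurable ((?N \<Otimes>\<^sub>M H) \<Otimes>\<^sub>M H)"
        unfolding case_prod_unfold by (rule borel_measurable_times)
    qed
    then show "(\<lambda>(t, x). ?G t x) \<in> borel_measurable (?N \<Otimes>\<^sub>M H)" by (simp add: case_prod_unfold)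
    fix t x assume t: "t \<in> space ?N"
    have "norm (?G t x) \<le> (\<integral>y. ?C * \<bar>?w y\<bar> \<partial>H)"
    proof (rule Bochner_Integration.integral_norm_bound_integral)
      show "integrable H (\<lambda>y. cell_kernel t (depth x) (depth y) * ?w y)"
        by (rule weighted_integrable[OF \<phi> km b[OF t]])
      show "integrable H (\<lambda>y. ?C * \<bar>?w y\<bar>)" using albedo_integrable[OF \<phi>] by (intro integrable_mult_right integrable_abs)
      show "norm (cell_kernel t (depth x) (depth y) * ?w y) \<le> ?C * \<bar>?w y\<bar>" for y
        unfolding real_norm_def abs_mult[of "cell_kernel t (depth x) (depth y)" "?w y"]
        by (rule mult_right_mono[OF b[OF t]]) simp
    qed
    then show "\<bar>?G t x\<bar> \<le> (\<integral>y. ?C * \<bar>?w y\<bar> \<partial>H)" by simp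
  qed
  then show ?thesis by (simp add: set_integral_restrict_space[OF cell_borel] G0)
qed

end

text \<open>
  The length of \<open>I\<close> is positive, because otherwise the uniform measure would vanish, while it is the
  law of a random variable here.
\<close>

lemma expectation_uniform_mean_zero:
  fixes I :: "real set"
  assumes P: "prob_space P" and X: "X \<in> borel_measurable P" and I: "I \<in> sets borel" "emeasure lborel I < \<infinity>"
    and distr: "distr P borel X = uniform_measure lborel I"
    and g: "g \<in> borel_measurable borel" and zero: "(LBINT t:I. g t) = (0::real)"
  shows "(\<integral>\<omega>. g (X \<omega>) \<partial>P) = 0"
proof -
  interpret prob_space P by fact
  define s where "s = measure lborel I"
  have s: "emeasure lborel I = ennreal s" using I(2) by (simp add: s_def emeasure_eq_ennreal_measure)
  have "prob_space (uniform_measure lborel I)" unfolding distr[symmetric] by (rule prob_space_distr[OF X])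
  have "emeasure lborel I \<noteq> 0"
  proof
    assume "emeasure lborel I = 0"
    then have ae: "AE t in lborel. t \<notin> I" using I(1) by (intro AE_not_in) (simp add: null_sets_def)
    have "(\<integral>\<^sup>+t. indicator I t / emeasure lborel I \<partial>lborel) = (\<integral>\<^sup>+(t::real). 0 \<partial>lborel)"
    proof (rule nn_integral_cong_AE)
      show "AE t in lborel. indicator I t / emeasure lborel I = 0" using ae by eventually_elim simp
    qed
    moreover have "emeasure (uniform_measure lborel I) UNIV = (\<integral>\<^sup>+t. indicator I t / emeasure lborel I \<partial>lborel)"
      using I(1) by (simp add: uniform_measure_def emeasure_density)
    moreover have "emeasure (uniform_measure lborel I) UNIV = 1"
      using prob_space.emeasure_space_1[OF \<open>prob_space (uniform_measure lborel I)\<close>] by simp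
    ultimately show False by simp
  qed
  then have s0: "s > 0" by (simp add: s s_def zero_less_measure_iff)
  have "uniform_measure lborel I = density lborel (\<lambda>t. ennreal (indicator I t / s))"
    unfolding uniform_measure_def s using I(1) s0
    by (intro density_cong) (auto simp: divide_ennreal[symmetric] ennreal_indicator)
  then have "(\<integral>t. g t \<partial>uniform_measure lborel I) = (\<integral>t. (indicator I t / s) *\<^sub>R g t \<partial>lborel)"
    using g I(1) s0 by (simp add: integral_density)
  also have "\<dots> = (LBINT t:I. g t) / s" by (simp add: set_lebesgue_integral_def)
  finally have "(\<integral>t. g t \<partial>distr P borel X) = 0" using zero distr by simp
  then show ?thesis using X g by (simp add: integral_distr)
qed

context ordinate_cell
begin

definition cell_op :: "real \<Rightarrow> (real \<Rightarrow> real) \<Rightarrow> real \<Rightarrow> real" where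
  "cell_op t \<phi> x = (\<integral>y. cell_kernel t (depth x) (depth y) * (albedo y * \<phi> y) \<partial>H)"

lemma len_le_1: "len \<le> 1"
proof -
  have "len \<le> measure lborel {-1..0::real}"
    by (rule measure_mono_fmeasurable) (use cell_subset \<delta> cell_borel in \<open>auto simp: fmeasurable_def emeasure_lborel_Icc_eq\<close>)
  then show ?thesis by simp
qed

lemma cell_op_has_bounded_kernel:
  assumes R: "0 < R" "\<forall>x\<in>{xL..xR}. \<bar>albedo x\<bar> \<le> R" and t: "\<delta> \<le> \<bar>t\<bar>"
  shows "has_bounded_kernel H (cell_op t) (\<lambda>x y. cell_kernel t (depth x) (depth y) * albedo y) (2 * \<bar>cell_scale\<bar> / \<delta> * R)"
  unfolding has_bounded_kernel_def
proof (intro conjI ballI)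
  have "(\<lambda>p. cell_kernel t (depth (fst p)) (depth (snd p)) * albedo (snd p)) \<in> borel_measurable (H \<Otimes>\<^sub>M H)"
    by (intro borel_measurable_times cell_kernel_measurable borel_measurable_const measurable_compose[OF measurable_fst depth_measurable]
        measurable_compose[OF measurable_snd depth_measurable] measurable_compose[OF measurable_snd albedo_measurable])
  then show "(\<lambda>(x, y). cell_kernel t (depth x) (depth y) * albedo y) \<in> borel_measurable (H \<Otimes>\<^sub>M H)"
    by (simp add: case_prod_unfold)
  fix x y assume "y \<in> space H"
  then have y: "y \<in> {xL..xR}" by (simp add: H_simps)
  have "\<bar>cell_kernel t (depth x) (depth y)\<bar> \<le> 2 * \<bar>cell_scale\<bar> * len / \<delta>" by (rule cell_kernel_bound[OF t])
  also have "\<dots> \<le> 2 * \<bar>cell_scale\<bar> * 1 / \<delta>"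
    using \<delta>(1) len_le_1 by (intro divide_right_mono mult_left_mono) auto
  finally show "\<bar>cell_kernel t (depth x) (depth y) * albedo y\<bar> \<le> 2 * \<bar>cell_scale\<bar> / \<delta> * R"
    unfolding abs_mult[of "cell_kernel t (depth x) (depth y)"] using R(2) y \<delta>(1) by (intro mult_mono) auto
qed (simp add: cell_op_def mult.assoc)

lemma cell_op_kernel_lipschitz:
  assumes R: "0 < R" "\<forall>x\<in>{xL..xR}. \<bar>albedo x\<bar> \<le> R" and t: "t \<le> - \<delta>" "t' \<le> - \<delta>" and y: "y \<in> {xL..xR}"
  shows "\<bar>cell_kernel t a b * albedo y - cell_kernel t' a b * albedo y\<bar> \<le> \<bar>cell_scale\<bar> / \<delta>\<^sup>2 * R * \<bar>t - t'\<bar>"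
proof -
  have "\<bar>cell_kernel t a b - cell_kernel t' a b\<bar> \<le> \<bar>cell_scale\<bar> * len / \<delta>\<^sup>2 * \<bar>t - t'\<bar>"
    by (rule cell_kernel_lipschitz[OF t])
  also have "\<dots> \<le> \<bar>cell_scale\<bar> * 1 / \<delta>\<^sup>2 * \<bar>t - t'\<bar>"
    using len_le_1 by (intro mult_right_mono divide_right_mono mult_left_mono) auto
  finally have "\<bar>cell_kernel t a b - cell_kernel t' a b\<bar> * \<bar>albedo y\<bar> \<le> (\<bar>cell_scale\<bar> / \<delta>\<^sup>2 * \<bar>t - t'\<bar>) * R"
    using R(2) y by (intro mult_mono) auto
  then show ?thesis unfolding left_diff_distrib[symmetric] abs_mult by (simp only: mult_ac)
qed

lemma cell_op_mean_zero:
  assumes "\<phi> \<in> L2 H" "\<psi> \<in> L2 H"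
  shows "(LBINT t:I. L2_inner H (cell_op t \<phi>) \<psi>) = 0"
  using cell_kernel_apply_mean_zero[OF assms] by (simp add: L2_inner_def cell_op_def)

lemma delta_op_at_eq_cell_op:
  assumes "\<mu> l = t" "\<mu> (2 * m + 1 - l) = - t" "\<delta> \<le> \<bar>t\<bar>" "\<phi> \<in> L2 H" "x \<in> space H"
  shows "delta_op_at (transport_op xL xR \<sigma>S \<sigma>T) \<delta> m S \<mu> l \<phi> x = cell_op t \<phi> x"
  unfolding cell_op_def by (rule delta_op_at_kernel[OF assms(1-4)]) (use assms(5) in \<open>simp add: H_simps\<close>)

end

section \<open>The expected squared norm of the fluctuation\<close>

theorem theorem4p8:
  fixes xL xR \<delta> :: real
    and \<sigma>S \<sigma>T :: "real \<Rightarrow> real"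
    and m :: nat
    and S :: "nat \<Rightarrow> real set"
    and P :: "'w measure"
    and \<mu> :: "nat \<Rightarrow> 'w \<Rightarrow> real"
  assumes "xL < xR"
    and "\<sigma>S \<in> borel_measurable (lebesgue_on {xL..xR})"
    and "\<sigma>T \<in> borel_measurable (lebesgue_on {xL..xR})"
    and "\<exists>c C. 0 < c \<and> (\<forall>x\<in>{xL..xR}. c \<le> \<sigma>S x \<and> \<sigma>S x \<le> C)"
    and "\<exists>c C. 0 < c \<and> (\<forall>x\<in>{xL..xR}. c \<le> \<sigma>T x \<and> \<sigma>T x \<le> C)"
    and "\<forall>x\<in>{xL..xR}. \<sigma>S x \<le> \<sigma>T x"
    and "scattering_ratio xL xR \<sigma>S \<sigma>T \<in> {0<..<1}"
    and "\<delta> \<in> {0<..<1}"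
    and "m \<ge> 1"
    and "\<And>l. l \<in> {1..m} \<Longrightarrow> is_interval (S l)"
    and "disjoint_family_on S {1..m}"
    and "(\<Union>l\<in>{1..m}. S l) = {-1..<-\<delta>}"
    and "\<And>l. l \<in> {1..m} \<Longrightarrow> S (2 * m + 1 - l) = uminus ` S l"
    and "prob_space P"
    and "prob_space.indep_vars P (\<lambda>_. borel) \<mu> {1..m}"
    and "\<And>l \<xi>. l \<in> {1..m} \<Longrightarrow> \<xi> \<in> space P \<Longrightarrow> \<mu> l \<xi> \<in> S l"
    and "\<And>l. l \<in> {1..m} \<Longrightarrow> distr P borel (\<mu> l) = uniform_measure lborel (S l)"
    and "\<And>l \<xi>. l \<in> {1..m} \<Longrightarrow> \<xi> \<in> space P \<Longrightarrow> \<mu> (2 * m + 1 - l) \<xi> = - \<mu> l \<xi>"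
  shows "let H = transport_measure xL xR \<sigma>T;
             A = transport_op xL xR \<sigma>S \<sigma>T;
             \<delta>T = (\<lambda>\<xi>. delta_op A \<delta> m S (\<lambda>k. \<mu> k \<xi>));
             \<delta>Tl = (\<lambda>\<xi> l. delta_op_at A \<delta> m S (\<lambda>k. \<mu> k \<xi>) l);
             sqnorms = (\<lambda>\<xi>. \<Sum>l = 1..m. (L2_onorm H (\<delta>Tl \<xi> l))\<^sup>2);
             traces = (\<lambda>\<xi>. \<Sum>l = 1..m. L2_trace H (L2_adjoint H (\<delta>Tl \<xi> l) \<circ> \<delta>Tl \<xi> l));
             lhs = (\<lambda>\<xi>. (L2_onorm H (\<delta>T \<xi>))\<^sup>2);
             rhs = (\<lambda>\<xi>. if sqnorms \<xi> = 0 then 0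
                        else (ln ((1 / real m * traces \<xi>) / (1 / real m * sqnorms \<xi>)) + 2.7)
                             * (1 / (real m)\<^sup>2 * sqnorms \<xi>))
         in integrable P lhs \<and> integrable P rhs \<and>
            prob_space.expectation P lhs \<le> 8 * prob_space.expectation P rhs"
proof -
  interpret transport_medium xL xR \<sigma>S \<sigma>T by unfold_locales (use assms(1-5) in auto)
  interpret finite_measure H by (rule finite_measure_H)
  have \<delta>: "0 < \<delta>" "\<delta> < 1" using assms(8) by auto
  have cell: "ordinate_cell xL xR \<sigma>S \<sigma>T \<delta> m S l" if l: "l \<in> {1..m}" for l
  proof
    show "0 < \<delta>" "\<delta> < 1" by fact+
    show "S l \<in> sets borel" by (rule real_interval_borel_measurable[OF assms(10)[OF l]])
    show "S l \<subseteq> {-1..<-\<delta>}" using assms(12) l by blast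
    show "S (2 * m + 1 - l) = uminus ` S l" by (rule assms(13)[OF l])
  qed
  obtain R where R: "0 < R" "\<forall>x\<in>{xL..xR}. \<bar>albedo x\<bar> \<le> R" by (rule albedo_bounded)
  define c where "c = real (2 * m) / measure lborel (ordinate_domain \<delta>)"
  define B where "B = 2 * \<bar>c\<bar> / \<delta> * R + \<bar>c\<bar> / \<delta>\<^sup>2 * R"
  have B0: "0 \<le> B" using \<delta> R(1) by (simp add: B_def)
  \<comment> \<open>Clamping the ordinate to \<open>[-1, -\<delta>]\<close> makes the kernels bounded and Lipschitz on the whole real line
    and does not affect the ordinates of the theorem.\<close>
  define clamp where "clamp t = max (-1) (min t (- \<delta>))" for t :: real
  have clamp: "clamp t \<le> - \<delta>" "\<delta> \<le> \<bar>clamp t\<bar>" for t using \<delta> by (auto simp: clamp_def)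
  have clamp_lip: "\<bar>clamp t - clamp t'\<bar> \<le> \<bar>t - t'\<bar>" for t t' by (auto simp: clamp_def max_def min_def)
  have clamp_id: "clamp t = t" if "t \<in> S l" "l \<in> {1..m}" for t l
    using ordinate_cell.cell_subset[OF cell[OF that(2)]] that(1) by (force simp: clamp_def max_def min_def)
  define T where "T l t = ordinate_cell.cell_op xL xR \<sigma>S \<sigma>T \<delta> m S l (clamp t)" for l t
  define k where "k l t x y = ordinate_cell.cell_kernel \<delta> m S l (clamp t) (depth x) (depth y) * albedo y" for l t x y
  have T: "has_bounded_kernel H (T l t) (k l t) B" if l: "l \<in> {1..m}" for l t
  proof -
    have "has_bounded_kernel H (T l t) (k l t) (2 * \<bar>c\<bar> / \<delta> * R)"
      unfolding T_def k_def[abs_def] c_def by (rule ordinate_cell.cell_op_has_bounded_kernel[OF cell[OF l] R clamp(2)])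
    moreover have "2 * \<bar>c\<bar> / \<delta> * R \<le> B" using \<delta> R(1) by (simp add: B_def)
    ultimately show ?thesis unfolding has_bounded_kernel_def by (meson order_trans)
  qed
  have lip: "\<bar>k l t x y - k l t' x y\<bar> \<le> B * \<bar>t - t'\<bar>" if "l \<in> {1..m}" "y \<in> space H" for l t t' x y
  proof -
    have "\<bar>k l t x y - k l t' x y\<bar> \<le> \<bar>c\<bar> / \<delta>\<^sup>2 * R * \<bar>clamp t - clamp t'\<bar>"
      unfolding k_def c_def using that(2)
      by (intro ordinate_cell.cell_op_kernel_lipschitz[OF cell[OF that(1)] R clamp(1) clamp(1)]) (simp add: H_simps)
    also have "\<dots> \<le> B * \<bar>t - t'\<bar>"
      using \<delta> R(1) clamp_lip by (intro mult_mono) (auto simp: B_def)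
    finally show ?thesis .
  qed
  have rv: "\<mu> l \<in> borel_measurable P" if "l \<in> {1..m}" for l
    using assms(15) that unfolding prob_space.indep_vars_def[OF assms(14)] by blast
  have zero: "(\<integral>\<omega>. L2_inner H (T l (\<mu> l \<omega>) (fst d)) (snd d) \<partial>P) = 0"
    if l: "l \<in> {1..m}" and d: "d \<in> L2_test_pairs H" for l d
  proof (rule expectation_uniform_mean_zero[OF assms(14) rv[OF l] ordinate_cell.cell_borel[OF cell[OF l]]
        ordinate_cell.cell_finite[OF cell[OF l]] assms(17)[OF l]])
    show "(\<lambda>t. L2_inner H (T l t (fst d)) (snd d)) \<in> borel_measurable borel"
    proof (rule lipschitz_borel_measurable)
      show "\<bar>L2_inner H (T l t (fst d)) (snd d) - L2_inner H (T l t' (fst d)) (snd d)\<bar> \<le> (B * measure H (space H)) * \<bar>t - t'\<bar>" for t t'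
        using kernel_perturbation(2)[OF T[OF l] T[OF l] lip[OF l] _ d, of t t'] B0 by (simp add: mult_ac)
    qed (use B0 in simp)
    have dL: "fst d \<in> L2 H" "snd d \<in> L2 H" using d by (auto simp: L2_test_pairs_def)
    have "(LBINT t:S l. L2_inner H (T l t (fst d)) (snd d)) = (LBINT t:S l. L2_inner H (ordinate_cell.cell_op xL xR \<sigma>S \<sigma>T \<delta> m S l t (fst d)) (snd d))"
      by (rule set_lebesgue_integral_cong) (use ordinate_cell.cell_borel[OF cell[OF l]] clamp_id[OF _ l] in \<open>auto simp: T_def\<close>)
    also have "\<dots> = 0" by (rule ordinate_cell.cell_op_mean_zero[OF cell[OF l] dL])
    finally show "(LBINT t:S l. L2_inner H (T l t (fst d)) (snd d)) = 0" .
  qed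
  define E where "E = (SOME E. L2_onb H E)"
  have onb: "L2_onb H E" unfolding E_def by (rule someI_ex[OF L2_onb_exists])
  define V where "V \<omega> = (\<Sum>l\<in>{1..m}. (L2_onorm H (T l (\<mu> l \<omega>)))\<^sup>2)" for \<omega>
  define W where "W \<omega> = (\<Sum>l\<in>{1..m}. \<Sum>\<^sub>\<infinity>e\<in>E. (L2_norm H (T l (\<mu> l \<omega>) e))\<^sup>2)" for \<omega>
  define lhs' where "lhs' \<omega> = (L2_onorm H (\<lambda>f x. \<Sum>l\<in>{1..m}. T l (\<mu> l \<omega>) f x))\<^sup>2" for \<omega>
  define rhs' where "rhs' \<omega> = (if V \<omega> = 0 then 0 else (ln (W \<omega> / V \<omega>) + 2.7) * V \<omega>)" for \<omega>
  have ne: "{1..m} \<noteq> {}" using assms(9) by auto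
  have main: "integrable P lhs'" "integrable P rhs'" "(\<integral>\<omega>. lhs' \<omega> \<partial>P) \<le> 8 * (\<integral>\<omega>. rhs' \<omega> \<partial>P)"
    unfolding lhs'_def[abs_def] rhs'_def[abs_def] V_def W_def
    using random_operator_second_moment[OF assms(14) finite_atLeastAtMost ne assms(15) T lip B0 zero onb] by blast+
  let ?A = "transport_op xL xR \<sigma>S \<sigma>T"
  let ?Tl = "\<lambda>\<xi> l. delta_op_at ?A \<delta> m S (\<lambda>k. \<mu> k \<xi>) l"
  have Tl: "?Tl \<xi> l f x = T l (\<mu> l \<xi>) f x"
    if "\<xi> \<in> space P" "l \<in> {1..m}" "f \<in> L2 H" "x \<in> space H" for \<xi> l f x
  proof -
    have \<mu>S: "\<mu> l \<xi> \<in> S l" by (rule assms(16)[OF that(2,1)])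
    show ?thesis
      unfolding T_def clamp_id[OF \<mu>S that(2)]
      by (rule ordinate_cell.delta_op_at_eq_cell_op[OF cell[OF that(2)] refl assms(18)[OF that(2,1)] _ that(3,4)])
        (use ordinate_cell.cell_distance(1)[OF cell[OF that(2)] \<mu>S] in simp)
  qed
  have onorm_Tl: "L2_onorm H (?Tl \<xi> l) = L2_onorm H (T l (\<mu> l \<xi>))" if "\<xi> \<in> space P" "l \<in> {1..m}" for \<xi> l
    by (rule L2_onorm_cong) (rule Tl[OF that])
  have trace_Tl: "L2_trace H (L2_adjoint H (?Tl \<xi> l) \<circ> ?Tl \<xi> l) = (\<Sum>\<^sub>\<infinity>e\<in>E. (L2_norm H (T l (\<mu> l \<xi>) e))\<^sup>2)"
    if "\<xi> \<in> space P" "l \<in> {1..m}" for \<xi> l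
  proof -
    have "has_bounded_kernel H (?Tl \<xi> l) (k l (\<mu> l \<xi>)) B"
      using T[OF that(2), of "\<mu> l \<xi>"] Tl[OF that] by (simp add: has_bounded_kernel_def)
    from L2_trace_adjoint_comp[OF this]
    have "L2_trace H (L2_adjoint H (?Tl \<xi> l) \<circ> ?Tl \<xi> l) = (\<Sum>\<^sub>\<infinity>e\<in>E. (L2_norm H (?Tl \<xi> l e))\<^sup>2)" by (simp add: E_def)
    also have "\<dots> = (\<Sum>\<^sub>\<infinity>e\<in>E. (L2_norm H (T l (\<mu> l \<xi>) e))\<^sup>2)"
    proof (rule infsum_cong)
      fix e assume "e \<in> E"
      then have "L2_norm H (?Tl \<xi> l e) = L2_norm H (T l (\<mu> l \<xi>) e)"
        by (intro L2_norm_cong Tl[OF that] onb_L2[OF onb])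
      then show "(L2_norm H (?Tl \<xi> l e))\<^sup>2 = (L2_norm H (T l (\<mu> l \<xi>) e))\<^sup>2" by simp
    qed
    finally show ?thesis .
  qed
  have m0: "0 < 1 / real m" using assms(9) by simp
  have lhs_eq: "(L2_onorm H (delta_op ?A \<delta> m S (\<lambda>k. \<mu> k \<xi>)))\<^sup>2 = (1 / real m)\<^sup>2 * lhs' \<xi>" if \<xi>: "\<xi> \<in> space P" for \<xi>
  proof -
    have "L2_onorm H (delta_op ?A \<delta> m S (\<lambda>k. \<mu> k \<xi>)) = L2_onorm H (\<lambda>f x. 1 / real m * (\<Sum>l\<in>{1..m}. T l (\<mu> l \<xi>) f x))"
      by (rule L2_onorm_cong) (simp add: delta_op_def Tl[OF \<xi>] cong: sum.cong_simp)
    also have "\<dots> = 1 / real m * L2_onorm H (\<lambda>f x. \<Sum>l\<in>{1..m}. T l (\<mu> l \<xi>) f x)"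
      by (rule L2_onorm_cmult[OF has_bounded_kernel_sum m0]) (rule T)
    finally show ?thesis unfolding lhs'_def by (simp only: power_mult_distrib)
  qed
  let ?sq = "\<lambda>\<xi>. \<Sum>l = 1..m. (L2_onorm H (?Tl \<xi> l))\<^sup>2"
  let ?tr = "\<lambda>\<xi>. \<Sum>l = 1..m. L2_trace H (L2_adjoint H (?Tl \<xi> l) \<circ> ?Tl \<xi> l)"
  have rhs_eq: "(if ?sq \<xi> = 0 then 0 else (ln ((1 / real m * ?tr \<xi>) / (1 / real m * ?sq \<xi>)) + 2.7) * (1 / (real m)\<^sup>2 * ?sq \<xi>))
     = (1 / real m)\<^sup>2 * rhs' \<xi>" if \<xi>: "\<xi> \<in> space P" for \<xi>
  proof -
    have sq: "?sq \<xi> = V \<xi>" unfolding V_def by (intro sum.cong refl) (simp only: onorm_Tl[OF \<xi>])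
    have tr: "?tr \<xi> = W \<xi>" unfolding W_def by (intro sum.cong refl) (simp only: trace_Tl[OF \<xi>])
    have q: "(1 / real m * W \<xi>) / (1 / real m * V \<xi>) = W \<xi> / V \<xi>"
      using m0 by (intro mult_divide_mult_cancel_left) simp
    show ?thesis unfolding sq tr q rhs'_def by (simp add: power_divide mult_ac)
  qed
  have "integrable P (\<lambda>\<xi>. (L2_onorm H (delta_op ?A \<delta> m S (\<lambda>k. \<mu> k \<xi>)))\<^sup>2)"
    by (subst Bochner_Integration.integrable_cong[OF refl lhs_eq]) (use main(1) in auto)
  moreover have "integrable P (\<lambda>\<xi>. if ?sq \<xi> = 0 then 0 else (ln ((1 / real m * ?tr \<xi>) / (1 / real m * ?sq \<xi>)) + 2.7) * (1 / (real m)\<^sup>2 * ?sq \<xi>))"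
    by (subst Bochner_Integration.integrable_cong[OF refl rhs_eq]) (use main(2) in auto)
  moreover have "(\<integral>\<xi>. (L2_onorm H (delta_op ?A \<delta> m S (\<lambda>k. \<mu> k \<xi>)))\<^sup>2 \<partial>P) = (1 / real m)\<^sup>2 * (\<integral>\<xi>. lhs' \<xi> \<partial>P)"
    by (subst Bochner_Integration.integral_cong[OF refl lhs_eq]) auto
  moreover have "(\<integral>\<xi>. (if ?sq \<xi> = 0 then 0 else (ln ((1 / real m * ?tr \<xi>) / (1 / real m * ?sq \<xi>)) + 2.7) * (1 / (real m)\<^sup>2 * ?sq \<xi>)) \<partial>P)
     = (1 / real m)\<^sup>2 * (\<integral>\<xi>. rhs' \<xi> \<partial>P)"
    by (subst Bochner_Integration.integral_cong[OF refl rhs_eq]) auto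
  moreover have "(1 / real m)\<^sup>2 * (\<integral>\<xi>. lhs' \<xi> \<partial>P) \<le> 8 * ((1 / real m)\<^sup>2 * (\<integral>\<xi>. rhs' \<xi> \<partial>P))"
    using mult_left_mono[OF main(3), of "(1 / real m)\<^sup>2"] by (simp add: mult_ac)
  ultimately show ?thesis unfolding Let_def by simp
qed

end
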